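(* Let $R$ be a triangle with side lengths $(a,b,c)$ and respective opposite angles $(\alpha,\beta,\gamma)$, where $\gamma = 2\pi/3$ and $R$ has non-commensurable angles. Suppose a triangle $ABC$ is tiled by $R$, and $ABC$ is not similar to $R$. Then $R$ has commensurable sides.
   Context: A tiling of a triangle (or polygon) $ABC$ by a triangle $R$ (the tile) is an expression of $ABC$ as a union of non-overlapping congruent copies of $R$. A triangle has commensurable angles if all its angles are rational multiples of $\pi$, and non-commensurable angles otherwise. It has commensurable sides if all pairwise ratios of its side lengths are rational. *)

theory Defs
  imports "HOL-Analysis.Analysis"
begin

text \<open>The unoriented angle at the middle point \<open>Y\<close>, with values in \<open>[0, pi]\<close>;
  it is meant for \<open>X \<noteq> Y\<close> and \<open>Z \<noteq> Y\<close>.\<close>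

definition angle :: "real^2 \<Rightarrow> real^2 \<Rightarrow> real^2 \<Rightarrow> real" where
  "angle X Y Z = arccos (((X - Y) \<bullet> (Z - Y)) / (norm (X - Y) * norm (Z - Y)))"

definition is_triangle :: "real^2 \<Rightarrow> real^2 \<Rightarrow> real^2 \<Rightarrow> bool" where
  "is_triangle X Y Z \<longleftrightarrow> \<not> collinear {X, Y, Z}"

definition triangle_region :: "real^2 \<Rightarrow> real^2 \<Rightarrow> real^2 \<Rightarrow> (real^2) set" where
  "triangle_region X Y Z = convex hull {X, Y, Z}"

definition similar :: "(real^2) set \<Rightarrow> (real^2) set \<Rightarrow> bool" where
  "similar S T \<longleftrightarrow>
     (\<exists>k>0. \<exists>f :: real^2 \<Rightarrow> real^2. (\<forall>x y. dist (f x) (f y) = k * dist x y) \<and> f ` S = T)"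

text \<open>Isometries may reverse orientation, so mirror images count as congruent.\<close>

definition congruent_sets :: "(real^2) set \<Rightarrow> (real^2) set \<Rightarrow> bool" where
  "congruent_sets S T \<longleftrightarrow>
     (\<exists>f :: real^2 \<Rightarrow> real^2. (\<forall>x y. dist (f x) (f y) = dist x y) \<and> f ` S = T)"

text \<open>Tiles may meet in arbitrary boundary pieces: a tiling need not be edge-to-edge.
  Finiteness is not demanded; for a bounded \<open>P\<close> and a tile \<open>R\<close> with nonempty interior
  it follows by comparing areas.\<close>

definition is_tiling :: "(real^2) set set \<Rightarrow> (real^2) set \<Rightarrow> (real^2) set \<Rightarrow> bool" where
  "is_tiling \<T> P R \<longleftrightarrow>
     (\<forall>T\<in>\<T>. congruent_sets R T) \<and>
     pairwise (\<lambda>S T. interior S \<inter> interior T = {}) \<T> \<and>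
     \<Union>\<T> = P"

definition tiled_by :: "(real^2) set \<Rightarrow> (real^2) set \<Rightarrow> bool" where
  "tiled_by P R \<longleftrightarrow> (\<exists>\<T>. is_tiling \<T> P R)"

definition commensurable_angles :: "real^2 \<Rightarrow> real^2 \<Rightarrow> real^2 \<Rightarrow> bool" where
  "commensurable_angles X Y Z \<longleftrightarrow>
     (\<forall>\<theta>\<in>{angle Y X Z, angle X Y Z, angle X Z Y}. \<exists>q\<in>\<rat>. \<theta> = q * pi)"

definition commensurable_sides :: "real^2 \<Rightarrow> real^2 \<Rightarrow> real^2 \<Rightarrow> bool" where
  "commensurable_sides X Y Z \<longleftrightarrow>
     (\<forall>s\<in>{dist Y Z, dist X Z, dist X Y}. \<forall>t\<in>{dist Y Z, dist X Z, dist X Y}. s / t \<in> \<rat>)"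

end

theory Submission
  imports Defs "HOL-Library.Multiset"
begin

text \<open>A function \<open>F p q\<close> of directed segments that is additive along lines has the same total over the
  counterclockwise tile edges as over the edges of the big triangle: inner edges cancel. Two choices of \<open>F\<close>
  matter: viewing angles and twisted lengths.

  The angle under which \<open>p q\<close> is seen from a point \<open>w\<close> yields the equation of angles at \<open>w\<close>.
  As \<open>\<alpha> + \<beta> = \<pi>/3\<close> and \<open>\<alpha>/\<pi>\<close> is irrational, a vertex that is not a corner meets as many
  \<open>\<alpha>\<close> as \<open>\<beta>\<close>, and the corners together take three of each and no \<open>2\<pi>/3\<close> (otherwise the
  big triangle is similar to the tile). Since every tile has one angle of each kind, points with three
  angles \<open>2\<pi>/3\<close> (stars) outnumber the points with three \<open>\<alpha>\<close>, three \<open>\<beta>\<close> and no \<open>2\<pi>/3\<close>.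

  Suppose no side relation \<open>m a = i a + j b + k c\<close> with \<open>j + k > 0\<close> holds. If at a vertex two edges leave in the
  same direction on both sides of a line, exactly one of them of length \<open>a\<close>, then the run of \<open>a\<close>-edges
  starting there ends in the interior of an edge on the other side. Such runs start at every star, and every
  run ending at a point with one angle of each kind continues as a new run from that point; so the runs
  inject the stars into the points with three \<open>\<alpha>\<close> and three \<open>\<beta>\<close>, a contradiction. The relation for \<open>a\<close> and
  the one for \<open>b\<close> make \<open>b/a\<close> rational.

  Suppose \<open>c/a\<close> is irrational, and take \<open>F p q = \<phi> |q - p| \<chi> (q - p)\<close>, where \<open>\<chi>\<close> is a character of directions
  with \<open>\<chi>(e^(i \<alpha>)) = 1\<close>, \<open>\<chi>(e^(i \<beta>)) = -1\<close> and \<open>\<phi>\<close> is \<open>\<rat>\<close>-linear with \<open>\<phi>(a - b + c) = 0\<close>. The tiles contribute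
  nothing, so a signed perimeter of the big triangle is a rational multiple of \<open>a - b + c\<close>; exchanging \<open>\<alpha>\<close> and
  \<open>\<beta>\<close> gives a second one that is a rational multiple of \<open>b - a + c\<close>. Each of the four numbers is, by the law of
  sines, a signed sum of the sines of the angles of a triangle, hence up to sign four times a product of sines
  and cosines of half angles. Multiplied crosswise, the two proportions compare numbers that are conjugate in
  \<open>\<rat>(c/a)\<close> and have a rational ratio; so these agree up to sign. The resulting equation between half-angle
  products fails for every admissible triple of corner angles.\<close>

section \<open>Lines in the complex plane\<close>

definition ray :: "complex \<Rightarrow> complex \<Rightarrow> real \<Rightarrow> complex" where
  "ray v u t = v + of_real t * u"

definition line :: "complex \<Rightarrow> complex \<Rightarrow> complex set" where
  "line v u = range (ray v u)"

text \<open>Positive to the left of the line through \<open>v\<close> in direction \<open>u\<close>.\<close>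

definition side :: "complex \<Rightarrow> complex \<Rightarrow> complex \<Rightarrow> real" where
  "side v u z = Im (cnj u * (z - v))"

text \<open>The edge from \<open>x\<close> to \<open>y\<close> covers an initial piece of the ray from \<open>v\<close> in direction \<open>u\<close>.\<close>

definition covers_ray :: "complex \<Rightarrow> complex \<Rightarrow> complex \<Rightarrow> complex \<Rightarrow> bool" where
  "covers_ray v u x y \<longleftrightarrow> norm u = 1 \<and> (\<exists>s t. s \<le> 0 \<and> 0 < t \<and> x = ray v u s \<and> y = ray v u t)"

definition line_additive :: "(complex \<Rightarrow> complex \<Rightarrow> 'a::real_vector) \<Rightarrow> bool" where
  "line_additive F \<longleftrightarrow>
     (\<forall>v u r s t. F (ray v u r) (ray v u s) + F (ray v u s) (ray v u t) = F (ray v u r) (ray v u t))"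

lemma ray_0 [simp]: "ray v u 0 = v"
  by (simp add: ray_def)

lemma ray_ray [simp]: "ray (ray v u s) u t = ray v u (s + t)"
  by (simp add: ray_def algebra_simps)

lemma ray_diff: "ray v u t - ray v u s = of_real (t - s) * u"
  by (simp add: ray_def algebra_simps)

lemma ray_uminus: "ray v (- u) t = ray v u (- t)"
  by (simp add: ray_def)

lemma ray_eq_iff: "u \<noteq> 0 \<Longrightarrow> ray v u s = ray v u t \<longleftrightarrow> s = t"
  by (simp add: ray_def)

lemma ray_to: "ray x (sgn (y - x)) (norm (y - x)) = y"
  by (cases "x = y") (simp_all add: ray_def sgn_eq)

lemma sgn_ray_diff: "norm u = 1 \<Longrightarrow> s < t \<Longrightarrow> sgn (ray v u t - ray v u s) = u"
  by (simp add: ray_diff sgn_mult sgn_of_real sgn_eq[of u] del: of_real_diff)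

lemma sgn_diff_commute: "sgn (x - y) = - sgn (y - x)" for x y :: complex
  by (metis minus_diff_eq sgn_minus)

lemma ray_in_open_segment_iff:
  assumes "u \<noteq> 0" "s < t"
  shows "ray v u r \<in> open_segment (ray v u s) (ray v u t) \<longleftrightarrow> s < r \<and> r < t"
proof -
  have "(1 - w) *\<^sub>R ray v u s + w *\<^sub>R ray v u t = ray v u (s + w * (t - s))" for w
    by (simp add: ray_def scaleR_conv_of_real algebra_simps)
  then have "ray v u r \<in> open_segment (ray v u s) (ray v u t) \<longleftrightarrow> (\<exists>w. 0 < w \<and> w < 1 \<and> r = s + w * (t - s))"
    using assms by (auto simp: in_segment ray_eq_iff)
  also have "\<dots> \<longleftrightarrow> s < r \<and> r < t"
  proof
    assume "s < r \<and> r < t"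
    then show "\<exists>w. 0 < w \<and> w < 1 \<and> r = s + w * (t - s)"
      by (intro exI[of _ "(r - s) / (t - s)"]) auto
  next
    assume "\<exists>w. 0 < w \<and> w < 1 \<and> r = s + w * (t - s)"
    then obtain w where "0 < w" "w < 1" "r = s + w * (t - s)" by blast
    moreover from this have "0 < w * (t - s)" "w * (t - s) < t - s" using \<open>s < t\<close> by simp_all
    ultimately show "s < r \<and> r < t" by linarith
  qed
  finally show ?thesis .
qed

lemma open_segment_rayE:
  assumes "v \<in> open_segment x y"
  obtains t where "0 < t" "t < norm (y - x)" "v = ray x (sgn (y - x)) t"
proof -
  obtain w where w: "0 < w" "w < 1" "v = (1 - w) *\<^sub>R x + w *\<^sub>R y" and "x \<noteq> y"
    using assms by (auto simp: in_segment)
  have "of_real (w * norm (y - x)) * sgn (y - x) = of_real w * (y - x)"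
    by (simp add: sgn_eq)
  then have "v = ray x (sgn (y - x)) (w * norm (y - x))"
    unfolding ray_def by (simp only:) (simp add: w scaleR_conv_of_real algebra_simps)
  then show thesis using w \<open>x \<noteq> y\<close> that[of "w * norm (y - x)"] by simp
qed

lemma line_ray [simp]: "line (ray v u s) u = line v u"
proof -
  have "range (ray (ray v u s) u) = ray v u ` range ((+) s)"
    unfolding image_image by (intro image_cong) simp_all
  then show ?thesis by (simp add: line_def)
qed

lemma line_uminus: "line v (- u) = line v u"
proof -
  have "ray v u t \<in> range (ray v (- u))" for u t
    using ray_uminus[of v u "- t"] by (metis minus_minus rangeI)
  from this[of u] this[of "- u"] show ?thesis by (auto simp: line_def)
qed

lemma ray_in_line [simp]: "ray v u t \<in> line v u"
  by (simp add: line_def)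

lemma line_self [simp]: "v \<in> line v u"
  using ray_in_line[of v u 0] by simp

lemma line_eq_imp_direction:
  assumes "line v u = line v u'" "norm u = 1" "norm u' = 1"
  shows "u' = u \<or> u' = - u"
proof -
  have "ray v u' 1 \<in> line v u" using assms(1) by simp
  then obtain t where "ray v u' 1 = ray v u t" unfolding line_def by blast
  then have t: "u' = of_real t * u" by (simp add: ray_def)
  then have "\<bar>t\<bar> = 1" using assms by (simp add: norm_mult)
  then show ?thesis using t by (auto simp: abs_if split: if_splits)
qed

lemma side_ray [simp]: "side v u (ray v u t) = 0"
  by (simp add: side_def ray_def)

lemma tendsto_ray: "(ray p w \<longlongrightarrow> p) (at_right 0)"
proof -
  have "((\<lambda>t. p + of_real t * w) \<longlongrightarrow> p + of_real 0 * w) (at_right 0)" by (intro tendsto_intros)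
  then show ?thesis by (simp add: ray_def[abs_def])
qed

lemma eventually_ray: "eventually P (nhds p) \<Longrightarrow> \<forall>\<^sub>F t in at_right 0. P (ray p w t)"
  by (rule eventually_compose_filterlim[OF _ tendsto_ray])

lemma eventually_ray_notin:
  assumes "finite S" "u \<noteq> 0"
  shows "\<forall>\<^sub>F t in at_right 0. ray v u t \<notin> S"
proof -
  have "\<forall>\<^sub>F t in at_right 0. ray v u t \<noteq> w" for w
  proof (cases "w \<in> ray v u ` {0<..}")
    case True
    then obtain s where "0 < s" "w = ray v u s" by auto
    then show ?thesis using eventually_at_right_real[of 0 s] assms(2)
      by (auto elim!: eventually_mono simp: ray_eq_iff)
  next
    case False
    then show ?thesis by (auto intro: eventually_mono[OF eventually_at_right_less])
  qed
  then have "\<forall>\<^sub>F t in at_right 0. \<forall>w\<in>S. ray v u t \<noteq> w"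
    using assms(1) by (intro eventually_ball_finite) auto
  then show ?thesis by (auto elim: eventually_mono)
qed

lemma covers_ray_iff: "covers_ray v u x y \<longleftrightarrow> x \<noteq> y \<and> sgn (y - x) = u \<and> (x = v \<or> v \<in> open_segment x y)"
proof
  assume "covers_ray v u x y"
  then obtain s t where st: "s \<le> 0" "0 < t" "x = ray v u s" "y = ray v u t" and u: "norm u = 1"
    unfolding covers_ray_def by blast
  have "u \<noteq> 0" using u by auto
  then show "x \<noteq> y \<and> sgn (y - x) = u \<and> (x = v \<or> v \<in> open_segment x y)"
    using ray_in_open_segment_iff[of u s t v 0] st u by (auto simp: ray_eq_iff sgn_ray_diff order_less_le)
next
  assume edge: "x \<noteq> y \<and> sgn (y - x) = u \<and> (x = v \<or> v \<in> open_segment x y)"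
  define l where "l = norm (y - x)"
  have l: "0 < l" "y = ray x u l" and u: "norm u = 1"
    using edge ray_to[of x y] by (auto simp: l_def norm_sgn)
  have "\<exists>t. 0 \<le> t \<and> t < l \<and> v = ray x u t"
  proof (cases "x = v")
    case True
    then show ?thesis using l by (auto intro: exI[of _ 0])
  next
    case False
    then have "v \<in> open_segment x y" using edge by blast
    then show ?thesis using edge by (auto simp: l_def elim!: open_segment_rayE intro: less_imp_le)
  qed
  then obtain t where "0 \<le> t" "t < l" "v = ray x u t" by blast
  then have "x = ray v u (- t)" "y = ray v u (l - t)" using l by simp_all
  then show "covers_ray v u x y"
    unfolding covers_ray_def using u \<open>0 \<le> t\<close> \<open>t < l\<close> by (intro conjI exI[of _ "- t"] exI[of _ "l - t"]) auto
qed

lemma covers_ray_ray_iff: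
  assumes "norm u = 1"
  shows "covers_ray (ray v u r) u (ray v u s) (ray v u t) \<longleftrightarrow> s \<le> r \<and> r < t"
proof -
  have "u \<noteq> 0" using assms by auto
  then have "covers_ray (ray v u r) u (ray v u s) (ray v u t) \<longleftrightarrow>
      (\<exists>s' t'. s' \<le> 0 \<and> 0 < t' \<and> s' = s - r \<and> t' = t - r)"
    by (simp add: covers_ray_def assms ray_eq_iff eq_diff_eq add.commute eq_commute[of s] eq_commute[of t])
  also have "\<dots> \<longleftrightarrow> s \<le> r \<and> r < t" by simp
  finally show ?thesis .
qed

lemma covers_rayE:
  assumes "covers_ray (ray v u r) u x y"
  obtains s t where "s \<le> r" "r < t" "x = ray v u s" "y = ray v u t" "norm u = 1"
proof -
  obtain s t where "s \<le> 0" "0 < t" "x = ray v u (r + s)" "y = ray v u (r + t)" "norm u = 1"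
    using assms unfolding covers_ray_def ray_ray by blast
  then show thesis using that[of "r + s" "r + t"] by simp
qed

lemma covers_ray_start: "x \<noteq> y \<Longrightarrow> covers_ray x (sgn (y - x)) x y"
  by (simp add: covers_ray_iff)

lemma covers_ray_open_segment: "v \<in> open_segment x y \<Longrightarrow> covers_ray v (sgn (y - x)) x y"
  by (auto simp: covers_ray_iff)

lemma eventually_covers_ray:
  assumes "covers_ray v u x y"
  shows "\<forall>\<^sub>F t in at_right 0. ray v u t \<in> open_segment x y"
proof -
  obtain s r where sr: "s \<le> 0" "0 < r" "x = ray v u s" "y = ray v u r" and "norm u = 1"
    using assms unfolding covers_ray_def by blast
  then have "u \<noteq> 0" by auto
  from eventually_at_right_real[OF sr(2)] show ?thesis
    by eventually_elim (use sr \<open>u \<noteq> 0\<close> in \<open>auto simp: ray_in_open_segment_iff\<close>)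
qed

lemma covers_ray_shift_back:
  assumes "covers_ray (ray v u r) u x y" "0 \<le> r" "\<And>t. 0 < t \<Longrightarrow> t \<le> r \<Longrightarrow> x \<noteq> ray v u t"
  shows "covers_ray v u x y"
proof -
  obtain s t where st: "s \<le> 0" "0 < t" "x = ray v u (r + s)" "y = ray v u (r + t)" and u: "norm u = 1"
    using assms(1) unfolding covers_ray_def ray_ray by blast
  have "r + s \<le> 0" using assms(3)[of "r + s"] st by force
  moreover have "0 < r + t" using st assms(2) by simp
  ultimately show ?thesis unfolding covers_ray_def using st u by blast
qed

lemma line_additiveD:
  "line_additive F \<Longrightarrow> F (ray v u r) (ray v u s) + F (ray v u s) (ray v u t) = F (ray v u r) (ray v u t)"
  by (simp add: line_additive_def)

lemma line_additive_same: "line_additive F \<Longrightarrow> F p p = 0"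
  using line_additiveD[of F p 0 0 0 0] by simp

lemma line_additive_commute:
  assumes "line_additive F"
  shows "F q p = - F p q"
proof -
  have "F p q + F q p = F p p"
    using line_additiveD[OF assms, of p "q - p" 0 1 0] by (simp add: ray_def)
  then show ?thesis using line_additive_same[OF assms] by (simp add: add_eq_0_iff)
qed

lemma line_additive_potential:
  assumes F: "line_additive F"
  obtains G where "\<And>x y. F x y = G (line y (sgn (y - x))) y - G (line x (sgn (y - x))) x"
proof (rule that[of "\<lambda>l. F (SOME p. p \<in> l)"])
  fix x y
  define base where "base = (SOME p. p \<in> line x (sgn (y - x)))"
  have "base \<in> line x (sgn (y - x))" unfolding base_def using line_self by (rule someI)
  then obtain r where "base = ray x (sgn (y - x)) r" by (auto simp: line_def)
  then have "F base x + F x y = F base y"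
    using line_additiveD[OF F, of x "sgn (y - x)" r 0 "norm (y - x)"] ray_to[of x y] by simp
  moreover have "line y (sgn (y - x)) = line x (sgn (y - x))"
    using line_ray[of x "sgn (y - x)" "norm (y - x)"] ray_to[of x y] by simp
  ultimately show "F x y = F (SOME p. p \<in> line y (sgn (y - x))) y - F (SOME p. p \<in> line x (sgn (y - x))) x"
    by (simp add: base_def[symmetric] algebra_simps)
qed

section \<open>Oriented triangles\<close>

definition orient :: "complex \<Rightarrow> complex \<Rightarrow> complex \<Rightarrow> real" where
  "orient x y z = side x (y - x) z"

text \<open>The edges of a triangle in counterclockwise direction, whatever the order of its vertices.\<close>

definition ccw_edges :: "complex \<Rightarrow> complex \<Rightarrow> complex \<Rightarrow> (complex \<times> complex) set" where
  "ccw_edges A B C = (if orient A B C > 0 then {(A, B), (B, C), (C, A)} else {(B, A), (C, B), (A, C)})"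

lemma orient_Re_Im: "orient x y z = Re (y - x) * Im (z - x) - Im (y - x) * Re (z - x)"
  by (simp add: orient_def side_def algebra_simps)

lemma orient_rotate: "orient y z x = orient x y z"
  by (simp add: orient_Re_Im algebra_simps)

lemma orient_swap: "orient y x z = - orient x y z" "orient x z y = - orient x y z"
  by (simp_all add: orient_Re_Im algebra_simps)

lemma orient_same [simp]: "orient x x z = 0" "orient x y x = 0" "orient x y y = 0"
  by (simp_all add: orient_Re_Im algebra_simps)

lemma orient_sum: "orient A B q + orient B C q + orient C A q = orient A B C"
  by (simp add: orient_Re_Im algebra_simps)

lemma orient_affine:
  assumes "r + s + t = 1"
  shows "orient x y (r *\<^sub>R A + s *\<^sub>R B + t *\<^sub>R C) = r * orient x y A + s * orient x y B + t * orient x y C"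
proof -
  have r: "r = 1 - s - t" using assms by simp
  show ?thesis unfolding r by (simp add: orient_Re_Im algebra_simps)
qed

lemma orient_ray: "orient (ray v u s) (ray v u t) z = (t - s) * side v u z"
  unfolding orient_def ray_diff by (simp add: side_def ray_def algebra_simps)

lemma orient_ray_right: "orient x y (ray p w t) = orient x y p + t * Im (cnj (y - x) * w)"
  by (simp add: orient_def side_def ray_def algebra_simps)

lemma orient_open_segment:
  assumes "p \<in> open_segment x y"
  shows "orient x y p = 0"
proof -
  obtain t where "p = (1 - t) *\<^sub>R x + t *\<^sub>R y + 0 *\<^sub>R x" using assms by (auto simp: in_segment)
  then show ?thesis by (simp only: orient_affine) simp
qed

lemma orient_eq_0_imp_ray:
  assumes "orient p q r = 0" "p \<noteq> q"
  obtains t where "r = ray p (q - p) t"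
proof -
  have "Im ((r - p) / (q - p)) = 0"
    using assms by (simp add: orient_Re_Im Im_divide mult.commute)
  then have "(r - p) / (q - p) = of_real (Re ((r - p) / (q - p)))" by (simp add: complex_eq_iff)
  then have "r = ray p (q - p) (Re ((r - p) / (q - p)))" using assms(2) by (simp add: ray_def field_simps)
  then show thesis by (rule that)
qed

lemma orient_eq_0_iff_collinear: "orient p q r = 0 \<longleftrightarrow> collinear {p, q, r}"
proof (cases "p = q")
  case False
  have "collinear {p, q, r} \<longleftrightarrow> (\<exists>t. r = ray p (q - p) t)"
  proof -
    have "collinear {p, q, r} \<longleftrightarrow> collinear {q, p, r}" by (simp add: insert_commute)
    also have "\<dots> \<longleftrightarrow> collinear {0, q - p, r - p}" by (rule collinear_3) (simp add: NO_MATCH_def)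
    also have "\<dots> \<longleftrightarrow> (\<exists>t. r - p = t *\<^sub>R (q - p))" using False
      by (auto simp: collinear_lemma intro: exI[of _ 0])
    finally show ?thesis by (simp add: ray_def scaleR_conv_of_real diff_eq_eq add.commute)
  qed
  moreover have "orient p q (ray p (q - p) t) = 0" for t
    by (simp add: orient_def)
  ultimately show ?thesis using False orient_eq_0_imp_ray by metis
qed simp

lemma barycentric:
  assumes "orient A B C \<noteq> 0"
  shows "q = (orient B C q / orient A B C) *\<^sub>R A + (orient C A q / orient A B C) *\<^sub>R B
    + (orient A B q / orient A B C) *\<^sub>R C"
proof -
  have "orient A B C *\<^sub>R q = orient B C q *\<^sub>R A + orient C A q *\<^sub>R B + orient A B q *\<^sub>R C"
    by (auto simp: complex_eq_iff orient_Re_Im algebra_simps)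
  then have "(1 / orient A B C) *\<^sub>R (orient A B C *\<^sub>R q) =
      (1 / orient A B C) *\<^sub>R (orient B C q *\<^sub>R A + orient C A q *\<^sub>R B + orient A B q *\<^sub>R C)"
    by simp
  then show ?thesis using assms by (simp add: scaleR_add_right)
qed

lemma barycentric_sum:
  "orient A B C \<noteq> 0 \<Longrightarrow>
    orient B C q / orient A B C + orient C A q / orient A B C + orient A B q / orient A B C = 1"
  unfolding add_divide_distrib[symmetric] using orient_sum[of A B q C] by simp

lemma ccw_rotate: "orient A B C > 0 \<Longrightarrow> orient B C A > 0" "orient A B C > 0 \<Longrightarrow> orient C A B > 0"
  by (simp_all add: orient_rotate orient_rotate[of A B C, symmetric])

lemma ccw_edges_tournament:
  assumes "orient A B C \<noteq> 0" "{x, y} \<subseteq> {A, B, C}" "x \<noteq> y"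
  shows "(y, x) \<in> ccw_edges A B C \<longleftrightarrow> (x, y) \<notin> ccw_edges A B C"
proof -
  have "A \<noteq> B" "B \<noteq> C" "C \<noteq> A" using assms(1) by auto
  then show ?thesis using assms(2,3) by (auto simp: ccw_edges_def)
qed

lemma ccw_edgeE:
  assumes "orient A B C \<noteq> 0" "(x, y) \<in> ccw_edges A B C"
  obtains z where "orient x y z > 0" "{A, B, C} = {x, y, z}" "ccw_edges A B C = {(x, y), (y, z), (z, x)}"
proof -
  note result = that
  have cyclic: thesis if ccw: "orient P Q R > 0" and S: "{A, B, C} = {P, Q, R}"
    and E: "ccw_edges A B C = {(P, Q), (Q, R), (R, P)}" for P Q R
  proof -
    consider "x = P" "y = Q" | "x = Q" "y = R" | "x = R" "y = P" using assms(2) E by auto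
    then show thesis
    proof cases
      case 1 then show thesis using result[of R] S E ccw by simp
    next
      case 2 then show thesis using result[of P] S E ccw_rotate(1)[OF ccw] by (simp add: insert_commute)
    next
      case 3 then show thesis using result[of Q] S E ccw_rotate(2)[OF ccw] by (simp add: insert_commute)
    qed
  qed
  show thesis
  proof (cases "orient A B C > 0")
    case True
    then show thesis by (intro cyclic[of A B C]) (auto simp: ccw_edges_def)
  next
    case False
    then have "orient B A C > 0" using assms(1) orient_swap(1)[of B A C] by linarith
    then show thesis using False by (intro cyclic[of B A C]) (auto simp: ccw_edges_def)
  qed
qed

lemma ccw_edges_obtain:
  assumes "orient A B C \<noteq> 0"
  obtains x y z where "orient x y z > 0" "{A, B, C} = {x, y, z}" "ccw_edges A B C = {(x, y), (y, z), (z, x)}"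
proof -
  have "ccw_edges A B C \<noteq> {}" by (simp add: ccw_edges_def)
  then obtain x y where "(x, y) \<in> ccw_edges A B C" by fast
  with assms show thesis by (rule ccw_edgeE) (rule that)
qed

lemma ccw_convex_hull:
  assumes "orient A B C > 0"
  shows "convex hull {A, B, C} = {q. orient A B q \<ge> 0 \<and> orient B C q \<ge> 0 \<and> orient C A q \<ge> 0}"
proof (intro set_eqI iffI)
  fix q assume "q \<in> convex hull {A, B, C}"
  then obtain r s t where "q = r *\<^sub>R A + s *\<^sub>R B + t *\<^sub>R C" "r + s + t = 1" "r \<ge> 0" "s \<ge> 0" "t \<ge> 0"
    unfolding convex_hull_3 by auto
  then show "q \<in> {q. orient A B q \<ge> 0 \<and> orient B C q \<ge> 0 \<and> orient C A q \<ge> 0}"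
    using assms ccw_rotate[OF assms] by (simp add: orient_affine)
next
  fix q assume left: "q \<in> {q. orient A B q \<ge> 0 \<and> orient B C q \<ge> 0 \<and> orient C A q \<ge> 0}"
  have "orient A B C \<noteq> 0" using assms by simp
  note barycentric[OF this, of q] barycentric_sum[OF this, of q]
  moreover have "orient B C q / orient A B C \<ge> 0" "orient C A q / orient A B C \<ge> 0"
    "orient A B q / orient A B C \<ge> 0"
    using left assms by simp_all
  ultimately show "q \<in> convex hull {A, B, C}" unfolding convex_hull_3 by blast
qed

lemma ccw_interior:
  assumes "orient A B C > 0"
  shows "interior (convex hull {A, B, C}) = {q. orient A B q > 0 \<and> orient B C q > 0 \<and> orient C A q > 0}"
proof -
  have nd: "orient A B C \<noteq> 0" using assms by simp
  then have "\<not> collinear {A, B, C}" by (simp add: orient_eq_0_iff_collinear)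
  then have I: "interior (convex hull {A, B, C}) =
      {v. \<exists>x y z. 0 < x \<and> 0 < y \<and> 0 < z \<and> x + y + z = 1 \<and> x *\<^sub>R A + y *\<^sub>R B + z *\<^sub>R C = v}"
    by (rule interior_convex_hull_3_minimal) simp
  show ?thesis
  proof (intro set_eqI iffI)
    fix q assume "q \<in> interior (convex hull {A, B, C})"
    then obtain r s t where "q = r *\<^sub>R A + s *\<^sub>R B + t *\<^sub>R C" "r + s + t = 1" "r > 0" "s > 0" "t > 0"
      unfolding I by blast
    then show "q \<in> {q. orient A B q > 0 \<and> orient B C q > 0 \<and> orient C A q > 0}"
      using assms ccw_rotate[OF assms] by (simp add: orient_affine)
  next
    fix q assume left: "q \<in> {q. orient A B q > 0 \<and> orient B C q > 0 \<and> orient C A q > 0}"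
    note barycentric[OF nd, of q, symmetric] barycentric_sum[OF nd, of q]
    moreover have "orient B C q / orient A B C > 0" "orient C A q / orient A B C > 0"
      "orient A B q / orient A B C > 0"
      using left assms by simp_all
    ultimately show "q \<in> interior (convex hull {A, B, C})" unfolding I by blast
  qed
qed

lemma interior_convex_hull_3_nonempty:
  fixes A B C :: "'a::euclidean_space"
  assumes "\<not> collinear {A, B, C}" "DIM('a) = 2"
  shows "interior (convex hull {A, B, C}) \<noteq> {}"
proof -
  have "(1 / 3) *\<^sub>R A + (1 / 3) *\<^sub>R B + (1 / 3) *\<^sub>R C \<in> interior (convex hull {A, B, C})"
    unfolding interior_convex_hull_3_minimal[OF assms] by (auto intro!: exI[of _ "1 / 3"])
  then show ?thesis by blast
qed

lemma convex_hull_ccw_edges: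
  assumes "orient A B C \<noteq> 0"
  shows "convex hull {A, B, C} = {q. \<forall>(x, y)\<in>ccw_edges A B C. orient x y q \<ge> 0}"
  using assms by (rule ccw_edges_obtain) (simp add: ccw_convex_hull)

lemma interior_ccw_edges:
  assumes "orient A B C \<noteq> 0"
  shows "interior (convex hull {A, B, C}) = {q. \<forall>(x, y)\<in>ccw_edges A B C. orient x y q > 0}"
  using assms by (rule ccw_edges_obtain) (simp add: ccw_interior)

lemma vertex_notin_interior: "orient A B C \<noteq> 0 \<Longrightarrow> w \<in> {A, B, C} \<Longrightarrow> w \<notin> interior (convex hull {A, B, C})"
  by (auto simp: interior_ccw_edges ccw_edges_def)

lemma open_segment_ccw:
  assumes "orient A B C > 0" "p \<in> open_segment A B"
  shows "orient A B p = 0" "orient B C p > 0" "orient C A p > 0"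
proof -
  obtain t where t: "p = (1 - t) *\<^sub>R A + t *\<^sub>R B + 0 *\<^sub>R C" "0 < t" "t < 1"
    using assms by (auto simp: in_segment)
  show "orient A B p = 0" "orient B C p > 0" "orient C A p > 0"
    unfolding t(1) by (subst orient_affine; use t ccw_rotate[OF assms(1)] in simp)+
qed

lemma open_segment_ccw_edge:
  assumes "orient A B C \<noteq> 0" "(x, y) \<in> ccw_edges A B C" "p \<in> open_segment x y"
  shows "p \<in> convex hull {A, B, C} - interior (convex hull {A, B, C}) - {A, B, C}"
  using assms(1,2)
proof (rule ccw_edgeE)
  fix z assume z: "orient x y z > 0" "{A, B, C} = {x, y, z}"
  have "p \<in> convex hull {x, y, z} - interior (convex hull {x, y, z}) - {x, y, z}"
    using open_segment_ccw[OF z(1) assms(3)] unfolding ccw_interior[OF z(1)]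
    unfolding ccw_convex_hull[OF z(1)] by auto
  then show ?thesis unfolding z(2) .
qed

lemma ccw_edge_nbhd:
  assumes "orient A B C \<noteq> 0" "(x, y) \<in> ccw_edges A B C" "p \<in> open_segment x y"
  shows "\<forall>\<^sub>F q in nhds p. (q \<in> convex hull {A, B, C} \<longleftrightarrow> orient x y q \<ge> 0) \<and>
    (q \<in> interior (convex hull {A, B, C}) \<longleftrightarrow> orient x y q > 0)"
  using assms(1,2)
proof (rule ccw_edgeE)
  fix z assume z: "orient x y z > 0" "{A, B, C} = {x, y, z}"
  have "continuous_on UNIV (orient a b)" for a b
    unfolding orient_def side_def by (intro continuous_intros)
  then have "(orient a b \<longlongrightarrow> orient a b p) (nhds p)" for a b
    by (simp add: continuous_on_def tendsto_at_iff_tendsto_nhds)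
  then have "\<forall>\<^sub>F q in nhds p. orient y z q > 0" "\<forall>\<^sub>F q in nhds p. orient z x q > 0"
    using open_segment_ccw(2,3)[OF z(1) assms(3)] by (blast intro: order_tendstoD)+
  then show ?thesis unfolding z(2) ccw_interior[OF z(1)] unfolding ccw_convex_hull[OF z(1)]
    by eventually_elim auto
qed

lemma convex_hull_3_cases:
  assumes nd: "orient A B C \<noteq> 0" and "p \<in> convex hull {A, B, C}"
  obtains "p \<in> {A, B, C}" | "p \<in> interior (convex hull {A, B, C})"
    | x y where "(x, y) \<in> ccw_edges A B C" "p \<in> open_segment x y"
proof (cases "p \<in> interior (convex hull {A, B, C})")
  case False
  then obtain x y where xy: "(x, y) \<in> ccw_edges A B C" "orient x y p \<le> 0"
    unfolding interior_ccw_edges[OF nd] by (auto simp: not_less)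
  from nd xy(1) obtain z where z: "orient x y z > 0" "{A, B, C} = {x, y, z}" by (rule ccw_edgeE)
  have p: "orient x y p = 0" "orient y z p \<ge> 0" "orient z x p \<ge> 0"
    using assms(2) xy unfolding z(2) ccw_convex_hull[OF z(1)] by auto
  define t where "t = orient z x p / orient x y z"
  have t: "orient y z p / orient x y z = 1 - t"
    using barycentric_sum[of x y z p] z p by (simp add: t_def)
  have "p = (1 - t) *\<^sub>R x + t *\<^sub>R y"
    using barycentric[of x y z p] z p unfolding t t_def[symmetric] by simp
  moreover have "0 \<le> t" using p z by (simp add: t_def)
  moreover have "0 \<le> 1 - t" unfolding t[symmetric] using p z by simp
  ultimately have "p \<in> closed_segment x y" by (auto simp: in_segment)
  then show thesis using that xy z by (auto simp: open_segment_def)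
qed (rule that)

lemma ccw_edges_disjoint:
  assumes "orient A B C \<noteq> 0" "(x, y) \<in> ccw_edges A B C" "(x', y') \<in> ccw_edges A B C"
    and p: "p \<in> open_segment x y" "p \<in> open_segment x' y'"
  shows "x = x' \<and> y = y'"
  using assms(1,2)
proof (rule ccw_edgeE)
  fix z assume z: "orient x y z > 0" "{A, B, C} = {x, y, z}" "ccw_edges A B C = {(x, y), (y, z), (z, x)}"
  then show ?thesis
    using assms(3) orient_open_segment[OF p(2)] open_segment_ccw[OF z(1) p(1)] by auto
qed

lemma sum_ccw_edges:
  assumes F: "line_additive F" and nd: "orient A B C \<noteq> 0"
  shows "(\<Sum>(x, y)\<in>ccw_edges A B C. F x y) = sgn (orient A B C) *\<^sub>R (F A B + F B C + F C A)"
proof (cases "orient A B C > 0")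
  case True
  then have "A \<noteq> B" "B \<noteq> C" "C \<noteq> A" by auto
  then show ?thesis using True by (simp add: ccw_edges_def)
next
  case False
  then have "sgn (orient A B C) = -1" "A \<noteq> B" "B \<noteq> C" "C \<noteq> A" using nd by (auto simp: sgn_if)
  then show ?thesis using False
      line_additive_commute[OF F, of B A] line_additive_commute[OF F, of C B]
        line_additive_commute[OF F, of A C]
    by (auto simp: ccw_edges_def)
qed

section \<open>Dissections of the plane\<close>

lemma left_of_bisector:
  fixes z z' :: complex
  assumes "z \<noteq> 0" "z' \<noteq> 0" "sgn z' \<noteq> - sgn z"
  shows "0 < Im (cnj z * (\<i> * (sgn z + sgn z')))"
proof -
  define u u' where "u = sgn z" and "u' = sgn z'"
  have unit: "norm u = 1" "norm u' = 1" using assms by (simp_all add: u_def u'_def norm_sgn)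
  have "u + u' \<noteq> 0" using assms(3) by (simp add: u_def u'_def add_eq_0_iff)
  then have "0 < (norm (u + u'))\<^sup>2" by simp
  also have "\<dots> = (norm u)\<^sup>2 + (norm u')\<^sup>2 + 2 * Re (cnj u * u')"
    unfolding cmod_power2 by (simp add: power2_eq_square algebra_simps)
  also have "\<dots> = 2 * Re (cnj u * (u + u'))"
  proof -
    have "Re (cnj u * u) = 1" using unit(1) by (simp add: cmod_def power2_eq_square)
    then show ?thesis using unit by (simp add: distrib_left del: times_complex.sel)
  qed
  finally have "0 < norm z * Re (cnj u * (u + u'))" using assms(1) by simp
  also have "\<dots> = Re (cnj (of_real (norm z) * u) * (u + u'))" by (simp add: algebra_simps)
  also have "of_real (norm z) * u = z" using assms(1) by (simp add: u_def sgn_eq)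
  finally have "0 < Re (cnj z * (u + u'))" .
  moreover have "Im (cnj z * (\<i> * w)) = Re (cnj z * w)" for w by simp
  ultimately show ?thesis unfolding u_def u'_def by (simp only:)
qed

lemma card_eq_subsingletons:
  assumes "A \<noteq> {} \<longleftrightarrow> B \<noteq> {}"
    and "\<And>x y. x \<in> A \<Longrightarrow> y \<in> A \<Longrightarrow> x = y" "\<And>x y. x \<in> B \<Longrightarrow> y \<in> B \<Longrightarrow> x = y"
  shows "card A = card B"
proof (cases "A = {}")
  case False
  then obtain x y where "A = {x}" "B = {y}" using assms by blast
  then show ?thesis by simp
qed (use assms in auto)

lemma sum_eq_if_card_fibres_eq:
  fixes G :: "'b \<Rightarrow> 'v::real_vector"
  assumes "finite S" "\<And>z. card {e\<in>S. f e = z} = card {e\<in>S. h e = z}"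
  shows "(\<Sum>e\<in>S. G (f e)) = (\<Sum>e\<in>S. G (h e))"
proof -
  have fibres: "(\<Sum>e\<in>S. G (k e)) = (\<Sum>z\<in>f ` S \<union> h ` S. real (card {e\<in>S. k e = z}) *\<^sub>R G z)"
    if "k \<in> {f, h}" for k
  proof -
    have "(\<Sum>e\<in>S. G (k e)) = (\<Sum>z\<in>f ` S \<union> h ` S. \<Sum>e | e \<in> S \<and> k e = z. G (k e))"
      using assms(1) that by (intro sum.group[symmetric]) auto
    also have "\<dots> = (\<Sum>z\<in>f ` S \<union> h ` S. \<Sum>e | e \<in> S \<and> k e = z. G z)"
      by (intro sum.cong) auto
    finally show ?thesis by (simp only: sum_constant_scaleR)
  qed
  show ?thesis using fibres[of f] fibres[of h] assms(2) by simp
qed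

text \<open>Every edge is directed so that its cell lies on the left. A side of one cell may be covered by sides of
  several other cells.\<close>

locale planar_dissection =
  fixes cells :: "'c set" and region :: "'c \<Rightarrow> complex set"
    and edges :: "'c \<Rightarrow> (complex \<times> complex) set" and vertices :: "complex set"
  assumes finite_cells: "finite cells"
    and finite_vertices: "finite vertices"
    and edge_vertices: "c \<in> cells \<Longrightarrow> (x, y) \<in> edges c \<Longrightarrow> x \<in> vertices \<and> y \<in> vertices"
    and edge_neq: "c \<in> cells \<Longrightarrow> (x, y) \<in> edges c \<Longrightarrow> x \<noteq> y"
    and closed_region: "c \<in> cells \<Longrightarrow> closed (region c)"
    and disjoint_interiors: "c \<in> cells \<Longrightarrow> d \<in> cells \<Longrightarrow> c \<noteq> d \<Longrightarrow>
      interior (region c) \<inter> interior (region d) = {}"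
    and region_cover: "(\<Union>c\<in>cells. region c) = UNIV"
    and region_left_of_edge: "c \<in> cells \<Longrightarrow> (x, y) \<in> edges c \<Longrightarrow> p \<in> open_segment x y \<Longrightarrow>
      \<forall>\<^sub>F q in nhds p. q \<in> region c \<longleftrightarrow> 0 \<le> orient x y q"
    and region_boundary: "c \<in> cells \<Longrightarrow> p \<in> region c \<Longrightarrow> p \<notin> interior (region c) \<Longrightarrow> p \<notin> vertices \<Longrightarrow>
      \<exists>(x, y)\<in>edges c. p \<in> open_segment x y"
    and edges_disjoint: "c \<in> cells \<Longrightarrow> (x, y) \<in> edges c \<Longrightarrow> (x', y') \<in> edges c \<Longrightarrow>
      p \<in> open_segment x y \<Longrightarrow> p \<in> open_segment x' y' \<Longrightarrow> x = x' \<and> y = y'"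
begin

text \<open>The edges directed so that the cell lies to the left (\<open>s\<close> true) or to the right (\<open>s\<close> false).\<close>

definition side_edges :: "bool \<Rightarrow> ('c \<times> complex \<times> complex) set" where
  "side_edges s = {(c, x, y). c \<in> cells \<and> (if s then (x, y) else (y, x)) \<in> edges c}"

lemma side_edges_reverse: "(c, x, y) \<in> side_edges (\<not> s) \<longleftrightarrow> (c, y, x) \<in> side_edges s"
  by (auto simp: side_edges_def)

lemma side_edgesD:
  assumes "(c, x, y) \<in> side_edges s"
  shows "c \<in> cells" "x \<noteq> y" "x \<in> vertices" "y \<in> vertices"
  using assms edge_neq edge_vertices by (auto simp: side_edges_def split: if_splits)

lemma side_edge_covers_ray:
  "(c, x, y) \<in> side_edges s \<Longrightarrow> sgn (y - x) = u \<Longrightarrow> covers_ray x u x y"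
  using covers_ray_start side_edgesD(2) by blast

lemma side_edges_True: "side_edges True = Sigma cells edges"
  by (auto simp: side_edges_def)

lemma finite_edges: "c \<in> cells \<Longrightarrow> finite (edges c)"
  using edge_vertices finite_vertices by (intro finite_subset[of "edges c" "vertices \<times> vertices"]) auto

lemma finite_side_edges: "finite (side_edges True)"
  unfolding side_edges_True using finite_cells finite_edges by blast

lemma eventually_interior_left:
  assumes "c \<in> cells" "(x, y) \<in> edges c" "p \<in> open_segment x y" "0 < Im (cnj (y - x) * w)"
  shows "\<forall>\<^sub>F t in at_right 0. ray p w t \<in> interior (region c)"
proof -
  from region_left_of_edge[OF assms(1-3)]
  obtain S where S: "open S" "p \<in> S" "\<And>q. q \<in> S \<Longrightarrow> q \<in> region c \<longleftrightarrow> 0 \<le> orient x y q"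
    unfolding eventually_nhds by blast
  have "continuous_on UNIV (orient x y)"
    unfolding orient_def side_def by (intro continuous_intros)
  then have "open (S \<inter> {q. 0 < orient x y q})"
    using S(1) by (intro open_Int open_Collect_less) auto
  moreover have "S \<inter> {q. 0 < orient x y q} \<subseteq> region c" using S(3) by force
  ultimately have left: "S \<inter> {q. 0 < orient x y q} \<subseteq> interior (region c)" by (rule interior_maximal[rotated])
  have "\<forall>\<^sub>F t in at_right 0. ray p w t \<in> S"
    by (rule eventually_ray) (use S in \<open>auto simp: eventually_nhds\<close>)
  then show ?thesis using eventually_at_right_less
  proof eventually_elim
    case (elim t)
    then have "0 < orient x y (ray p w t)"
      using assms(3,4) by (simp add: orient_ray_right orient_open_segment)
    with elim left show ?case by blast
  qed
qed

text \<open>Near a common interior point of two edges of different cells the cells are disjoint half planes.\<close>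

lemma edges_crossing_imp_same_cell:
  assumes c: "c \<in> cells" "(x, y) \<in> edges c" "p \<in> open_segment x y"
    and d: "d \<in> cells" "(x', y') \<in> edges d" "p \<in> open_segment x' y'"
    and not_opposite: "sgn (y' - x') \<noteq> - sgn (y - x)"
  shows "c = d"
proof (rule ccontr)
  assume "c \<noteq> d"
  define w where "w = \<i> * (sgn (y - x) + sgn (y' - x'))"
  have nz: "y - x \<noteq> 0" "y' - x' \<noteq> 0" using edge_neq c(1,2) d(1,2) by auto
  have left: "0 < Im (cnj (y - x) * w)"
    unfolding w_def by (rule left_of_bisector[OF nz not_opposite])
  have "sgn (y - x) \<noteq> - sgn (y' - x')" using not_opposite by auto
  then have left': "0 < Im (cnj (y' - x') * w)"
    unfolding w_def add.commute[of "sgn (y - x)"] by (rule left_of_bisector[OF nz(2,1)])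
  from eventually_interior_left[OF c left] eventually_interior_left[OF d left']
  have "\<forall>\<^sub>F t in at_right (0::real). False"
    by eventually_elim (use disjoint_interiors[OF c(1) d(1) \<open>c \<noteq> d\<close>] in blast)
  then show False by simp
qed

lemma side_edge_unique:
  assumes "(c, x, y) \<in> side_edges s" "p \<in> open_segment x y"
    and "(d, x', y') \<in> side_edges s" "p \<in> open_segment x' y'" and "sgn (y' - x') = sgn (y - x)"
  shows "(c, x, y) = (d, x', y')"
proof -
  have unique: "(c, x, y) = (d, x', y')"
    if e: "c \<in> cells" "(x, y) \<in> edges c" "p \<in> open_segment x y" "d \<in> cells" "(x', y') \<in> edges d"
      "p \<in> open_segment x' y'"
      and "sgn (y' - x') = sgn (y - x)" for x y x' y'
  proof -
    have "sgn (y - x) \<noteq> 0" using edge_neq e by (auto simp: sgn_zero_iff)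
    then have "sgn (y' - x') \<noteq> - sgn (y - x)" using that(7) by simp
    then have "c = d" by (rule edges_crossing_imp_same_cell[OF e])
    then show ?thesis using edges_disjoint e by blast
  qed
  show ?thesis
  proof (cases s)
    case True
    then show ?thesis using unique[of x y x' y'] assms by (simp add: side_edges_def)
  next
    case False
    then show ?thesis using unique[of y x y' x'] assms sgn_diff_commute[of x y] sgn_diff_commute[of x' y']
      by (simp add: side_edges_def open_segment_commute)
  qed
qed

lemma left_of_direction: "z \<noteq> 0 \<Longrightarrow> 0 < Im (cnj z * (\<i> * z))"
  using sum_squares_gt_zero_iff[of "Re z" "Im z"] by (simp add: complex_eq_iff)

lemma other_cell_at_edge:
  assumes c: "c \<in> cells" "(x, y) \<in> edges c" "p \<in> open_segment x y"
  shows "\<exists>d\<in>cells - {c}. p \<in> region d"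
proof (rule ccontr)
  define right where "right = - (\<i> * (y - x))"
  have "y - x \<noteq> 0" using edge_neq c(1,2) by auto
  from left_of_direction[OF this] have right: "Im (cnj (y - x) * right) < 0"
    by (simp only: right_def mult_minus_right uminus_complex.sel neg_less_0_iff_less)
  assume "\<not> ?thesis"
  moreover have "closed (\<Union>d\<in>cells - {c}. region d)"
    using finite_cells closed_region by (intro closed_UN) auto
  ultimately have "\<forall>\<^sub>F q in nhds p. q \<notin> (\<Union>d\<in>cells - {c}. region d)"
    by (auto simp: eventually_nhds closed_def)
  then have "\<forall>\<^sub>F q in nhds p. 0 \<le> orient x y q" using region_left_of_edge[OF c]
    by eventually_elim (use region_cover in blast)
  from eventually_ray[OF this, of right] eventually_at_right_less
  have "\<forall>\<^sub>F t in at_right (0::real). False"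
  proof eventually_elim
    case (elim t)
    have "orient x y (ray p right t) = t * Im (cnj (y - x) * right)"
      using c(3) by (simp add: orient_ray_right orient_open_segment)
    with elim mult_pos_neg[OF \<open>0 < t\<close> right] show ?case by linarith
  qed
  then show False by simp
qed

lemma opposite_edge:
  assumes c: "c \<in> cells" "(x, y) \<in> edges c" and p: "p \<in> open_segment x y" "p \<notin> vertices"
  shows "\<exists>d\<in>cells. \<exists>(x', y')\<in>edges d. p \<in> open_segment x' y' \<and> sgn (y' - x') = - sgn (y - x)"
proof -
  obtain d where d: "d \<in> cells" "d \<noteq> c" "p \<in> region d"
    using other_cell_at_edge[OF c p(1)] by blast
  have "y - x \<noteq> 0" using edge_neq c by auto
  note left = left_of_direction[OF this]
  have "p \<notin> interior (region d)"
  proof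
    assume "p \<in> interior (region d)"
    then have "\<forall>\<^sub>F q in nhds p. q \<in> interior (region d)" by (auto simp: eventually_nhds)
    from eventually_ray[OF this] eventually_interior_left[OF c p(1) left]
    have "\<forall>\<^sub>F t in at_right (0::real). False"
      by eventually_elim (use disjoint_interiors[OF d(1) c(1) d(2)] in blast)
    then show False by simp
  qed
  with d p(2) obtain x' y' where e: "(x', y') \<in> edges d" "p \<in> open_segment x' y'" using region_boundary by blast
  then have "sgn (y' - x') = - sgn (y - x)"
    using edges_crossing_imp_same_cell[OF c p(1) d(1) e] d(2) by blast
  then show ?thesis using d(1) e by blast
qed

lemma opposite_side_edge:
  assumes "(c, x, y) \<in> side_edges s" "p \<in> open_segment x y" "p \<notin> vertices"
  shows "\<exists>(d, x', y')\<in>side_edges (\<not> s). p \<in> open_segment x' y' \<and> sgn (y' - x') = sgn (y - x)"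
proof (cases s)
  case True
  then obtain d x' y' where "d \<in> cells" "(x', y') \<in> edges d" "p \<in> open_segment x' y'"
    "sgn (y' - x') = - sgn (y - x)"
    using opposite_edge assms by (fastforce simp: side_edges_def)
  then show ?thesis using True sgn_diff_commute[of x' y']
    by (intro bexI[of _ "(d, y', x')"]) (auto simp: side_edges_def open_segment_commute)
next
  case False
  then obtain d x' y' where "d \<in> cells" "(x', y') \<in> edges d" "p \<in> open_segment x' y'"
    "sgn (y' - x') = - sgn (x - y)"
    using opposite_edge[of c y x p] assms by (fastforce simp: side_edges_def open_segment_commute)
  then show ?thesis using False sgn_diff_commute[of y x]
    by (intro bexI[of _ "(d, x', y')"]) (auto simp: side_edges_def)
qed

lemma covering_edge_unique:
  assumes "(c, x, y) \<in> side_edges s" "covers_ray v u x y" "(d, x', y') \<in> side_edges s" "covers_ray v u x' y'"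
  shows "(c, x, y) = (d, x', y')"
proof -
  have "\<forall>\<^sub>F t in at_right 0. ray v u t \<in> open_segment x y \<and> ray v u t \<in> open_segment x' y'"
    using assms by (intro eventually_conj eventually_covers_ray)
  then obtain t where "ray v u t \<in> open_segment x y" "ray v u t \<in> open_segment x' y'"
    using eventually_happens' trivial_limit_at_right_real by blast
  then show ?thesis using side_edge_unique assms unfolding covers_ray_iff by metis
qed

lemma covering_edge_opposite:
  assumes e: "(c, x, y) \<in> side_edges s" "covers_ray v u x y"
  shows "\<exists>(d, x', y')\<in>side_edges (\<not> s). covers_ray v u x' y'"
proof -
  have u: "norm u = 1" "sgn (y - x) = u" using e(2) covers_ray_iff by (auto simp: covers_ray_def)
  then have "u \<noteq> 0" by auto
  have "\<forall>\<^sub>F t in at_right 0. ray v u t \<notin> vertices"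
    using finite_vertices \<open>u \<noteq> 0\<close> by (rule eventually_ray_notin)
  then obtain b where b: "0 < b" "\<And>t. 0 < t \<Longrightarrow> t < b \<Longrightarrow> ray v u t \<notin> vertices"
    unfolding eventually_at_right_field by blast
  have "\<forall>\<^sub>F t in at_right 0. 0 < t \<and> t < b \<and> ray v u t \<in> open_segment x y"
    using eventually_covers_ray[OF e(2)] eventually_at_right_real[OF b(1)] by eventually_elim auto
  then obtain t where t: "0 < t" "t < b" "ray v u t \<in> open_segment x y"
    using eventually_happens' trivial_limit_at_right_real by blast
  obtain d x' y' where e': "(d, x', y') \<in> side_edges (\<not> s)" "ray v u t \<in> open_segment x' y'" "sgn (y' - x') = u"
    using opposite_side_edge[OF e(1) t(3)] b(2) t u(2) by blast
  then have "covers_ray (ray v u t) u x' y'" using covers_ray_open_segment by blast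
  then have "covers_ray v u x' y'"
    using t b(2) side_edgesD(3)[OF e'(1)] by (intro covers_ray_shift_back[of v u t]) force+
  then show ?thesis using e'(1) by blast
qed

lemma edge_end_is_start:
  assumes e: "(c, x, y) \<in> side_edges s" "sgn (y - x) = u" and e': "(d, x', y') \<in> side_edges s"
    "covers_ray y u x' y'"
  shows "x' = y"
proof (rule ccontr)
  assume "x' \<noteq> y"
  then have y: "y \<in> open_segment y' x'" "sgn (y' - x') = u"
    using e'(2) by (simp_all add: covers_ray_iff open_segment_commute)
  then have "covers_ray y (- u) y' x'"
    using covers_ray_open_segment[of y y' x'] sgn_diff_commute[of x' y'] by simp
  moreover have "covers_ray y (- u) y x"
    using covers_ray_start[of y x] side_edgesD(2)[OF e(1)] e(2) sgn_diff_commute[of x y] by simp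
  moreover have "(c, y, x) \<in> side_edges (\<not> s)" "(d, y', x') \<in> side_edges (\<not> s)"
    using e(1) e'(1) by (simp_all add: side_edges_reverse)
  ultimately have "y' = y" using covering_edge_unique by blast
  then show False using y by (simp add: open_segment_def)
qed

lemma card_covering_edges:
  "card {(c, x, y)\<in>side_edges True. covers_ray v u x y} = card {(c, x, y)\<in>side_edges True. covers_ray v u y x}"
    (is "card ?out = card ?in")
proof (rule card_eq_subsingletons)
  have rev: "(c, x, y) \<in> side_edges False \<longleftrightarrow> (c, y, x) \<in> side_edges True" for c x y
    using side_edges_reverse[of c x y True] by simp
  have "?in \<noteq> {}" if out: "?out \<noteq> {}"
  proof -
    obtain c x y where "(c, x, y) \<in> side_edges True" "covers_ray v u x y" using out by blast
    then obtain d x' y' where "(d, x', y') \<in> side_edges False" "covers_ray v u x' y'"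
      using covering_edge_opposite[of c x y True] unfolding not_True_eq_False by blast
    then show ?thesis unfolding rev by blast
  qed
  moreover have "?out \<noteq> {}" if inn: "?in \<noteq> {}"
  proof -
    obtain c x y where "(c, x, y) \<in> side_edges False" "covers_ray v u x y" using inn unfolding rev by blast
    then show ?thesis using covering_edge_opposite[of c x y False] unfolding not_False_eq_True by blast
  qed
  ultimately show "?out \<noteq> {} \<longleftrightarrow> ?in \<noteq> {}" by blast
  show "e = e'" if "e \<in> ?out" "e' \<in> ?out" for e e'
    using that covering_edge_unique by blast
  show "e = e'" if "e \<in> ?in" "e' \<in> ?in" for e e'
    using that covering_edge_unique[of _ _ _ False] unfolding rev by blast
qed

text \<open>An edge passing through \<open>v\<close> covers both opposite rays from \<open>v\<close>, once forwards and once backwards, so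
  it drops out of the count.\<close>

lemma card_ends_eq_card_starts:
  assumes u: "norm u = 1"
  shows "card {(c, x, y)\<in>side_edges True. y = v \<and> sgn (y - x) \<in> {u, - u}} =
    card {(c, x, y)\<in>side_edges True. x = v \<and> sgn (y - x) \<in> {u, - u}}"
proof -
  define ends where "ends u = {(c, x, y)\<in>side_edges True. y = v \<and> sgn (y - x) = u}" for u
  define starts where "starts u = {(c, x, y)\<in>side_edges True. x = v \<and> sgn (y - x) = u}" for u
  define through where "through u = {(c, x, y)\<in>side_edges True. v \<in> open_segment x y \<and> sgn (y - x) = u}" for u
  have fin: "finite (ends u)" "finite (starts u)" "finite (through u)" for u
    unfolding ends_def starts_def through_def by (rule finite_subset[OF _ finite_side_edges], auto)+
  have germ: "card (starts u) + card (through u) = card (ends (- u)) + card (through (- u))" for u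
  proof -
    have "starts u \<union> through u = {(c, x, y)\<in>side_edges True. covers_ray v u x y}"
      by (auto simp: starts_def through_def covers_ray_iff dest: side_edgesD)
    moreover have "sgn (x - y) = u \<longleftrightarrow> sgn (y - x) = - u" for x y :: complex
      using sgn_diff_commute[of x y] by auto
    then have "ends (- u) \<union> through (- u) = {(c, x, y)\<in>side_edges True. covers_ray v u y x}"
      by (auto simp: ends_def through_def covers_ray_iff open_segment_commute dest: side_edgesD)
    moreover have "card (starts u \<union> through u) = card (starts u) + card (through u)"
      using fin by (intro card_Un_disjoint) (auto simp: starts_def through_def open_segment_def)
    moreover have "card (ends (- u) \<union> through (- u)) = card (ends (- u)) + card (through (- u))"
      using fin by (intro card_Un_disjoint) (auto simp: ends_def through_def open_segment_def)
    ultimately show ?thesis using card_covering_edges[of v u] by simp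
  qed
  have "u \<noteq> - u" using u by auto
  then have "card (ends u \<union> ends (- u)) = card (ends u) + card (ends (- u))"
    and "card (starts u \<union> starts (- u)) = card (starts u) + card (starts (- u))"
    using fin by (auto intro!: card_Un_disjoint simp: ends_def starts_def)
  moreover have "{(c, x, y)\<in>side_edges True. y = v \<and> sgn (y - x) \<in> {u, - u}} = ends u \<union> ends (- u)"
    and "{(c, x, y)\<in>side_edges True. x = v \<and> sgn (y - x) \<in> {u, - u}} = starts u \<union> starts (- u)"
    by (auto simp: ends_def starts_def)
  ultimately show ?thesis using germ[of u] germ[of "- u"] by simp
qed

lemma card_line_ends_eq_card_line_starts:
  "card {(c, x, y)\<in>side_edges True. line y (sgn (y - x)) = l \<and> y = v} =
   card {(c, x, y)\<in>side_edges True. line x (sgn (y - x)) = l \<and> x = v}"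
proof (cases "\<exists>u. norm u = 1 \<and> l = line v u")
  case True
  then obtain u where u: "norm u = 1" "l = line v u" by blast
  have "line v w = l \<longleftrightarrow> w \<in> {u, - u}" if "norm w = 1" for w
    using line_eq_imp_direction[of v u w] that u by (auto simp: line_uminus)
  then have "line v (sgn (y - x)) = l \<longleftrightarrow> sgn (y - x) \<in> {u, - u}" if "(c, x, y) \<in> side_edges True" for c x y
    using side_edgesD(2)[OF that] by (simp add: norm_sgn del: insert_iff)
  then have "{(c, x, y)\<in>side_edges True. line y (sgn (y - x)) = l \<and> y = v} =
      {(c, x, y)\<in>side_edges True. y = v \<and> sgn (y - x) \<in> {u, - u}}"
    and "{(c, x, y)\<in>side_edges True. line x (sgn (y - x)) = l \<and> x = v} =
      {(c, x, y)\<in>side_edges True. x = v \<and> sgn (y - x) \<in> {u, - u}}"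
    by auto
  then show ?thesis using card_ends_eq_card_starts[OF u(1)] by simp
next
  case False
  then have "line v (sgn (y - x)) \<noteq> l" if "(c, x, y) \<in> side_edges True" for c x y
    using side_edgesD(2)[OF that] by (metis norm_sgn right_minus_eq)
  then have "{(c, x, y)\<in>side_edges True. line y (sgn (y - x)) = l \<and> y = v} = {}"
    and "{(c, x, y)\<in>side_edges True. line x (sgn (y - x)) = l \<and> x = v} = {}"
    by auto
  then show ?thesis by (simp only:)
qed

text \<open>On each line \<open>F x y = G y - G x\<close> for a potential \<open>G\<close>, and every point of the line is as often the end
  as the start of an edge on the line.\<close>

lemma sum_edges_eq_0:
  fixes F :: "complex \<Rightarrow> complex \<Rightarrow> 'v::real_vector"
  assumes F: "line_additive F"
  shows "(\<Sum>c\<in>cells. \<Sum>(x, y)\<in>edges c. F x y) = 0"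
proof -
  from F obtain G where G: "\<And>x y. F x y = G (line y (sgn (y - x))) y - G (line x (sgn (y - x))) x"
    by (rule line_additive_potential) blast
  define src dst :: "'c \<times> complex \<times> complex \<Rightarrow> complex set \<times> complex"
    where "src = (\<lambda>(c, x, y). (line x (sgn (y - x)), x))" and "dst = (\<lambda>(c, x, y). (line y (sgn (y - x)), y))"
  have "(\<Sum>c\<in>cells. \<Sum>(x, y)\<in>edges c. F x y) = (\<Sum>(c, x, y)\<in>side_edges True. F x y)"
    unfolding side_edges_True using finite_cells finite_edges by (subst sum.Sigma) (auto simp: split_beta)
  also have "\<dots> = (\<Sum>e\<in>side_edges True. case_prod G (dst e) - case_prod G (src e))"
    by (rule sum.cong) (auto simp: G src_def dst_def)
  also have "\<dots> = 0"
  proof -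
    have "card {e\<in>side_edges True. dst e = z} = card {e\<in>side_edges True. src e = z}" for z
    proof (cases z)
      case (Pair l v)
      have "{e\<in>side_edges True. dst e = (l, v)} = {(c, x, y)\<in>side_edges True. line y (sgn (y - x)) = l \<and> y = v}"
        and "{e\<in>side_edges True. src e = (l, v)} =
            {(c, x, y)\<in>side_edges True. line x (sgn (y - x)) = l \<and> x = v}"
        by (auto simp: src_def dst_def)
      then show ?thesis using card_line_ends_eq_card_line_starts by (simp only: Pair)
    qed
    from sum_eq_if_card_fibres_eq[OF finite_side_edges this, of "case_prod G"]
    show ?thesis by (simp add: sum_subtractf)
  qed
  finally show ?thesis .
qed

end

section \<open>Tilings of a triangle by triangles\<close>

locale triangle_tiling =
  fixes I :: "'i set" and tA tB tC :: "'i \<Rightarrow> complex" and X Y Z :: complex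
  assumes finite_tiles: "finite I"
    and tile_nondegenerate: "i \<in> I \<Longrightarrow> orient (tA i) (tB i) (tC i) \<noteq> 0"
    and nondegenerate: "orient X Y Z \<noteq> 0"
    and tiles_disjoint: "i \<in> I \<Longrightarrow> j \<in> I \<Longrightarrow> i \<noteq> j \<Longrightarrow>
      interior (convex hull {tA i, tB i, tC i}) \<inter> interior (convex hull {tA j, tB j, tC j}) = {}"
    and tiles_cover: "(\<Union>i\<in>I. convex hull {tA i, tB i, tC i}) = convex hull {X, Y, Z}"
begin

abbreviation tile :: "'i \<Rightarrow> complex set" where
  "tile i \<equiv> convex hull {tA i, tB i, tC i}"

abbreviation big :: "complex set" where
  "big \<equiv> convex hull {X, Y, Z}"

abbreviation tile_edges :: "'i \<Rightarrow> (complex \<times> complex) set" where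
  "tile_edges i \<equiv> ccw_edges (tA i) (tB i) (tC i)"

text \<open>The complement of the big triangle is one more cell, indexed by \<open>None\<close>.\<close>

definition cells :: "'i option set" where
  "cells = insert None (Some ` I)"

definition region :: "'i option \<Rightarrow> complex set" where
  "region c = (case c of None \<Rightarrow> - interior big | Some i \<Rightarrow> tile i)"

definition edges :: "'i option \<Rightarrow> (complex \<times> complex) set" where
  "edges c = (case c of None \<Rightarrow> (ccw_edges X Y Z)\<inverse> | Some i \<Rightarrow> tile_edges i)"

definition vertices :: "complex set" where
  "vertices = {X, Y, Z} \<union> tA ` I \<union> tB ` I \<union> tC ` I"

lemma cell_simps [simp]:
  "None \<in> cells" "Some i \<in> cells \<longleftrightarrow> i \<in> I"
  "region None = - interior big" "region (Some i) = tile i"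
  "edges None = (ccw_edges X Y Z)\<inverse>" "edges (Some i) = tile_edges i"
  by (auto simp: cells_def region_def edges_def)

lemma corner_in_vertices: "{X, Y, Z} \<subseteq> vertices" "i \<in> I \<Longrightarrow> {tA i, tB i, tC i} \<subseteq> vertices"
  by (auto simp: vertices_def)

lemma finite_vertices: "finite vertices"
  by (simp add: vertices_def finite_tiles)

lemma tile_subset: "i \<in> I \<Longrightarrow> tile i \<subseteq> big"
  using tiles_cover by blast

lemma tiles_nonempty: "I \<noteq> {}"
proof -
  have "X \<in> big" by (rule hull_inc) simp
  then show ?thesis using tiles_cover by auto
qed

lemma interior_outer_region: "interior (- interior big) = - big"
proof -
  have "interior big \<noteq> {}"
    using nondegenerate interior_convex_hull_3_nonempty[of X Y Z] by (simp add: orient_eq_0_iff_collinear)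
  then have "closure (interior big) = closure big"
    by (intro convex_closure_interior) simp_all
  also have "\<dots> = big" by (simp add: closure_closed compact_imp_closed compact_convex_hull)
  finally show ?thesis by (simp add: interior_complement)
qed

lemma disjoint_cell_interiors:
  assumes "c \<in> cells" "d \<in> cells" "c \<noteq> d"
  shows "interior (region c) \<inter> interior (region d) = {}"
proof -
  have "interior (tile i) \<subseteq> big" if "i \<in> I" for i using tile_subset[OF that] interior_subset by blast
  then show ?thesis using assms tiles_disjoint by (cases c; cases d) (auto simp: interior_outer_region)
qed

lemma cell_left_of_edge:
  assumes "c \<in> cells" "(x, y) \<in> edges c" "p \<in> open_segment x y"
  shows "\<forall>\<^sub>F q in nhds p. q \<in> region c \<longleftrightarrow> 0 \<le> orient x y q"
proof (cases c)
  case None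
  then have "\<forall>\<^sub>F q in nhds p. q \<in> interior big \<longleftrightarrow> 0 < orient y x q"
    using ccw_edge_nbhd[OF nondegenerate, of y x p] assms
    by (auto simp: open_segment_commute elim: eventually_mono)
  then show ?thesis using None orient_swap(1)[of x y]
    by (auto elim!: eventually_mono)
next
  case (Some i)
  then show ?thesis using ccw_edge_nbhd[OF tile_nondegenerate, of i x y p] assms
    by (auto elim: eventually_mono)
qed

lemma cell_boundary_edge:
  assumes "c \<in> cells" "p \<in> region c" "p \<notin> interior (region c)" "p \<notin> vertices"
  shows "\<exists>(x, y)\<in>edges c. p \<in> open_segment x y"
proof (cases c)
  case None
  then have outer: "p \<in> big" "p \<notin> interior big" using assms by (auto simp: interior_outer_region)
  from nondegenerate outer(1) show ?thesis
  proof (rule convex_hull_3_cases)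
    assume "p \<in> {X, Y, Z}"
    then show ?thesis using assms(4) corner_in_vertices(1) by blast
  next
    fix x y assume "(x, y) \<in> ccw_edges X Y Z" "p \<in> open_segment x y"
    then show ?thesis using None by (intro bexI[of _ "(y, x)"]) (auto simp: open_segment_commute)
  qed (use outer in blast)
next
  case (Some i)
  then have i: "i \<in> I" "p \<in> tile i" "p \<notin> interior (tile i)" using assms by auto
  from tile_nondegenerate[OF i(1)] i(2) show ?thesis
  proof (rule convex_hull_3_cases)
    assume "p \<in> {tA i, tB i, tC i}"
    then show ?thesis using assms(4) corner_in_vertices(2)[OF i(1)] by blast
  next
    fix x y assume "(x, y) \<in> tile_edges i" "p \<in> open_segment x y"
    then show ?thesis using Some by auto
  qed (use i in blast)
qed

lemma cell_edges_disjoint: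
  assumes "c \<in> cells" "(x, y) \<in> edges c" "(x', y') \<in> edges c"
    and "p \<in> open_segment x y" "p \<in> open_segment x' y'"
  shows "x = x' \<and> y = y'"
proof (cases c)
  case None
  then show ?thesis using ccw_edges_disjoint[OF nondegenerate, of y x y' x' p] assms
    by (simp add: open_segment_commute)
next
  case (Some i)
  then show ?thesis using ccw_edges_disjoint[OF tile_nondegenerate, of i x y x' y' p] assms by simp
qed

sublocale planar_dissection cells region edges vertices
proof
  show "finite cells" by (simp add: cells_def finite_tiles)
  show "finite vertices" by (rule finite_vertices)
  have "- interior big \<union> big = UNIV" using interior_subset by blast
  then show "(\<Union>c\<in>cells. region c) = UNIV" using tiles_cover by (simp add: cells_def)
  fix c assume c: "c \<in> cells"
  show "closed (region c)"
    by (cases c) (auto simp: compact_imp_closed compact_convex_hull)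
  fix x y assume e: "(x, y) \<in> edges c"
  show "x \<in> vertices \<and> y \<in> vertices"
    using e c corner_in_vertices by (cases c) (force simp: ccw_edges_def split: if_splits)+
  show "x \<noteq> y"
    using e c nondegenerate tile_nondegenerate by (cases c) (force simp: ccw_edges_def split: if_splits)+
qed (fact disjoint_cell_interiors cell_left_of_edge cell_boundary_edge cell_edges_disjoint)+

theorem sum_tile_edges:
  fixes F :: "complex \<Rightarrow> complex \<Rightarrow> 'v::real_vector"
  assumes F: "line_additive F"
  shows "(\<Sum>i\<in>I. \<Sum>(x, y)\<in>tile_edges i. F x y) = (\<Sum>(x, y)\<in>ccw_edges X Y Z. F x y)"
proof -
  have outer: "(\<Sum>(x, y)\<in>edges None. F x y) = - (\<Sum>(x, y)\<in>ccw_edges X Y Z. F x y)"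
  proof -
    have "(\<Sum>(x, y)\<in>edges None. F x y) = (\<Sum>(x, y)\<in>ccw_edges X Y Z. F y x)"
      by (rule sum.reindex_bij_witness[of _ prod.swap prod.swap]) auto
    also have "\<dots> = (\<Sum>e\<in>ccw_edges X Y Z. - (case e of (x, y) \<Rightarrow> F x y))"
      by (intro sum.cong) (auto intro: line_additive_commute[OF F])
    finally show ?thesis by (simp only: sum_negf)
  qed
  have "0 = (\<Sum>c\<in>cells. \<Sum>(x, y)\<in>edges c. F x y)" using sum_edges_eq_0[OF F] by simp
  also have "\<dots> = (\<Sum>(x, y)\<in>edges None. F x y) + (\<Sum>c\<in>Some ` I. \<Sum>(x, y)\<in>edges c. F x y)"
    unfolding cells_def using finite_tiles by (intro sum.insert) auto
  also have "(\<Sum>c\<in>Some ` I. \<Sum>(x, y)\<in>edges c. F x y) = (\<Sum>i\<in>I. \<Sum>(x, y)\<in>tile_edges i. F x y)"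
    by (subst sum.reindex) auto
  finally show ?thesis unfolding outer by simp
qed

end

section \<open>Angles\<close>

definition vertex_angle :: "'a::real_inner \<Rightarrow> 'a \<Rightarrow> 'a \<Rightarrow> real" where
  "vertex_angle p q r = arccos (((p - q) \<bullet> (r - q)) / (norm (p - q) * norm (r - q)))"

lemma vertex_angle_commute: "vertex_angle p q r = vertex_angle r q p"
  by (simp add: vertex_angle_def inner_commute mult.commute)

lemma vertex_angle_cong_dist:
  fixes x y z :: "'a::real_inner" and x' y' z' :: "'b::real_inner"
  assumes "dist x y = dist x' y'" "dist y z = dist y' z'" "dist x z = dist x' z'"
  shows "vertex_angle x y z = vertex_angle x' y' z'"
proof -
  have norms: "norm (x - y) = norm (x' - y')" "norm (z - y) = norm (z' - y')" "norm (x - z) = norm (x' - z')"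
    using assms by (simp_all add: dist_norm norm_minus_commute)
  then have "(x - y) \<bullet> (z - y) = (x' - y') \<bullet> (z' - y')" by (simp add: dot_norm_neg)
  then show ?thesis unfolding vertex_angle_def norms by simp
qed

lemma orient_squared: "(orient A B C)\<^sup>2 = (norm (B - A) * norm (C - A))\<^sup>2 - ((B - A) \<bullet> (C - A))\<^sup>2"
  unfolding power_mult_distrib cmod_power2
  by (simp add: orient_Re_Im inner_complex_def power2_eq_square algebra_simps)

lemma cos_sin_vertex_angle:
  assumes "orient A B C \<noteq> 0"
  shows "0 < vertex_angle B A C" "vertex_angle B A C < pi"
    and "cos (vertex_angle B A C) = ((B - A) \<bullet> (C - A)) / (norm (B - A) * norm (C - A))"
    and "sin (vertex_angle B A C) = \<bar>orient A B C\<bar> / (norm (B - A) * norm (C - A))"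
proof -
  define n where "n = norm (B - A) * norm (C - A)"
  define x where "x = ((B - A) \<bullet> (C - A)) / n"
  have "B \<noteq> A" "C \<noteq> A" using assms by auto
  then have n: "n > 0" by (simp add: n_def)
  have sq: "1 - x\<^sup>2 = (\<bar>orient A B C\<bar> / n)\<^sup>2"
    using n orient_squared[of A B C, folded n_def] by (simp add: x_def field_simps)
  moreover have "0 < (\<bar>orient A B C\<bar> / n)\<^sup>2" using assms n by simp
  ultimately have "x\<^sup>2 < 1" by linarith
  then have x: "- 1 < x" "x < 1" by (auto simp: abs_square_less_1 abs_less_iff)
  have angle: "vertex_angle B A C = arccos x" by (simp add: vertex_angle_def x_def n_def)
  show "0 < vertex_angle B A C" "vertex_angle B A C < pi" using arccos_lt_bounded[OF x] angle by auto
  show "cos (vertex_angle B A C) = ((B - A) \<bullet> (C - A)) / (norm (B - A) * norm (C - A))"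
    using x by (simp add: angle) (simp add: x_def n_def)
  show "sin (vertex_angle B A C) = \<bar>orient A B C\<bar> / (norm (B - A) * norm (C - A))"
    using x n sq by (simp add: angle sin_arccos_abs) (simp add: n_def)
qed

lemmas vertex_angle_bounds = cos_sin_vertex_angle(1,2)

lemma law_of_sines:
  assumes "orient A B C \<noteq> 0"
  obtains k where "k > 0" "norm (C - B) = k * sin (vertex_angle B A C)"
    "norm (C - A) = k * sin (vertex_angle A B C)" "norm (B - A) = k * sin (vertex_angle A C B)"
proof (rule that)
  have ne: "A \<noteq> B" "B \<noteq> C" "C \<noteq> A" using assms by auto
  have abs: "\<bar>orient B A C\<bar> = \<bar>orient A B C\<bar>" "\<bar>orient C A B\<bar> = \<bar>orient A B C\<bar>"
    using orient_swap(1)[of A B C] orient_rotate[of A B C] by simp_all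
  then have nd: "orient B A C \<noteq> 0" "orient C A B \<noteq> 0" using assms by auto
  have n: "norm (A - B) = norm (B - A)" "norm (A - C) = norm (C - A)" "norm (B - C) = norm (C - B)"
    by (simp_all add: norm_minus_commute)
  let ?k = "norm (B - A) * norm (C - B) * norm (C - A) / \<bar>orient A B C\<bar>"
  show "?k > 0" using ne assms by simp
  show "norm (C - B) = ?k * sin (vertex_angle B A C)" "norm (C - A) = ?k * sin (vertex_angle A B C)"
    "norm (B - A) = ?k * sin (vertex_angle A C B)"
    using ne assms by (simp_all add: cos_sin_vertex_angle(4)[OF assms] cos_sin_vertex_angle(4)[OF nd(1)]
      cos_sin_vertex_angle(4)[OF nd(2)] abs n)
qed

text \<open>The oriented angle at \<open>w\<close> under which the segment from \<open>p\<close> to \<open>q\<close> is seen; it is 0 also when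
  \<open>w\<close> lies between \<open>p\<close> and \<open>q\<close>.\<close>

definition view_angle :: "complex \<Rightarrow> complex \<Rightarrow> complex \<Rightarrow> real" where
  "view_angle w p q = (if orient w p q = 0 then 0 else Arg ((q - w) / (p - w)))"

lemma Im_divide_orient: "Im ((q - w) / (p - w)) = orient w p q / (norm (p - w))\<^sup>2"
  unfolding cmod_power2 by (simp add: orient_Re_Im Im_divide algebra_simps)

lemma Re_divide_inner: "Re ((q - w) / (p - w)) = ((p - w) \<bullet> (q - w)) / (norm (p - w))\<^sup>2"
  unfolding cmod_power2 by (simp add: Re_divide inner_complex_def algebra_simps)

lemma view_angle_same [simp]: "view_angle w w q = 0" "view_angle w p w = 0" "view_angle w p p = 0"
  by (simp_all add: view_angle_def)

lemma Arg_divide_upper: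
  assumes "Im s > 0" "Im t > 0"
  shows "Arg (t / s) = Arg t - Arg s"
proof -
  have "s \<noteq> 0" "t \<noteq> 0" using assms by auto
  moreover have "0 < Arg s" "Arg s < pi" "0 < Arg t" "Arg t < pi" using assms Arg_lt_pi by blast+
  moreover have "t / s = rcis (norm t / norm s) (Arg t - Arg s)"
    using rcis_cmod_Arg[of s] rcis_cmod_Arg[of t] rcis_divide[of "norm t" "Arg t" "norm s" "Arg s"] by simp
  ultimately show ?thesis by (simp add: Arg_rcis)
qed

lemma view_angle_half_plane:
  assumes "side w d p > 0" "side w d q > 0"
  shows "view_angle w p q = Arg (cnj d * (q - w)) - Arg (cnj d * (p - w))"
proof -
  have pos: "Im (cnj d * (p - w)) > 0" "Im (cnj d * (q - w)) > 0" using assms by (simp_all add: side_def)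
  then have "(cnj d * (q - w)) / (cnj d * (p - w)) = (q - w) / (p - w)" by auto
  then have Arg: "Arg ((q - w) / (p - w)) = Arg (cnj d * (q - w)) - Arg (cnj d * (p - w))"
    using Arg_divide_upper[OF pos] by simp
  show ?thesis
  proof (cases "orient w p q = 0")
    case True
    then have "(q - w) / (p - w) \<in> \<real>" by (simp add: complex_is_Real_iff Im_divide_orient)
    then have "Arg ((q - w) / (p - w)) = 0 \<or> Arg ((q - w) / (p - w)) = pi" by (simp only: Arg_eq_0_pi)
    moreover have "Arg ((q - w) / (p - w)) < pi"
      unfolding Arg using pos Arg_lt_pi by (smt (verit))
    ultimately show ?thesis using True Arg by (simp add: view_angle_def)
  qed (use Arg in \<open>simp add: view_angle_def\<close>)
qed

lemma line_additive_view_angle: "line_additive (view_angle w)"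
  unfolding line_additive_def
proof (intro allI)
  fix v u r s t
  show "view_angle w (ray v u r) (ray v u s) + view_angle w (ray v u s) (ray v u t) =
      view_angle w (ray v u r) (ray v u t)"
  proof (cases "side v u w = 0")
    case True
    then have "orient w (ray v u r) (ray v u s) = 0" for r s
      using orient_rotate[of "ray v u r" "ray v u s" w] by (simp add: orient_ray)
    then show ?thesis by (simp add: view_angle_def)
  next
    case False
    have "side w (of_real (- side v u w) * u) (ray v u t) = (side v u w)\<^sup>2" for t
      by (simp add: side_def ray_def power2_eq_square algebra_simps)
    then have "side w (of_real (- side v u w) * u) (ray v u t) > 0" for t using False by simp
    note view_angle_half_plane[OF this this]
    then show ?thesis by simp
  qed
qed

lemma view_angle_ccw:
  assumes "orient w p q > 0"
  shows "view_angle w p q = vertex_angle p w q"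
proof -
  define z where "z = (q - w) / (p - w)"
  have ne: "p \<noteq> w" "q \<noteq> w" using assms by auto
  have nd: "orient w p q \<noteq> 0" using assms by simp
  have "Im z > 0" unfolding z_def Im_divide_orient using assms ne by simp
  then have Arg: "0 \<le> Arg z" "Arg z \<le> pi" using Arg_lt_pi[of z] by auto
  have "cos (Arg z) = Re z / norm z" using ne by (intro cos_Arg) (simp add: z_def)
  also have "\<dots> = cos (vertex_angle p w q)"
    unfolding z_def Re_divide_inner norm_divide cos_sin_vertex_angle(3)[OF nd]
    by (simp add: power2_eq_square)
  finally have "cos (Arg z) = cos (vertex_angle p w q)" .
  then have "Arg z = vertex_angle p w q"
    by (rule cos_inj_pi[OF Arg, rotated 2]) (use vertex_angle_bounds[OF nd] in simp_all)
  then show ?thesis using nd by (simp add: view_angle_def z_def)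
qed

lemma view_angle_eq_vertex_angle:
  assumes "orient w p q \<noteq> 0"
  shows "sgn (orient w p q) * view_angle w p q = vertex_angle p w q"
proof (cases "orient w p q > 0")
  case False
  then have "orient w q p > 0" "sgn (orient w p q) = - 1"
    using assms orient_swap(2)[of w p q] by (auto simp: sgn_if)
  then show ?thesis
    using view_angle_ccw[of w q p] line_additive_commute[OF line_additive_view_angle, of w p q]
      vertex_angle_commute[of q w p]
    by simp
qed (simp add: view_angle_ccw)

lemma cis_view_angle: "orient w p q \<noteq> 0 \<Longrightarrow> cis (view_angle w p q) = sgn ((q - w) / (p - w))"
  by (cases "p = w"; cases "q = w") (simp_all add: view_angle_def cis_Arg del: sgn_divide)

lemma cis_eq_1_imp_2pi:
  assumes "cis x = 1" "0 < x" "x < 4 * pi"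
  shows "x = 2 * pi"
proof -
  have "cos x = 1" using assms(1) by (metis cis.sel(1) one_complex.sel(1))
  then obtain n :: int where n: "x = of_int n * 2 * pi" using cos_one_2pi_int by auto
  then have "0 < n" "n < 2" using assms by (auto simp: zero_less_mult_iff)
  then have "n = 1" by linarith
  then show ?thesis using n by simp
qed

lemma cis_eq_minus_1_imp_pi: "cis x = -1 \<Longrightarrow> 0 < x \<Longrightarrow> x < 3 * pi \<Longrightarrow> x = pi"
  using cis_eq_1_imp_2pi[of "x + pi"] by (simp add: cis_mult[symmetric])

lemma triangle_angle_sum:
  assumes "orient A B C \<noteq> 0"
  shows "vertex_angle B A C + vertex_angle A B C + vertex_angle A C B = pi"
proof -
  have ccw: "vertex_angle B A C + vertex_angle A B C + vertex_angle A C B = pi" if d: "orient A B C > 0"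
    for A B C
  proof -
    have "A \<noteq> B" "B \<noteq> C" "C \<noteq> A" using d by auto
    then have "((C - A) / (B - A)) * ((A - B) / (C - B)) * ((B - C) / (A - C)) = -1"
      by (simp add: divide_simps) (simp add: algebra_simps)
    then have "sgn ((C - A) / (B - A)) * sgn ((A - B) / (C - B)) * sgn ((B - C) / (A - C)) = -1"
      by (simp only: sgn_mult[symmetric]) (simp add: sgn_minus)
    then have "cis (vertex_angle B A C + vertex_angle C B A + vertex_angle A C B) = -1"
      using d ccw_rotate[OF d] by (simp add: cis_mult[symmetric] cis_view_angle view_angle_ccw[symmetric])
    then have "vertex_angle B A C + vertex_angle C B A + vertex_angle A C B = pi"
      using vertex_angle_bounds[of A B C] vertex_angle_bounds[of B C A] vertex_angle_bounds[of C A B] d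
        ccw_rotate[OF d]
      by (intro cis_eq_minus_1_imp_pi) auto
    then show ?thesis by (simp add: vertex_angle_commute)
  qed
  consider "orient A B C > 0" | "orient B A C > 0" using assms orient_swap(1)[of A B C] by linarith
  then show ?thesis using ccw[of A B C] ccw[of B A C] by cases (simp_all add: vertex_angle_commute)
qed

definition angle_at :: "complex \<Rightarrow> complex \<Rightarrow> complex \<Rightarrow> complex \<Rightarrow> real" where
  "angle_at A B C w =
    (if w = A then vertex_angle B A C else if w = B then vertex_angle A B C
     else if w = C then vertex_angle A C B
     else if w \<in> interior (convex hull {A, B, C}) then 2 * pi else if w \<in> convex hull {A, B, C} then pi else 0)"

lemma angle_at_eq_sum:
  assumes nd: "orient A B C \<noteq> 0"
  shows "angle_at A B C w =
      (if A = w then vertex_angle B A C else 0) + (if B = w then vertex_angle A B C else 0)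
    + (if C = w then vertex_angle A C B else 0)
    + (if w \<in> convex hull {A, B, C} - interior (convex hull {A, B, C}) - {A, B, C} then pi else 0)
    + (if w \<in> interior (convex hull {A, B, C}) then 2 * pi else 0)"
proof (cases "w \<in> {A, B, C}")
  case True
  moreover have "A \<noteq> B" "B \<noteq> C" "C \<noteq> A" using nd by auto
  moreover have "w \<notin> interior (convex hull {A, B, C})" using nd True by (rule vertex_notin_interior)
  ultimately show ?thesis unfolding angle_at_def by (elim insertE emptyE) simp_all
next
  case False
  then have "A \<noteq> w" "B \<noteq> w" "C \<noteq> w" by auto
  then show ?thesis
    using False subsetD[OF interior_subset, of w "convex hull {A, B, C}"] by (simp add: angle_at_def)
qed

lemma sum_view_angle_vertex:
  assumes nd: "orient A B C \<noteq> 0" and w: "w \<in> {A, B, C}"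
  shows "(\<Sum>(x, y)\<in>ccw_edges A B C. view_angle w x y) = angle_at A B C w"
proof -
  have "A \<noteq> B" "B \<noteq> C" "C \<noteq> A" using nd by auto
  moreover have "orient B C A = orient A B C" "orient C A B = orient A B C"
    using orient_rotate[of A B C] orient_rotate[of B C A] by simp_all
  ultimately show ?thesis
    using w nd view_angle_eq_vertex_angle[of A B C] view_angle_eq_vertex_angle[of B C A]
      view_angle_eq_vertex_angle[of C A B] vertex_angle_commute[of C B A]
    by (auto simp: sum_ccw_edges[OF line_additive_view_angle nd] angle_at_def)
qed

lemma sum_view_angle_interior:
  assumes nd: "orient A B C \<noteq> 0" and w: "w \<in> interior (convex hull {A, B, C})"
  shows "(\<Sum>(x, y)\<in>ccw_edges A B C. view_angle w x y) = 2 * pi"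
  using nd
proof (rule ccw_edges_obtain)
  fix x y z assume E: "ccw_edges A B C = {(x, y), (y, z), (z, x)}" and ccw: "orient x y z > 0"
  then have pos: "orient w x y > 0" "orient w y z > 0" "orient w z x > 0"
    using w by (simp_all add: interior_ccw_edges[OF nd] orient_rotate[of _ _ w])
  then have ne: "w \<noteq> x" "w \<noteq> y" "w \<noteq> z" by auto
  have "sgn ((y - w) / (x - w)) * sgn ((z - w) / (y - w)) * sgn ((x - w) / (z - w)) = 1"
    using ne by (simp only: sgn_mult[symmetric]) simp
  then have "cis (view_angle w x y + view_angle w y z + view_angle w z x) = 1"
    using pos by (simp add: cis_mult[symmetric] cis_view_angle)
  then have "view_angle w x y + view_angle w y z + view_angle w z x = 2 * pi"
    using pos vertex_angle_bounds[of w x y] vertex_angle_bounds[of w y z] vertex_angle_bounds[of w z x]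
    by (intro cis_eq_1_imp_2pi) (simp_all add: view_angle_ccw)
  moreover have "x \<noteq> y" "y \<noteq> z" "z \<noteq> x" using ccw by auto
  ultimately show ?thesis by (simp add: E)
qed

lemma sum_view_angle_edge:
  assumes nd: "orient A B C \<noteq> 0" and e: "(x, y) \<in> ccw_edges A B C" and w: "w \<in> open_segment x y"
  shows "(\<Sum>(x, y)\<in>ccw_edges A B C. view_angle w x y) = pi"
  using nd e
proof (rule ccw_edgeE)
  fix z assume E: "ccw_edges A B C = {(x, y), (y, z), (z, x)}" and ccw: "orient x y z > 0"
  have pos: "orient w x y = 0" "orient w y z > 0" "orient w z x > 0"
    using open_segment_ccw[OF ccw w] by (simp_all add: orient_rotate[of _ _ w])
  obtain s where s: "0 < s" "s < norm (y - x)" "w = ray x (sgn (y - x)) s"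
    using w by (rule open_segment_rayE)
  have "x - w = of_real (- s) * sgn (y - x)" "y - w = of_real (norm (y - x) - s) * sgn (y - x)"
    using ray_to[of x y] by (simp_all add: s(3) ray_def algebra_simps)
  then have opposite: "sgn ((x - w) / (y - w)) = -1"
    using s(1,2) ccw
    by (auto simp: sgn_mult sgn_divide sgn_of_real sgn_minus sgn_zero_iff simp del: of_real_diff)
  have "w \<noteq> x" "w \<noteq> y" "w \<noteq> z" using pos by auto
  then have "sgn ((z - w) / (y - w)) * sgn ((x - w) / (z - w)) = sgn ((x - w) / (y - w))"
    by (simp only: sgn_mult[symmetric]) simp
  then have "cis (view_angle w y z + view_angle w z x) = -1"
    using pos opposite by (simp add: cis_mult[symmetric] cis_view_angle del: sgn_divide)
  then have "view_angle w y z + view_angle w z x = pi"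
    using pos vertex_angle_bounds[of w y z] vertex_angle_bounds[of w z x]
    by (intro cis_eq_minus_1_imp_pi) (simp_all add: view_angle_ccw)
  moreover have "x \<noteq> y" "y \<noteq> z" "z \<noteq> x" using ccw by auto
  ultimately show ?thesis using pos(1) by (simp add: E) (simp add: view_angle_def)
qed

lemma sum_view_angle_outside:
  assumes nd: "orient A B C \<noteq> 0" and w: "w \<notin> convex hull {A, B, C}"
  shows "(\<Sum>(x, y)\<in>ccw_edges A B C. view_angle w x y) = 0"
proof -
  obtain x y where xy: "(x, y) \<in> ccw_edges A B C" "orient x y w < 0"
    using w by (auto simp: convex_hull_ccw_edges[OF nd] not_le)
  have "side w (y - x) q > 0" if "q \<in> {A, B, C}" for q
  proof -
    have "q \<in> convex hull {A, B, C}" using that by (rule hull_inc)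
    then have "orient x y q \<ge> 0" using xy(1) by (auto simp: convex_hull_ccw_edges[OF nd])
    moreover have "side w (y - x) q = orient x y q - orient x y w"
      by (simp add: orient_def side_def algebra_simps)
    ultimately show ?thesis using xy(2) by simp
  qed
  then show ?thesis
    by (simp add: sum_ccw_edges[OF line_additive_view_angle nd] view_angle_half_plane[of w "y - x"])
qed

lemma sum_view_angle:
  assumes nd: "orient A B C \<noteq> 0"
  shows "(\<Sum>(x, y)\<in>ccw_edges A B C. view_angle w x y) = angle_at A B C w"
proof (cases "w \<in> convex hull {A, B, C}")
  case inside: True
  with nd show ?thesis
  proof (rule convex_hull_3_cases)
    assume "w \<in> {A, B, C}"
    with nd show ?thesis by (rule sum_view_angle_vertex)
  next
    assume interior: "w \<in> interior (convex hull {A, B, C})"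
    then have "w \<notin> {A, B, C}" using vertex_notin_interior[OF nd] by blast
    then show ?thesis using interior sum_view_angle_interior[OF nd interior] by (simp add: angle_at_def)
  next
    fix x y assume edge: "(x, y) \<in> ccw_edges A B C" "w \<in> open_segment x y"
    then show ?thesis
      using sum_view_angle_edge[OF nd edge] open_segment_ccw_edge[OF nd edge] by (simp add: angle_at_def)
  qed
next
  case False
  moreover have "w \<notin> interior (convex hull {A, B, C})" "w \<notin> {A, B, C}"
    using False interior_subset[of "convex hull {A, B, C}"] hull_inc[of w "{A, B, C}" convex] by blast+
  ultimately show ?thesis using sum_view_angle_outside[OF nd False] by (simp add: angle_at_def)
qed

lemma (in triangle_tiling) sum_angle_at:
  "(\<Sum>i\<in>I. angle_at (tA i) (tB i) (tC i) w) = angle_at X Y Z w"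
  using sum_tile_edges[OF line_additive_view_angle, of w]
  by (simp add: sum_view_angle tile_nondegenerate nondegenerate)

section \<open>The angles meeting at a point\<close>

lemma sum_if_eq_card:
  fixes z :: real
  assumes "finite S"
  shows "(\<Sum>i\<in>S. if P i then z else 0) = real (card {i\<in>S. P i}) * z"
  using assms by (simp add: sum.inter_filter[symmetric])

lemma sum_card_fibres:
  assumes "finite S" "finite V" "f ` S \<subseteq> V"
  shows "(\<Sum>w\<in>V. card {i\<in>S. f i = w}) = card S"
  using sum.group[OF assms, of "\<lambda>_. 1 :: nat"] by simp

locale dissimilar_tiling = triangle_tiling I tA tB tC X Y Z
  for I :: "'i set" and tA tB tC :: "'i \<Rightarrow> complex" and X Y Z :: complex +
  fixes a b c \<alpha> \<beta> :: real
  assumes side_lengths: "i \<in> I \<Longrightarrow> norm (tC i - tB i) = a" "i \<in> I \<Longrightarrow> norm (tC i - tA i) = b"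
      "i \<in> I \<Longrightarrow> norm (tB i - tA i) = c"
    and tile_angles: "i \<in> I \<Longrightarrow> vertex_angle (tB i) (tA i) (tC i) = \<alpha>"
      "i \<in> I \<Longrightarrow> vertex_angle (tA i) (tB i) (tC i) = \<beta>"
      "i \<in> I \<Longrightarrow> vertex_angle (tA i) (tC i) (tB i) = 2 * pi / 3"
    and angles_pos: "\<alpha> > 0" "\<beta> > 0"
    and angles_sum: "\<alpha> + \<beta> = pi / 3"
    and alpha_irrational: "q \<in> \<rat> \<Longrightarrow> \<alpha> \<noteq> q * pi"
    and dissimilar: "{#vertex_angle Y X Z, vertex_angle X Y Z, vertex_angle X Z Y#} \<noteq> {#\<alpha>, \<beta>, 2 * pi / 3#}"
begin

lemma tile_vertices_distinct: "i \<in> I \<Longrightarrow> tA i \<noteq> tB i \<and> tA i \<noteq> tC i \<and> tB i \<noteq> tC i"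
  using tile_nondegenerate by fastforce

lemma corners_distinct: "X \<noteq> Y" "Y \<noteq> Z" "X \<noteq> Z"
  using nondegenerate by auto

definition num_alpha :: "complex \<Rightarrow> nat" where "num_alpha w = card {i\<in>I. tA i = w}"
definition num_beta :: "complex \<Rightarrow> nat" where "num_beta w = card {i\<in>I. tB i = w}"
definition num_gamma :: "complex \<Rightarrow> nat" where "num_gamma w = card {i\<in>I. tC i = w}"

definition straight_tiles :: "complex \<Rightarrow> 'i set" where
  "straight_tiles w = {i\<in>I. w \<in> tile i - interior (tile i) - {tA i, tB i, tC i}}"

definition num_straight :: "complex \<Rightarrow> nat" where "num_straight w = card (straight_tiles w)"
definition num_full :: "complex \<Rightarrow> nat" where "num_full w = card {i\<in>I. w \<in> interior (tile i)}"

lemma angle_equation: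
  "num_alpha w * \<alpha> + num_beta w * \<beta> + num_gamma w * (2 * pi / 3) + num_straight w * pi + num_full w * (2 * pi) =
   angle_at X Y Z w"
proof -
  have "angle_at X Y Z w = (\<Sum>i\<in>I. angle_at (tA i) (tB i) (tC i) w)" by (rule sum_angle_at[symmetric])
  also have "\<dots> = (\<Sum>i\<in>I. (if tA i = w then \<alpha> else 0) + (if tB i = w then \<beta> else 0) +
      (if tC i = w then 2 * pi / 3 else 0) +
      (if w \<in> tile i - interior (tile i) - {tA i, tB i, tC i} then pi else 0) +
      (if w \<in> interior (tile i) then 2 * pi else 0))"
    by (rule sum.cong[OF refl]) (simp only: angle_at_eq_sum[OF tile_nondegenerate] tile_angles)
  also have "\<dots> = num_alpha w * \<alpha> + num_beta w * \<beta> + num_gamma w * (2 * pi / 3) + num_straight w * pi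
      + num_full w * (2 * pi)"
    by (simp only: sum.distrib sum_if_eq_card[OF finite_tiles] num_alpha_def num_beta_def num_gamma_def
        num_straight_def straight_tiles_def num_full_def)
  finally show ?thesis by simp
qed

lemma alpha_pi_independent:
  assumes "of_int m * \<alpha> = of_int n * (pi / 3)"
  shows "m = 0 \<and> n = 0"
proof -
  have "m = 0"
  proof (rule ccontr)
    assume "m \<noteq> 0"
    then have "\<alpha> = (of_int n / (3 * of_int m)) * pi" using assms by (simp add: field_simps)
    then show False using alpha_irrational[of "of_int n / (3 * of_int m)"] by simp
  qed
  then show ?thesis using assms by simp
qed

lemma angle_combination:
  fixes p q r h k n :: nat
  assumes "p * \<alpha> + q * \<beta> + r * (2 * pi / 3) + h * pi + k * (2 * pi) = n * (pi / 3)"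
  shows "q = p" "p + 2 * r + 3 * h + 6 * k = n"
proof -
  have \<beta>: "\<beta> = pi / 3 - \<alpha>" using angles_sum by simp
  have "of_int (int p - int q) * \<alpha> = of_int (int n - int q - 2 * int r - 3 * int h - 6 * int k) * (pi / 3)"
    using assms unfolding \<beta> by (simp add: algebra_simps)
  then show "q = p" "p + 2 * r + 3 * h + 6 * k = n" using alpha_pi_independent by fastforce+
qed

lemma noncorner_counts:
  assumes "w \<notin> {X, Y, Z}"
  shows "num_beta w = num_alpha w"
    and "num_alpha w + 2 * num_gamma w + 3 * num_straight w + 6 * num_full w =
      (if w \<in> interior big then 6 else if w \<in> big then 3 else 0)"
proof -
  have "angle_at X Y Z w = (if w \<in> interior big then 6 else if w \<in> big then 3 else 0 :: nat) * (pi / 3)"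
    using assms by (simp add: angle_at_def)
  note angle_combination[OF angle_equation[of w, unfolded this]]
  then show "num_beta w = num_alpha w"
    and "num_alpha w + 2 * num_gamma w + 3 * num_straight w + 6 * num_full w =
      (if w \<in> interior big then 6 else if w \<in> big then 3 else 0)"
    by blast+
qed

lemma corner_angle_at:
  "angle_at X Y Z X = vertex_angle Y X Z" "angle_at X Y Z Y = vertex_angle X Y Z"
  "angle_at X Y Z Z = vertex_angle X Z Y"
  using corners_distinct by (simp_all add: angle_at_def)

lemma corner_angle_bounds:
  assumes "w \<in> {X, Y, Z}"
  shows "0 < angle_at X Y Z w" "angle_at X Y Z w < pi"
proof -
  have "orient Y X Z \<noteq> 0" "orient Z X Y \<noteq> 0"
    using nondegenerate orient_swap(1)[of X Y Z] orient_rotate[of X Y Z] by auto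
  then have "0 < angle_at X Y Z w \<and> angle_at X Y Z w < pi"
    using assms vertex_angle_bounds[OF nondegenerate] vertex_angle_bounds[of Y X Z]
      vertex_angle_bounds[of Z X Y]
    by (auto simp: corner_angle_at)
  then show "0 < angle_at X Y Z w" "angle_at X Y Z w < pi" by simp_all
qed

lemma corner_tiles_exist:
  assumes "w \<in> {X, Y, Z}"
  shows "1 \<le> num_alpha w + num_beta w + num_gamma w + num_straight w + num_full w"
proof (rule ccontr)
  assume "\<not> ?thesis"
  then show False using corner_angle_bounds(1)[OF assms] angle_equation[of w] by (simp add: not_le)
qed

lemma corner_count_sums:
  "num_beta X + num_beta Y + num_beta Z = num_alpha X + num_alpha Y + num_alpha Z"
  "num_alpha X + num_alpha Y + num_alpha Z + 2 * (num_gamma X + num_gamma Y + num_gamma Z)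
    + 3 * (num_straight X + num_straight Y + num_straight Z) + 6 * (num_full X + num_full Y + num_full Z) = 3"
proof -
  have "(num_alpha X + num_alpha Y + num_alpha Z) * \<alpha> + (num_beta X + num_beta Y + num_beta Z) * \<beta>
    + (num_gamma X + num_gamma Y + num_gamma Z) * (2 * pi / 3)
    + (num_straight X + num_straight Y + num_straight Z) * pi
    + (num_full X + num_full Y + num_full Z) * (2 * pi) = (3 :: nat) * (pi / 3)"
    using angle_equation[of X] angle_equation[of Y] angle_equation[of Z] triangle_angle_sum[OF nondegenerate]
    by (simp add: corner_angle_at algebra_simps)
  from angle_combination[OF this] show
    "num_beta X + num_beta Y + num_beta Z = num_alpha X + num_alpha Y + num_alpha Z"
    "num_alpha X + num_alpha Y + num_alpha Z + 2 * (num_gamma X + num_gamma Y + num_gamma Z)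
      + 3 * (num_straight X + num_straight Y + num_straight Z)
      + 6 * (num_full X + num_full Y + num_full Z) = 3" .
qed

lemma corner_straight_full: "w \<in> {X, Y, Z} \<Longrightarrow> num_straight w = 0 \<and> num_full w = 0"
proof -
  have full: "num_full X + num_full Y + num_full Z = 0" using corner_count_sums(2) by simp
  have none: "s = 0" if "p + 2 * r + 3 * s = 3" "3 \<le> 2 * p + r + s" for p r s :: nat
    using that by presburger
  have "3 \<le> (num_alpha X + num_alpha Y + num_alpha Z) + (num_beta X + num_beta Y + num_beta Z)
      + (num_gamma X + num_gamma Y + num_gamma Z) + (num_straight X + num_straight Y + num_straight Z)
      + (num_full X + num_full Y + num_full Z)"
    using corner_tiles_exist[of X] corner_tiles_exist[of Y] corner_tiles_exist[of Z] by simp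
  then have "num_straight X + num_straight Y + num_straight Z = 0"
    using corner_count_sums unfolding full
    by (intro none[of "num_alpha X + num_alpha Y + num_alpha Z"
      "num_gamma X + num_gamma Y + num_gamma Z"]) simp_all
  with full show "w \<in> {X, Y, Z} \<Longrightarrow> num_straight w = 0 \<and> num_full w = 0" by auto
qed

lemma corner_angle_eq:
  assumes "w \<in> {X, Y, Z}"
  shows "angle_at X Y Z w = num_alpha w * \<alpha> + num_beta w * \<beta> + num_gamma w * (2 * pi / 3)"
  using angle_equation[of w] corner_straight_full[OF assms] by simp

text \<open>If a corner contains \<open>2\<pi>/3\<close>, then the three corners are single tile corners, one of each kind.\<close>

lemma corner_num_gamma: "num_gamma X + num_gamma Y + num_gamma Z = 0"
proof (rule ccontr)
  assume "num_gamma X + num_gamma Y + num_gamma Z \<noteq> 0"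
  moreover have "r = 1" "p = 1" if "p + 2 * r + 3 * s + 6 * k = 3" "r \<noteq> 0" for p r s k :: nat
    using that by presburger+
  note this[OF corner_count_sums(2)]
  ultimately have "num_gamma X + num_gamma Y + num_gamma Z = 1" "num_alpha X + num_alpha Y + num_alpha Z = 1"
    by blast+
  with corner_count_sums(1) have one: "num_alpha X + num_alpha Y + num_alpha Z = 1"
    "num_beta X + num_beta Y + num_beta Z = 1" "num_gamma X + num_gamma Y + num_gamma Z = 1" by simp_all
  have unit: "x = 1 \<and> y = 0 \<and> z = 0 \<or> x = 0 \<and> y = 1 \<and> z = 0 \<or> x = 0 \<and> y = 0 \<and> z = 1"
    if "x + y + z = 1" for x y z :: nat
    using that by presburger
  have "{#angle_at X Y Z X, angle_at X Y Z Y, angle_at X Y Z Z#} = {#\<alpha>, \<beta>, 2 * pi / 3#}"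
    using unit[OF one(1)] unit[OF one(2)] unit[OF one(3)] corner_straight_full
      corner_tiles_exist[of X] corner_tiles_exist[of Y] corner_tiles_exist[of Z]
    by (elim disjE conjE) (simp_all add: corner_angle_eq add_mset_commute)
  then show False using dissimilar by (simp add: corner_angle_at)
qed

lemma corner_counts:
  "num_alpha X + num_alpha Y + num_alpha Z = 3" "num_beta X + num_beta Y + num_beta Z = 3"
  using corner_count_sums corner_num_gamma corner_straight_full by simp_all

lemma corner_angles:
  "vertex_angle Y X Z = num_alpha X * \<alpha> + num_beta X * \<beta>"
  "vertex_angle X Y Z = num_alpha Y * \<alpha> + num_beta Y * \<beta>"
  "vertex_angle X Z Y = num_alpha Z * \<alpha> + num_beta Z * \<beta>"
  using corner_angle_eq[of X] corner_angle_eq[of Y] corner_angle_eq[of Z] corner_num_gamma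
  by (simp_all add: corner_angle_at)

definition stars :: "complex set" where
  "stars = {w. w \<notin> {X, Y, Z} \<and> num_alpha w = 0 \<and> num_gamma w = 3}"

definition alpha_beta_points :: "complex set" where
  "alpha_beta_points = {w. w \<notin> {X, Y, Z} \<and> num_alpha w = 3 \<and> num_gamma w = 0}"

lemma counted_in_vertices: "num_alpha w > 0 \<or> num_beta w > 0 \<or> num_gamma w > 0 \<Longrightarrow> w \<in> vertices"
  unfolding num_alpha_def num_beta_def num_gamma_def vertices_def card_gt_0_iff by auto

lemma special_points_subset: "stars \<subseteq> vertices - {X, Y, Z}" "alpha_beta_points \<subseteq> vertices - {X, Y, Z}"
  using counted_in_vertices by (force simp: stars_def alpha_beta_points_def)+

lemma finite_special_points: "finite stars" "finite alpha_beta_points"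
  using special_points_subset finite_vertices by (meson finite_Diff finite_subset)+

lemma sum_counts_vertices:
  "(\<Sum>w\<in>vertices. num_alpha w) = card I" "(\<Sum>w\<in>vertices. num_beta w) = card I"
  "(\<Sum>w\<in>vertices. num_gamma w) = card I"
  unfolding num_alpha_def num_beta_def num_gamma_def
  by (rule sum_card_fibres[OF finite_tiles finite_vertices], use corner_in_vertices(2) in blast)+

lemma noncorner_excess:
  assumes "w \<notin> {X, Y, Z}"
  shows "6 * (of_bool (w \<in> alpha_beta_points) - of_bool (w \<in> stars)) \<le>
    int (num_alpha w) + int (num_beta w) - 2 * int (num_gamma w)"
proof -
  have "num_alpha w + 2 * num_gamma w + 3 * num_straight w + 6 * num_full w = 0 \<or>
      num_alpha w + 2 * num_gamma w + 3 * num_straight w + 6 * num_full w = 3 \<or>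
      num_alpha w + 2 * num_gamma w + 3 * num_straight w + 6 * num_full w = 6"
    using noncorner_counts(2)[OF assms] by simp
  then have counts: "num_alpha w + 2 * num_gamma w = 0 \<or> num_alpha w + 2 * num_gamma w = 3 \<or>
      num_alpha w + 2 * num_gamma w = 6"
    by presburger
  then consider "num_gamma w = 0" | "num_gamma w = 1" | "num_gamma w = 2" | "num_gamma w = 3" by linarith
  then show ?thesis
    using counts noncorner_counts(1)[OF assms] assms
    by cases (auto simp: stars_def alpha_beta_points_def)
qed

text \<open>Every tile has one angle of each kind, so the excess adds up to 0 over all vertices; the corners take 6
  of it.\<close>

theorem card_alpha_beta_points_less: "card alpha_beta_points < card stars"
proof -
  define excess where "excess w = int (num_alpha w) + int (num_beta w) - 2 * int (num_gamma w)" for w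
  have card: "(\<Sum>w\<in>vertices - {X, Y, Z}. of_bool (w \<in> S)) = int (card S)" if "S \<subseteq> vertices - {X, Y, Z}" for S
    using that finite_vertices by (simp add: of_bool_def sum.If_cases Int_absorb1)
  have "6 * (int (card alpha_beta_points) - int (card stars)) =
      (\<Sum>w\<in>vertices - {X, Y, Z}. 6 * (of_bool (w \<in> alpha_beta_points) - of_bool (w \<in> stars)))"
    by (simp only: sum_distrib_left[symmetric] sum_subtractf card[OF special_points_subset(1)]
        card[OF special_points_subset(2)])
  also have "\<dots> \<le> (\<Sum>w\<in>vertices - {X, Y, Z}. excess w)"
    unfolding excess_def by (intro sum_mono noncorner_excess) simp
  also have "\<dots> = (\<Sum>w\<in>vertices. excess w) - (\<Sum>w\<in>{X, Y, Z}. excess w)"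
    using finite_vertices corner_in_vertices(1) by (intro sum_diff) auto
  also have "(\<Sum>w\<in>vertices. excess w) = 0"
    by (simp add: excess_def sum.distrib sum_subtractf sum_distrib_left[symmetric] sum_counts_vertices
      flip: of_nat_sum)
  also have "(\<Sum>w\<in>{X, Y, Z}. excess w) = 6"
    using corners_distinct corner_counts corner_num_gamma by (simp add: excess_def)
  finally show ?thesis by simp
qed

end

section \<open>Runs of edges of equal length\<close>

context triangle_tiling
begin

lemma tile_edgeD:
  assumes "(Some i, x, y) \<in> side_edges s"
  shows "i \<in> I" "x \<in> {tA i, tB i, tC i}" "y \<in> {tA i, tB i, tC i}"
  using assms by (auto simp: side_edges_def ccw_edges_def split: if_splits)

definition cuts_big :: "complex \<Rightarrow> complex \<Rightarrow> bool" where
  "cuts_big v u \<longleftrightarrow> (\<exists>z\<in>big. side v u z > 0) \<and> (\<exists>z\<in>big. side v u z < 0)"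

lemma tile_beside_edge:
  assumes e: "(Some i, x, y) \<in> side_edges s" and cov: "covers_ray v u x y"
  shows "\<exists>z\<in>big. if s then side v u z > 0 else side v u z < 0"
proof -
  obtain r t where rt: "r < t" "x = ray v u r" "y = ray v u t"
    using covers_rayE[of v u 0] cov by (metis le_less_trans ray_0)
  have i: "i \<in> I" using tile_edgeD(1)[OF e] .
  have left: "\<exists>z\<in>big. orient p q z > 0" if "(p, q) \<in> tile_edges i" for p q
    using tile_nondegenerate[OF i] that
  proof (rule ccw_edgeE)
    fix z assume z: "orient p q z > 0" "{tA i, tB i, tC i} = {p, q, z}"
    then have "z \<in> tile i" by (intro hull_inc) auto
    then show ?thesis using z(1) tile_subset[OF i] by blast
  qed
  have "\<exists>z\<in>big. if s then orient x y z > 0 else orient y x z > 0"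
    using e left by (cases s) (auto simp: side_edges_def)
  then show ?thesis using rt
    by (auto simp: orient_ray zero_less_mult_iff mult_less_0_iff split: if_splits)
qed

lemma outer_edge_not_on_cutting_line:
  assumes cuts: "cuts_big v u" and e: "(None, x, y) \<in> side_edges s"
  shows "\<not> covers_ray (ray v u t) u x y"
proof
  assume "covers_ray (ray v u t) u x y"
  then obtain p q where pq: "p < q" "x = ray v u p" "y = ray v u q"
    by (metis covers_rayE le_less_trans)
  obtain z z' where z: "z \<in> big" "side v u z > 0" "z' \<in> big" "side v u z' < 0"
    using cuts by (auto simp: cuts_big_def)
  have "(if s then (y, x) else (x, y)) \<in> ccw_edges X Y Z" using e by (auto simp: side_edges_def)
  then have "if s then orient y x z \<ge> 0 else orient x y z' \<ge> 0"
    using z(1,3) by (auto simp: convex_hull_ccw_edges[OF nondegenerate] split: if_splits)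
  then show False using pq z(2,4) by (auto simp: orient_ray zero_le_mult_iff split: if_splits)
qed

lemma outer_edge_not_at_interior_point:
  assumes "w \<in> interior big" "(None, x, y) \<in> side_edges s"
  shows "\<not> covers_ray w u x y"
proof
  assume "covers_ray w u x y"
  then have w: "w = x \<or> w \<in> open_segment x y" by (auto simp: covers_ray_iff)
  have e: "(if s then (y, x) else (x, y)) \<in> ccw_edges X Y Z" using assms(2) by (auto simp: side_edges_def)
  then have "x \<in> {X, Y, Z}" by (auto simp: ccw_edges_def split: if_splits)
  then have "w \<in> open_segment x y" using w assms(1) vertex_notin_interior[OF nondegenerate] by blast
  then show False
    using open_segment_ccw_edge[OF nondegenerate, of x y w] open_segment_ccw_edge[OF nondegenerate, of y x w] e
      assms(1)
    by (auto simp: open_segment_commute split: if_splits)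
qed

lemma opposite_tile_edge:
  assumes "(Some i, x, y) \<in> side_edges s" "covers_ray w u x y"
    and "\<And>x' y'. (None, x', y') \<in> side_edges (\<not> s) \<Longrightarrow> \<not> covers_ray w u x' y'"
  obtains j x' y' where "(Some j, x', y') \<in> side_edges (\<not> s)" "covers_ray w u x' y'"
proof -
  obtain d x' y' where "(d, x', y') \<in> side_edges (\<not> s)" "covers_ray w u x' y'"
    using covering_edge_opposite[OF assms(1,2)] by blast
  then show thesis using assms(3) that by (cases d) blast+
qed

end

context dissimilar_tiling
begin

definition is_a_edge :: "'i \<Rightarrow> complex \<Rightarrow> complex \<Rightarrow> bool" where
  "is_a_edge i x y \<longleftrightarrow> {x, y} = {tB i, tC i}"

lemma is_a_edge_commute: "is_a_edge i x y \<longleftrightarrow> is_a_edge i y x"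
  by (auto simp: is_a_edge_def)

lemma tile_edge_length:
  assumes "(Some i, x, y) \<in> side_edges s"
  shows "norm (y - x) \<in> (if is_a_edge i x y then {a} else {b, c})"
  using tile_edgeD[OF assms] side_edgesD(2)[OF assms] side_lengths[of i]
  by (auto simp: is_a_edge_def doubleton_eq_iff norm_minus_commute)

lemma sides_pos: "a > 0" "b > 0" "c > 0"
proof -
  obtain i where i: "i \<in> I" using tiles_nonempty by blast
  have "norm (tC i - tB i) > 0" "norm (tC i - tA i) > 0" "norm (tB i - tA i) > 0"
    using tile_vertices_distinct[OF i] by auto
  then show "a > 0" "b > 0" "c > 0" unfolding side_lengths[OF i] .
qed

definition mixed_length :: "real \<Rightarrow> bool" where
  "mixed_length t \<longleftrightarrow> (\<exists>i j k :: nat. t = real i * a + real j * b + real k * c \<and> j + k > 0)"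

lemma mixed_length_b_c: "l \<in> {b, c} \<Longrightarrow> mixed_length l"
  unfolding mixed_length_def
  by (elim insertE emptyE, rule exI[of _ 0], rule exI[of _ 1], rule exI[of _ 0], simp,
      rule exI[of _ 0], rule exI[of _ 0], rule exI[of _ 1], simp)

lemma mixed_length_add:
  assumes "mixed_length t" "l \<in> {a, b, c}"
  shows "mixed_length (t + l)"
proof -
  obtain i j k :: nat where t: "t = real i * a + real j * b + real k * c" "j + k > 0"
    using assms(1) unfolding mixed_length_def by blast
  from assms(2) consider "l = a" | "l = b" | "l = c" by blast
  then show ?thesis unfolding mixed_length_def
  proof cases
    case 1
    then show "\<exists>i j k :: nat. t + l = real i * a + real j * b + real k * c \<and> j + k > 0"
      using t by (intro exI[of _ "Suc i"] exI[of _ j] exI[of _ k]) (simp add: algebra_simps)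
  next
    case 2
    then show "\<exists>i j k :: nat. t + l = real i * a + real j * b + real k * c \<and> j + k > 0"
      using t by (intro exI[of _ i] exI[of _ "Suc j"] exI[of _ k]) (simp add: algebra_simps)
  next
    case 3
    then show "\<exists>i j k :: nat. t + l = real i * a + real j * b + real k * c \<and> j + k > 0"
      using t by (intro exI[of _ i] exI[of _ j] exI[of _ "Suc k"]) (simp add: algebra_simps)
  qed
qed

text \<open>A run starts at \<open>v\<close> in direction \<open>u\<close> on the side \<open>s\<close> of the line where the edge of length \<open>a\<close> lies.\<close>

definition run_starts :: "(complex \<times> complex \<times> bool) set" where
  "run_starts = {(v, u, s). \<exists>i x j y.
     (Some i, v, x) \<in> side_edges s \<and> is_a_edge i v x \<and> sgn (x - v) = u \<and>
     (Some j, v, y) \<in> side_edges (\<not> s) \<and> \<not> is_a_edge j v y \<and> sgn (y - v) = u}"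

definition is_run :: "complex \<Rightarrow> complex \<Rightarrow> bool \<Rightarrow> nat \<Rightarrow> bool" where
  "is_run v u s n \<longleftrightarrow> (\<forall>k<n. \<exists>i. (Some i, ray v u (k * a), ray v u (Suc k * a)) \<in> side_edges s \<and>
      is_a_edge i (ray v u (k * a)) (ray v u (Suc k * a)))"

lemma run_startE:
  assumes "(v, u, s) \<in> run_starts"
  obtains i x j y where "(Some i, v, x) \<in> side_edges s" "is_a_edge i v x" "sgn (x - v) = u"
    "(Some j, v, y) \<in> side_edges (\<not> s)" "\<not> is_a_edge j v y" "sgn (y - v) = u"
  using assms unfolding run_starts_def mem_Collect_eq prod.case by (elim exE conjE)

lemma run_start_properties:
  assumes "(v, u, s) \<in> run_starts"
  shows "norm u = 1" "cuts_big v u"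
proof -
  from assms obtain i x j y where e: "(Some i, v, x) \<in> side_edges s" "sgn (x - v) = u"
    "(Some j, v, y) \<in> side_edges (\<not> s)" "sgn (y - v) = u"
    by (rule run_startE)
  have cov: "covers_ray v u v x" "covers_ray v u v y"
    by (rule side_edge_covers_ray[OF e(1,2)], rule side_edge_covers_ray[OF e(3,4)])
  then show "norm u = 1" by (simp add: covers_ray_def)
  show "cuts_big v u"
    using tile_beside_edge[OF e(1) cov(1)] tile_beside_edge[OF e(3) cov(2)]
    by (cases s) (auto simp: cuts_big_def)
qed

lemma run_start_opposite_edge:
  assumes "(v, u, s) \<in> run_starts" "(Some i, x, y) \<in> side_edges r" "covers_ray (ray v u t) u x y"
  obtains j x' y' where "(Some j, x', y') \<in> side_edges (\<not> r)" "covers_ray (ray v u t) u x' y'"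
  using assms(2,3) outer_edge_not_on_cutting_line[OF run_start_properties(2)[OF assms(1)]]
  by (rule opposite_tile_edge)

lemma run_covers:
  assumes run: "is_run v u s n" "norm u = 1" and t: "0 \<le> t" "t < n * a"
  obtains i x y where "(Some i, x, y) \<in> side_edges s" "covers_ray (ray v u t) u x y"
proof -
  define k where "k = nat \<lfloor>t / a\<rfloor>"
  have "real k \<le> t / a" "t / a < real k + 1" using t sides_pos(1) by (auto simp: k_def)
  then have k: "k * a \<le> t" "t < Suc k * a" using sides_pos(1) by (auto simp: field_simps)
  then have "k * a < n * a" using t(2) by linarith
  then have "k < n" using sides_pos(1) by simp
  then obtain i where i: "(Some i, ray v u (k * a), ray v u (Suc k * a)) \<in> side_edges s"
    using run(1) unfolding is_run_def by blast
  moreover have "covers_ray (ray v u t) u (ray v u (k * a)) (ray v u (Suc k * a))"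
    using k run(2) by (simp only: covers_ray_ray_iff)
  ultimately show thesis by (rule that)
qed

definition mixed_breaks :: "complex \<Rightarrow> complex \<Rightarrow> bool \<Rightarrow> real set" where
  "mixed_breaks v u s = {t. 0 < t \<and> mixed_length t \<and>
     (\<exists>j x. (Some j, x, ray v u t) \<in> side_edges s \<and> sgn (ray v u t - x) = u)}"

lemma finite_mixed_breaks:
  assumes "norm u = 1"
  shows "finite (mixed_breaks v u s)"
proof -
  have "u \<noteq> 0" using assms by auto
  then have "inj_on (ray v u) (mixed_breaks v u s)" by (auto simp: inj_on_def ray_eq_iff)
  moreover have "ray v u ` mixed_breaks v u s \<subseteq> vertices"
    unfolding mixed_breaks_def using side_edgesD(4) by blast
  ultimately show ?thesis using finite_vertices finite_imageD finite_subset by blast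
qed

lemma edge_end_mixed_break:
  assumes e: "(Some j, ray v u t, y) \<in> side_edges s" "sgn (y - ray v u t) = u"
    and t: "0 \<le> t" "t < t0" "ray v u t0 \<notin> open_segment (ray v u t) y"
    and mixed: "mixed_length (t + norm (y - ray v u t))"
  shows "t + norm (y - ray v u t) \<in> mixed_breaks v u s \<inter> {t<..t0}"
proof -
  define l where "l = norm (y - ray v u t)"
  have y: "y = ray v u (t + l)" using ray_to[of "ray v u t" y] e(2) by (simp add: l_def)
  have l: "0 < l" using side_edgesD(2)[OF e(1)] by (simp add: l_def)
  have "u \<noteq> 0" using e(2) side_edgesD(2)[OF e(1)] by (metis right_minus_eq sgn_zero_iff)
  have "t + l \<le> t0"
  proof (rule ccontr)
    assume "\<not> t + l \<le> t0"
    then have "ray v u t0 \<in> open_segment (ray v u t) y"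
      using t l \<open>u \<noteq> 0\<close> by (simp add: y ray_in_open_segment_iff)
    then show False using t(3) by blast
  qed
  moreover have "(Some j, ray v u t, ray v u (t + l)) \<in> side_edges s" "sgn (ray v u (t + l) - ray v u t) = u"
    using e by (simp_all add: y)
  moreover have "0 < t + l" using t l by simp
  ultimately have "t + l \<in> mixed_breaks v u s"
    using mixed unfolding mixed_breaks_def l_def[symmetric] by blast
  then show ?thesis using \<open>t + l \<le> t0\<close> l by (simp add: l_def)
qed

lemma edge_after_mixed_break:
  assumes start: "(v, u, s) \<in> run_starts" and run: "is_run v u s n"
    and t: "t \<in> mixed_breaks v u (\<not> s)" "t < n * a"
  obtains k y where "(Some k, ray v u t, y) \<in> side_edges (\<not> s)" "sgn (y - ray v u t) = u"
    "mixed_length (t + norm (y - ray v u t))"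
proof -
  obtain j x where last: "(Some j, x, ray v u t) \<in> side_edges (\<not> s)" "sgn (ray v u t - x) = u"
    and mixed: "0 < t" "mixed_length t"
    using t(1) by (auto simp: mixed_breaks_def)
  obtain i x1 y1 where "(Some i, x1, y1) \<in> side_edges s" "covers_ray (ray v u t) u x1 y1"
    using run_covers[OF run run_start_properties(1)[OF start], of t] mixed(1) t(2) by auto
  with start obtain k x' y where next_edge: "(Some k, x', y) \<in> side_edges (\<not> s)" "covers_ray (ray v u t) u x' y"
    by (rule run_start_opposite_edge)
  have x': "x' = ray v u t" using edge_end_is_start[OF last next_edge] .
  have "norm (y - x') \<in> {a, b, c}" using tile_edge_length[OF next_edge(1)] by (auto split: if_splits)
  then have "mixed_length (t + norm (y - x'))" using mixed(2) by (intro mixed_length_add)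
  then show thesis using that next_edge by (simp add: x' covers_ray_iff)
qed

text \<open>On the other side of a run the first edge has length \<open>b\<close> or \<open>c\<close>, so all edges there end at mixed distances
  from \<open>v\<close>. The last of these distances up to \<open>t0\<close> is \<open>t0\<close> itself, unless an edge passes through that point.\<close>

lemma opposite_side_of_run:
  assumes start: "(v, u, s) \<in> run_starts" and run: "is_run v u s n" and t0: "0 < t0" "t0 \<le> n * a"
  shows "mixed_length t0 \<or>
    (\<exists>j x y. (Some j, x, y) \<in> side_edges (\<not> s) \<and> sgn (y - x) = u \<and> ray v u t0 \<in> open_segment x y)"
proof (rule disjCI)
  assume not_inside:
    "\<not> (\<exists>j x y. (Some j, x, y) \<in> side_edges (\<not> s) \<and> sgn (y - x) = u \<and> ray v u t0 \<in> open_segment x y)"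
  define breaks where "breaks = mixed_breaks v u (\<not> s) \<inter> {0<..t0}"
  have edge_end: "t + norm (y - ray v u t) \<in> breaks \<inter> {t<..}"
    if "(Some j, ray v u t, y) \<in> side_edges (\<not> s)" "sgn (y - ray v u t) = u" "0 \<le> t" "t < t0"
      "mixed_length (t + norm (y - ray v u t))" for t j y
  proof -
    have "ray v u t0 \<notin> open_segment (ray v u t) y" using not_inside that(1,2) by blast
    from edge_end_mixed_break[OF that(1-4) this that(5)] show ?thesis
      by (auto simp: breaks_def mixed_breaks_def)
  qed
  from start obtain j y where first: "(Some j, v, y) \<in> side_edges (\<not> s)" "\<not> is_a_edge j v y" "sgn (y - v) = u"
    by (rule run_startE)
  have "mixed_length (norm (y - v))"
    using tile_edge_length[OF first(1)] first(2) by (intro mixed_length_b_c) simp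
  then have "breaks \<noteq> {}" using edge_end[of j 0 y] first(1,3) t0(1) by auto
  moreover have "finite breaks"
    using finite_mixed_breaks[OF run_start_properties(1)[OF start]] by (simp add: breaks_def)
  ultimately obtain t where t: "t \<in> breaks" and max: "\<And>t'. t' \<in> breaks \<Longrightarrow> t' \<le> t"
    using Max_in Max_ge by blast
  have "t = t0"
  proof (rule ccontr)
    assume "t \<noteq> t0"
    then have less: "0 \<le> t" "t < t0" and break: "t \<in> mixed_breaks v u (\<not> s)" using t by (auto simp: breaks_def)
    have "t < n * a" using less t0 by simp
    with start run break obtain k y where "(Some k, ray v u t, y) \<in> side_edges (\<not> s)" "sgn (y - ray v u t) = u"
      "mixed_length (t + norm (y - ray v u t))"
      by (rule edge_after_mixed_break)
    then show False using edge_end less max by fastforce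
  qed
  then show "mixed_length t0" using t by (simp add: breaks_def mixed_breaks_def)
qed

definition is_run_end :: "complex \<Rightarrow> complex \<Rightarrow> bool \<Rightarrow> bool" where
  "is_run_end w u s \<longleftrightarrow>
     (\<exists>i x. (Some i, x, w) \<in> side_edges s \<and> is_a_edge i x w \<and> sgn (w - x) = u) \<and>
     (\<exists>j y. (Some j, w, y) \<in> side_edges s \<and> \<not> is_a_edge j w y \<and> sgn (y - w) = u) \<and>
     (\<exists>k z z'. (Some k, z, z') \<in> side_edges (\<not> s) \<and> sgn (z' - z) = u \<and> w \<in> open_segment z z')"

lemma longest_run:
  assumes start: "(v, u, s) \<in> run_starts"
  obtains n where "is_run v u s (Suc n)" "\<not> is_run v u s (Suc (Suc n))"
proof -
  note u = run_start_properties(1)[OF start]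
  from start obtain i x where e: "(Some i, v, x) \<in> side_edges s" "is_a_edge i v x" "sgn (x - v) = u"
    by (rule run_startE)
  have "x = ray v u a" using ray_to[of v x] tile_edge_length[OF e(1)] e(2,3) by simp
  then have one: "is_run v u s 1" unfolding is_run_def using e by auto
  have "u \<noteq> 0" using u by auto
  have bound: "n \<le> card vertices" if "is_run v u s n" for n
  proof -
    have "(\<lambda>k. ray v u (k * a)) ` {..<n} \<subseteq> vertices"
      using that side_edgesD(3) unfolding is_run_def by blast
    moreover have "inj_on (\<lambda>k. ray v u (real k * a)) {..<n}"
      using sides_pos(1) \<open>u \<noteq> 0\<close> by (auto simp: inj_on_def ray_eq_iff)
    ultimately have "card {..<n} \<le> card vertices" using card_inj_on_le finite_vertices by blast
    then show ?thesis by simp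
  qed
  define n where "n = (GREATEST n. is_run v u s n)"
  have "is_run v u s n" unfolding n_def using one bound by (rule GreatestI_nat)
  moreover have max: "m \<le> n" if "is_run v u s m" for m
    unfolding n_def using that bound by (rule Greatest_le_nat)
  moreover obtain k where "n = Suc k" using max[OF one] by (cases n) auto
  ultimately show thesis using that[of k] max[of "Suc n"] by auto
qed

lemma run_end_exists:
  assumes start: "(v, u, s) \<in> run_starts" and no_relation: "\<And>m :: nat. \<not> mixed_length (m * a)"
  shows "\<exists>n. is_run v u s n \<and> is_run_end (ray v u (n * a)) u s"
proof -
  note u = run_start_properties(1)[OF start]
  from start obtain n where run: "is_run v u s (Suc n)" and max: "\<not> is_run v u s (Suc (Suc n))"
    by (rule longest_run)
  define w where "w = ray v u (Suc n * a)"
  have "0 < Suc n * a" using sides_pos(1) by simp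
  then obtain k z z' where through: "(Some k, z, z') \<in> side_edges (\<not> s)" "sgn (z' - z) = u"
    "w \<in> open_segment z z'"
    using opposite_side_of_run[OF start run _ order_refl] no_relation unfolding w_def by blast
  obtain i where last: "(Some i, ray v u (n * a), w) \<in> side_edges s" "is_a_edge i (ray v u (n * a)) w"
    using run unfolding is_run_def w_def by blast
  have dir: "sgn (w - ray v u (n * a)) = u"
    unfolding w_def using u sides_pos(1) by (intro sgn_ray_diff) simp_all
  have "covers_ray w u z z'" using covers_ray_open_segment[OF through(3)] through(2) by simp
  then obtain j x y where next_edge: "(Some j, x, y) \<in> side_edges s" "covers_ray w u x y"
    using run_start_opposite_edge[OF start through(1), of "Suc n * a"]
    unfolding w_def[symmetric] not_not by blast
  have x: "x = w" using edge_end_is_start[OF last(1) dir next_edge] .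
  have y: "sgn (y - w) = u" using next_edge(2) x by (simp add: covers_ray_iff)
  have "\<not> is_a_edge j w y"
  proof
    assume a_edge: "is_a_edge j w y"
    then have "norm (y - w) = a" using tile_edge_length[OF next_edge(1)] x by simp
    then have "y = ray v u (Suc (Suc n) * a)"
      using ray_to[of w y] y by (simp add: w_def algebra_simps)
    then have "is_run v u s (Suc (Suc n))"
      using run next_edge(1) a_edge x unfolding is_run_def w_def by (auto simp: less_Suc_eq)
    then show False using max by blast
  qed
  then have "is_run_end w u s" unfolding is_run_end_def using last dir next_edge(1) x y through by blast
  then show ?thesis using run w_def by blast
qed

text \<open>Two runs on the same side of a line with the same end: the later start would lie in the first run,
  hence in the interior of an edge on the other side, but it is the start of such an edge.\<close>

lemma run_end_determines_start:
  assumes start: "(v, u, s) \<in> run_starts" "(v', u, s) \<in> run_starts"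
    and run: "is_run v u s m" "is_run v' u s m'" and same_end: "ray v u (m * a) = ray v' u (m' * a)"
    and no_relation: "\<And>m :: nat. \<not> mixed_length (m * a)"
  shows "v = v'"
proof -
  have not_less: "\<not> m' < m" if start: "(v, u, s) \<in> run_starts" "(v', u, s) \<in> run_starts"
    and run: "is_run v u s m" and same_end: "ray v u (m * a) = ray v' u (m' * a)" for v v' and m m' :: nat
  proof
    assume less: "m' < m"
    have "ray v u ((m - m') * a) = ray (ray v u (m * a)) u (- (m' * a))"
      using less by (simp add: of_nat_diff algebra_simps)
    also have "\<dots> = v'" unfolding same_end by simp
    finally have v': "ray v u ((m - m') * a) = v'" .
    have "0 < (m - m') * a" "(m - m') * a \<le> m * a" using less sides_pos(1) by simp_all
    then obtain j x y where through: "(Some j, x, y) \<in> side_edges (\<not> s)" "sgn (y - x) = u"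
      "v' \<in> open_segment x y"
      using opposite_side_of_run[OF start(1) run] no_relation unfolding v'[symmetric] by blast
    from start(2) obtain k z where "(Some k, v', z) \<in> side_edges (\<not> s)" "sgn (z - v') = u"
      by (rule run_startE)
    moreover from this have "covers_ray v' u v' z" by (rule side_edge_covers_ray)
    moreover have "covers_ray v' u x y" using covers_ray_open_segment through by blast
    ultimately have "x = v'" using covering_edge_unique through(1) by blast
    then show False using through(3) by (simp add: open_segment_def)
  qed
  have "m = m'"
    using not_less[OF start run(1) same_end] not_less[OF start(2,1) run(2) same_end[symmetric]] by simp
  then show ?thesis using same_end by (simp add: ray_def)
qed

section \<open>Where runs start and end\<close>

lemma through_edge_straight:
  assumes "(Some k, z, z') \<in> side_edges r" "w \<in> open_segment z z'"
  shows "k \<in> straight_tiles w"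
proof -
  have k: "k \<in> I" using tile_edgeD(1)[OF assms(1)] .
  have "(z, z') \<in> tile_edges k \<or> (z', z) \<in> tile_edges k"
    using assms(1) by (auto simp: side_edges_def split: if_splits)
  then have "w \<in> tile k - interior (tile k) - {tA k, tB k, tC k}"
    using open_segment_ccw_edge[OF tile_nondegenerate[OF k]] assms(2) open_segment_commute by metis
  then show ?thesis using k by (simp add: straight_tiles_def)
qed

lemma finite_straight_tiles: "finite (straight_tiles w)"
  by (simp add: straight_tiles_def finite_tiles)

lemma through_edge_num_straight:
  assumes "(Some k, z, z') \<in> side_edges r" "w \<in> open_segment z z'"
  shows "1 \<le> num_straight w"
proof -
  have "straight_tiles w \<noteq> {}" using through_edge_straight[OF assms] by blast
  then have "0 < card (straight_tiles w)" using finite_straight_tiles by (simp add: card_gt_0_iff)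
  then show ?thesis by (simp add: num_straight_def)
qed

lemma through_edge_direction:
  assumes "num_straight w = 1"
    and e: "(Some k, z, z') \<in> side_edges r" "w \<in> open_segment z z'"
    and e': "(Some k', y, y') \<in> side_edges r'" "w \<in> open_segment y y'"
  shows "sgn (y' - y) = (if r' = r then sgn (z' - z) else - sgn (z' - z))"
proof -
  have "k' = k"
    using assms(1) through_edge_straight[OF e] through_edge_straight[OF e'] unfolding num_straight_def
    by (metis card_1_singletonE singletonD)
  then have same: "p = z \<and> q = z'" if "(Some k', p, q) \<in> side_edges r" "w \<in> open_segment p q" for p q
    using that e cell_edges_disjoint[of "Some k" _ _ _ _ w]
    by (auto simp: side_edges_def open_segment_commute split: if_splits)
  show ?thesis
  proof (cases "r' = r")
    case True
    then show ?thesis using same e' by simp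
  next
    case False
    then have "(Some k', y', y) \<in> side_edges r" using e'(1) side_edges_reverse[of "Some k'" y y' r] by simp
    then show ?thesis
      using same[of y' y] e'(2) False sgn_diff_commute[of y' y] by (simp add: open_segment_commute)
  qed
qed

lemma run_end_counts:
  assumes "is_run_end w u s"
  shows "w \<notin> {X, Y, Z}" "num_straight w = 1" "w \<in> interior big" "num_alpha w + 2 * num_gamma w = 3"
proof -
  obtain i x k z z' where last: "(Some i, x, w) \<in> side_edges s" "is_a_edge i x w"
    and through: "(Some k, z, z') \<in> side_edges (\<not> s)" "w \<in> open_segment z z'"
    using assms unfolding is_run_end_def by blast
  have straight: "1 \<le> num_straight w" by (rule through_edge_num_straight[OF through])
  show noncorner: "w \<notin> {X, Y, Z}" using straight corner_straight_full by force
  have "w = tB i \<or> w = tC i" "i \<in> I" using last tile_edgeD(1) by (auto simp: is_a_edge_def doubleton_eq_iff)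
  then have "0 < num_beta w \<or> 0 < num_gamma w"
    unfolding num_beta_def num_gamma_def card_gt_0_iff using finite_tiles by auto
  then have pos: "0 < num_alpha w + 2 * num_gamma w" using noncorner_counts(1)[OF noncorner] by auto
  note counts = noncorner_counts(2)[OF noncorner]
  show "w \<in> interior big"
    using counts straight pos by (cases "w \<in> interior big"; cases "w \<in> big") auto
  then have six: "num_alpha w + 2 * num_gamma w + 3 * num_straight w + 6 * num_full w = 6" using counts by simp
  with straight pos show "num_straight w = 1" by presburger
  with six straight show "num_alpha w + 2 * num_gamma w = 3" by presburger
qed

definition a_edges_at :: "complex \<Rightarrow> ('i \<times> complex \<times> bool) set" where
  "a_edges_at w = {(i, x, s). (Some i, w, x) \<in> side_edges s \<and> is_a_edge i w x}"

lemma a_edges_at_eq_image: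
  defines "other w i \<equiv> if tB i = w then tC i else tB i"
  shows "a_edges_at w =
    (\<lambda>i. (i, other w i, (w, other w i) \<in> tile_edges i)) ` ({i\<in>I. tB i = w} \<union> {i\<in>I. tC i = w})"
proof -
  have ends: "is_a_edge i w x \<longleftrightarrow> w \<in> {tB i, tC i} \<and> x = other w i" if "i \<in> I" for i x
    using tile_vertices_distinct[OF that] by (auto simp: is_a_edge_def other_def doubleton_eq_iff)
  have side: "(Some i, w, x) \<in> side_edges s \<longleftrightarrow> s = ((w, x) \<in> tile_edges i)" if "i \<in> I" "is_a_edge i w x"
    for i x s
  proof -
    have "w \<noteq> x" "{w, x} \<subseteq> {tA i, tB i, tC i}"
      using that(2) tile_vertices_distinct[OF that(1)] by (auto simp: is_a_edge_def doubleton_eq_iff)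
    then have "(x, w) \<in> tile_edges i \<longleftrightarrow> (w, x) \<notin> tile_edges i"
      using ccw_edges_tournament tile_nondegenerate[OF that(1)] by blast
    then show ?thesis using that(1) by (auto simp: side_edges_def)
  qed
  have "(i, x, s) \<in> a_edges_at w \<longleftrightarrow>
      i \<in> I \<and> (tB i = w \<or> tC i = w) \<and> x = other w i \<and> s = ((w, other w i) \<in> tile_edges i)" for i x s
  proof -
    have "(i, x, s) \<in> a_edges_at w \<longleftrightarrow> i \<in> I \<and> is_a_edge i w x \<and> s = ((w, x) \<in> tile_edges i)"
      unfolding a_edges_at_def using side tile_edgeD(1) by blast
    then show ?thesis using ends by auto
  qed
  then show ?thesis by (intro set_eqI) (force simp: image_iff)
qed

lemma card_a_edges_at: "card (a_edges_at w) = num_beta w + num_gamma w" "finite (a_edges_at w)"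
proof -
  have "{i\<in>I. tB i = w} \<inter> {i\<in>I. tC i = w} = {}" using tile_vertices_distinct by fastforce
  then show "card (a_edges_at w) = num_beta w + num_gamma w"
    unfolding a_edges_at_eq_image num_beta_def num_gamma_def using finite_tiles
    by (subst card_image) (auto simp: inj_on_def intro!: card_Un_disjoint)
  show "finite (a_edges_at w)" unfolding a_edges_at_eq_image using finite_tiles by simp
qed

lemma opposite_edge_at_interior_point:
  assumes w: "w \<in> interior big" and e: "(Some i, w, x) \<in> side_edges s" "sgn (x - w) = u"
    and not_through: "\<And>k z z'. (Some k, z, z') \<in> side_edges (\<not> s) \<Longrightarrow> w \<in> open_segment z z' \<Longrightarrow> sgn (z' - z) \<noteq> u"
  obtains j y where "(Some j, w, y) \<in> side_edges (\<not> s)" "sgn (y - w) = u"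
proof -
  have "covers_ray w u w x" using e by (rule side_edge_covers_ray)
  then obtain j x' y' where j: "(Some j, x', y') \<in> side_edges (\<not> s)" "covers_ray w u x' y'"
    using opposite_tile_edge[OF e(1)] outer_edge_not_at_interior_point[OF w] by metis
  then have "x' = w" using not_through unfolding covers_ray_iff by blast
  then show thesis using that j unfolding covers_ray_iff by blast
qed

definition a_directions :: "complex \<Rightarrow> bool \<Rightarrow> complex set" where
  "a_directions w s = {sgn (x - w) | i x. (i, x, s) \<in> a_edges_at w}"

lemma card_a_edges_at_eq_directions:
  "card (a_edges_at w) = card (a_directions w True) + card (a_directions w False)"
proof -
  define f where "f = (\<lambda>(i :: 'i, x, s :: bool). (s, sgn (x - w)))"
  have "inj_on f (a_edges_at w)"
  proof (rule inj_onI)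
    fix e e' assume same: "e \<in> a_edges_at w" "e' \<in> a_edges_at w" "f e = f e'"
    obtain i x s i' x' s' where e: "e = (i, x, s)" "e' = (i', x', s')" by (metis prod_cases3)
    then have edges: "(Some i, w, x) \<in> side_edges s" "(Some i', w, x') \<in> side_edges s"
      and dir: "sgn (x' - w) = sgn (x - w)" and "s' = s"
      using same by (auto simp: f_def a_edges_at_def)
    have "covers_ray w (sgn (x - w)) w x" "covers_ray w (sgn (x - w)) w x'"
      using dir edges by (auto intro: side_edge_covers_ray)
    then show "e = e'" using covering_edge_unique[OF edges(1) _ edges(2)] \<open>s' = s\<close> e by blast
  qed
  then have "card (a_edges_at w) = card (f ` a_edges_at w)" by (simp add: card_image)
  also have "f ` a_edges_at w = Sigma UNIV (a_directions w)"
    by (force simp: f_def a_directions_def image_iff)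
  also have "card \<dots> = (\<Sum>s\<in>UNIV. card (a_directions w s))"
  proof (rule card_SigmaI)
    have "a_directions w s = (\<lambda>(i, x, s). sgn (x - w)) ` {e\<in>a_edges_at w. snd (snd e) = s}" for s
      by (force simp: a_directions_def image_iff)
    then show "\<forall>s\<in>UNIV. finite (a_directions w s)" using card_a_edges_at(2) by simp
  qed simp
  finally show ?thesis by (simp add: UNIV_bool)
qed

text \<open>Otherwise the edges of length \<open>a\<close> leaving a star come in pairs of edges on both sides of a line; but
  there are three of them.\<close>

lemma star_is_run_start:
  assumes "w \<in> stars"
  shows "\<exists>u s. (w, u, s) \<in> run_starts"
proof (rule ccontr)
  assume none: "\<not> (\<exists>u s. (w, u, s) \<in> run_starts)"
  have w: "w \<notin> {X, Y, Z}" "num_alpha w = 0" "num_gamma w = 3" using assms by (auto simp: stars_def)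
  have interior: "w \<in> interior big" "num_straight w = 0"
    using noncorner_counts(2)[OF w(1)] w by (auto split: if_splits)
  have "a_directions w s \<subseteq> a_directions w (\<not> s)" for s
  proof
    fix u assume "u \<in> a_directions w s"
    then obtain i x where e: "(Some i, w, x) \<in> side_edges s" "is_a_edge i w x" "sgn (x - w) = u"
      by (auto simp: a_directions_def a_edges_at_def)
    obtain j y where j: "(Some j, w, y) \<in> side_edges (\<not> s)" "sgn (y - w) = u"
      using opposite_edge_at_interior_point[OF interior(1) e(1,3)] through_edge_num_straight interior(2)
      by (metis not_one_le_zero)
    have "is_a_edge j w y" using none e j unfolding run_starts_def by blast
    then show "u \<in> a_directions w (\<not> s)" using j by (auto simp: a_directions_def a_edges_at_def)
  qed
  from this[of True] this[of False] have "a_directions w True = a_directions w False" by auto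
  then have "even (card (a_edges_at w))" by (simp add: card_a_edges_at_eq_directions)
  moreover have "card (a_edges_at w) = 3" using card_a_edges_at(1)[of w] w noncorner_counts(1)[OF w(1)] by simp
  ultimately show False by simp
qed

lemma run_end_other_a_edge:
  assumes stop: "is_run_end w u s"
    and last: "(Some i, x, w) \<in> side_edges s" "sgn (w - x) = u"
    and other: "(Some i', w, x') \<in> side_edges s'" "is_a_edge i' w x'" "(i', x', s') \<noteq> (i, x, \<not> s)"
  shows "sgn (x' - w) \<notin> {u, - u}"
proof -
  obtain j y k z z' where next_edge: "(Some j, w, y) \<in> side_edges s" "\<not> is_a_edge j w y" "sgn (y - w) = u"
    and through: "(Some k, z, z') \<in> side_edges (\<not> s)" "sgn (z' - z) = u" "w \<in> open_segment z z'"
    using stop unfolding is_run_end_def by blast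
  have "z \<noteq> w" "z' \<noteq> w" using through(3) by (auto simp: open_segment_def)
  have cov: "covers_ray w (sgn (x' - w)) w x'" using other(1) refl by (rule side_edge_covers_ray)
  have "sgn (x' - w) \<noteq> - u"
  proof
    assume u: "sgn (x' - w) = - u"
    have reversed: "(Some i, w, x) \<in> side_edges (\<not> s)" "sgn (x - w) = - u"
      using last side_edges_reverse[of "Some i" w x s] sgn_diff_commute[of x w] by simp_all
    then have "covers_ray w (- u) w x" by (rule side_edge_covers_ray)
    moreover have "covers_ray w (- u) z' z"
      using through(2,3) sgn_diff_commute[of z z'] by (auto simp: covers_ray_iff open_segment_commute)
    moreover have "(Some k, z', z) \<in> side_edges s"
      using through(1) side_edges_reverse[of "Some k" z z' s] by simp
    ultimately show False
      using covering_edge_unique[OF other(1) cov[unfolded u]] reversed(1) other(3) \<open>z' \<noteq> w\<close>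
      by (cases "s' = s") auto
  qed
  moreover have "sgn (x' - w) \<noteq> u"
  proof
    assume u: "sgn (x' - w) = u"
    have "covers_ray w u z z'" using covers_ray_open_segment[OF through(3)] through(2) by simp
    moreover have "covers_ray w u w y" using next_edge(1,3) by (rule side_edge_covers_ray)
    ultimately show False
      using covering_edge_unique[OF other(1) cov[unfolded u]] through(1) next_edge(1,2) other(2) \<open>z \<noteq> w\<close>
      by (cases "s' = s") auto
  qed
  ultimately show ?thesis by blast
qed

text \<open>Besides the last edge of the run there is one more edge of length \<open>a\<close> at \<open>w\<close>; it starts a new run.\<close>

lemma run_end_is_run_start:
  assumes stop: "is_run_end w u s" and "num_gamma w = 1"
  shows "\<exists>u s. (w, u, s) \<in> run_starts"
proof -
  note counts = run_end_counts[OF stop]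
  obtain i x k z z' where last: "(Some i, x, w) \<in> side_edges s" "is_a_edge i x w" "sgn (w - x) = u"
    and through: "(Some k, z, z') \<in> side_edges (\<not> s)" "sgn (z' - z) = u" "w \<in> open_segment z z'"
    using stop unfolding is_run_end_def by blast
  have card: "card (a_edges_at w) = 2"
    using card_a_edges_at(1)[of w] counts(4) assms(2) noncorner_counts(1)[OF counts(1)] by simp
  have reversed: "(i, x, \<not> s) \<in> a_edges_at w"
    using last(1,2) side_edges_reverse[of "Some i" w x s] is_a_edge_commute[of i x w]
    by (simp add: a_edges_at_def)
  then have "\<exists>e\<in>a_edges_at w. e \<noteq> (i, x, \<not> s)" using card by (metis card_2_iff insertCI)
  then obtain i' x' s' where other: "(i', x', s') \<in> a_edges_at w" "(i', x', s') \<noteq> (i, x, \<not> s)"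
    by (metis prod_cases3)
  then have edge: "(Some i', w, x') \<in> side_edges s'" "is_a_edge i' w x'" by (simp_all add: a_edges_at_def)
  have transversal: "sgn (x' - w) \<notin> {u, - u}"
    using run_end_other_a_edge[OF stop last(1,3) edge other(2)] .
  then have "sgn (q - p) \<noteq> sgn (x' - w)" if "(Some k', p, q) \<in> side_edges (\<not> s')" "w \<in> open_segment p q"
    for k' p q
    using through_edge_direction[OF counts(2) through(1,3) that] through(2) by (auto split: if_splits)
  with counts(3) edge(1) refl obtain j y where partner: "(Some j, w, y) \<in> side_edges (\<not> s')"
    "sgn (y - w) = sgn (x' - w)"
    by (rule opposite_edge_at_interior_point)
  have "\<not> is_a_edge j w y"
  proof
    assume "is_a_edge j w y"
    then have "{(i, x, \<not> s), (i', x', s'), (j, y, \<not> s')} \<subseteq> a_edges_at w"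
      using partner(1) reversed other(1) by (simp add: a_edges_at_def)
    then have "card {(i, x, \<not> s), (i', x', s'), (j, y, \<not> s')} \<le> 2"
      using card card_mono[OF card_a_edges_at(2)] by metis
    moreover have "sgn (x - w) = - u" using last(3) sgn_diff_commute[of x w] by simp
    then have "x \<noteq> y" using partner(2) transversal by auto
    ultimately show False using other(2) by (auto simp: card_insert_if split: if_splits)
  qed
  then show ?thesis using edge partner unfolding run_starts_def by blast
qed

lemma run_end_direction_unique:
  assumes "is_run_end w u s" "is_run_end w u' s'"
  shows "u' = u \<and> s' = s"
proof -
  obtain j y k z z' where next_edge: "(Some j, w, y) \<in> side_edges s" "\<not> is_a_edge j w y" "sgn (y - w) = u"
    and through: "(Some k, z, z') \<in> side_edges (\<not> s)" "sgn (z' - z) = u" "w \<in> open_segment z z'"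
    using assms(1) unfolding is_run_end_def by blast
  obtain i x k' p q where last: "(Some i, x, w) \<in> side_edges s'" "is_a_edge i x w" "sgn (w - x) = u'"
    and through': "(Some k', p, q) \<in> side_edges (\<not> s')" "sgn (q - p) = u'" "w \<in> open_segment p q"
    using assms(2) unfolding is_run_end_def by blast
  have dir: "u' = (if s' = s then u else - u)"
    using through_edge_direction[OF run_end_counts(2)[OF assms(1)] through(1,3) through'(1,3)] through(2)
      through'(2)
    by (cases s; cases s') auto
  have "s' = s"
  proof (rule ccontr)
    assume "s' \<noteq> s"
    then have reversed: "(Some i, w, x) \<in> side_edges s" "sgn (x - w) = u"
      using last(1,3) dir side_edges_reverse[of "Some i" w x s'] sgn_diff_commute[of x w]
      by (auto split: if_splits)
    then have "covers_ray w u w x" "covers_ray w u w y"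
      using next_edge(1,3) by (auto intro: side_edge_covers_ray)
    then have "i = j \<and> x = y" using covering_edge_unique[OF reversed(1) _ next_edge(1)] by blast
    then show False using last(2) next_edge(2) is_a_edge_commute by blast
  qed
  with dir show ?thesis by simp
qed

definition run_ends :: "complex set" where
  "run_ends = {w. \<exists>u s. is_run_end w u s}"

lemma finite_run_ends: "finite run_ends"
proof -
  have "run_ends \<subseteq> vertices" unfolding run_ends_def is_run_end_def using side_edgesD(4) by blast
  then show ?thesis using finite_vertices finite_subset by blast
qed

lemma card_run_starts_le:
  assumes no_relation: "\<And>m :: nat. \<not> mixed_length (m * a)"
  shows "finite run_starts" "card run_starts \<le> card run_ends"
proof -
  have "\<forall>e\<in>run_starts. \<exists>n. case e of (v, u, s) \<Rightarrow> is_run v u s n \<and> is_run_end (ray v u (n * a)) u s"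
    using run_end_exists[OF _ no_relation] by auto
  from bchoice[OF this] obtain n where
    n: "\<forall>e\<in>run_starts. case e of (v, u, s) \<Rightarrow> is_run v u s (n e) \<and> is_run_end (ray v u (n e * a)) u s" ..
  define stop where "stop e = (case e of (v, u, s) \<Rightarrow> ray v u (n e * a))" for e
  have stop: "is_run v u s (n (v, u, s))" "is_run_end (stop (v, u, s)) u s" if "(v, u, s) \<in> run_starts"
    for v u s
    using bspec[OF n that] by (simp_all add: stop_def)
  have "stop ` run_starts \<subseteq> run_ends"
    using stop(2) by (fastforce simp: run_ends_def)
  moreover have "inj_on stop run_starts"
  proof (rule inj_onI)
    fix e e' assume starts: "e \<in> run_starts" "e' \<in> run_starts" and eq: "stop e = stop e'"
    obtain v u s v' u' s' where e: "e = (v, u, s)" "e' = (v', u', s')" by (metis prod_cases3)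
    have "is_run_end (stop e) u s" using stop(2) starts(1) by (simp add: e)
    moreover have "is_run_end (stop e) u' s'" unfolding eq using stop(2) starts(2) by (simp add: e)
    ultimately have us: "u' = u" "s' = s" using run_end_direction_unique by blast+
    have "v = v'"
    proof (rule run_end_determines_start)
      show "(v, u, s) \<in> run_starts" "(v', u, s) \<in> run_starts" using starts us e by simp_all
      then show "is_run v u s (n (v, u, s))" "is_run v' u s (n (v', u, s))" by (simp_all add: stop(1))
      show "ray v u (n (v, u, s) * a) = ray v' u (n (v', u, s) * a)" using eq us e by (simp add: stop_def)
    qed (rule no_relation)
    then show "e = e'" using us e by simp
  qed
  ultimately show "finite run_starts" "card run_starts \<le> card run_ends"
    using finite_run_ends card_inj_on_le[of stop run_starts run_ends] inj_on_finite[of stop run_starts run_ends]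
    by blast+
qed

lemma run_ends_subset: "run_ends \<subseteq> {w\<in>run_ends. num_gamma w = 1} \<union> alpha_beta_points"
proof
  fix w assume w: "w \<in> run_ends"
  then have counts: "num_alpha w + 2 * num_gamma w = 3" "w \<notin> {X, Y, Z}"
    using run_end_counts unfolding run_ends_def by blast+
  then have "num_gamma w = 0 \<or> num_gamma w = 1" by presburger
  then show "w \<in> {w\<in>run_ends. num_gamma w = 1} \<union> alpha_beta_points"
    using w counts by (auto simp: alpha_beta_points_def)
qed

theorem mixed_multiple_exists: "\<exists>m :: nat. mixed_length (m * a)"
proof (rule ccontr)
  assume "\<not> ?thesis"
  then have no_relation: "\<And>m :: nat. \<not> mixed_length (m * a)" by blast
  note starts = card_run_starts_le[OF no_relation]
  define continued where "continued = {w\<in>run_ends. num_gamma w = 1}"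
  have finite_continued: "finite continued" using finite_run_ends by (simp add: continued_def)
  have "card run_ends \<le> card (continued \<union> alpha_beta_points)"
    using run_ends_subset finite_continued finite_special_points
    unfolding continued_def by (intro card_mono) auto
  also have "\<dots> \<le> card continued + card alpha_beta_points" by (rule card_Un_le)
  also have "\<dots> < card continued + card stars" using card_alpha_beta_points_less by simp
  also have "\<dots> = card (continued \<union> stars)"
    using finite_continued finite_special_points
    by (intro card_Un_disjoint[symmetric]) (auto simp: continued_def stars_def)
  also have "\<dots> \<le> card (fst ` run_starts)"
  proof (rule card_mono)
    show "continued \<union> stars \<subseteq> fst ` run_starts"
      using star_is_run_start run_end_is_run_start by (force simp: continued_def run_ends_def)
  qed (use starts in simp)
  also have "\<dots> \<le> card run_starts" using starts(1) by (rule card_image_le)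
  finally show False using starts(2) by simp
qed

end

section \<open>Signed perimeters\<close>

interpretation rat_real: vector_space "\<lambda>(q::rat) (x::real). of_rat q * x"
  by unfold_locales (simp_all add: algebra_simps of_rat_add of_rat_mult)

interpretation rat_real_pair: vector_space_pair "\<lambda>(q::rat) (x::real). of_rat q * x"
  "\<lambda>(q::rat) (x::real). of_rat q * x"
  by unfold_locales

lemma additive_extension:
  fixes x y :: real
  assumes "x \<noteq> 0" "\<And>q. q \<in> \<rat> \<Longrightarrow> y \<noteq> q * x"
  obtains f :: "real \<Rightarrow> real" where "Modules.additive f" "f x = u" "f y = v"
proof -
  have "y \<notin> rat_real.span {x}"
  proof
    assume "y \<in> rat_real.span {x}"
    then obtain k where "y = of_rat k * x" by (auto simp: rat_real.span_singleton)
    then show False using assms(2)[of "of_rat k"] by simp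
  qed
  moreover have "rat_real.independent {x}" using assms(1) by simp
  ultimately have "rat_real.independent {y, x}" by (rule rat_real.independent_insertI)
  from rat_real_pair.linear_independent_extend[OF this, of "\<lambda>z. if z = x then u else v"]
  obtain f where f:
    "Vector_Spaces.linear (\<lambda>(q::rat) (x::real). of_rat q * x) (\<lambda>(q::rat) (x::real). of_rat q * x) f"
    "\<forall>z\<in>{y, x}. f z = (if z = x then u else v)"
    by blast
  have "Modules.additive f" using f(1) by unfold_locales (simp add: rat_real_pair.linear_add)
  moreover have "y \<noteq> x" using assms(2)[of 1] by auto
  ultimately show thesis using that f(2) by simp
qed

lemma cis_pi_nat: "cis (pi * real n) = (- 1) ^ n"
  by (induction n) (simp_all add: distrib_left cis_mult[symmetric])

text \<open>A character of directions; it is well defined because \<open>g\<close> maps a full turn to the even number 6.\<close>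

locale direction_character = Modules.additive g for g :: "real \<Rightarrow> real" +
  assumes g_pi: "g pi = 3"
begin

definition chi :: "complex \<Rightarrow> complex" where
  "chi z = cis (pi * g (Arg z))"

lemma g_int: "g (of_int n * t) = of_int n * g t"
proof -
  have nat: "g (real n * t) = real n * g t" for n
    by (induction n) (simp_all add: zero add algebra_simps)
  show ?thesis
  proof (cases "n \<ge> 0")
    case True
    then show ?thesis using nat[of "nat n"] by simp
  next
    case False
    then show ?thesis using nat[of "nat (- n)"] minus[of "of_int n * t"] by simp
  qed
qed

lemma cis_g_cong:
  assumes "cis x = cis y"
  shows "cis (pi * g x) = cis (pi * g y)"
proof -
  have "cis (x - y) = 1" using assms by (simp add: cis_divide[symmetric])
  then have "cos (x - y) = 1" by (metis cis.sel(1) one_complex.sel(1))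
  then obtain n :: int where n: "x - y = of_int n * 2 * pi" using cos_one_2pi_int by auto
  then have "x = y + of_int (2 * n) * pi" by (simp add: algebra_simps)
  then have "g x = g y + of_int (6 * n)" by (simp only: add g_int g_pi)
  then have "cis (pi * g x) = cis (pi * g y) * cis (2 * pi * of_int (3 * n))"
    by (simp add: cis_mult algebra_simps)
  also have "cis (2 * pi * of_int (3 * n)) = 1" by (rule cis_multiple_2pi) simp
  finally show ?thesis by simp
qed

lemma chi_mult:
  assumes "z \<noteq> 0" "w \<noteq> 0"
  shows "chi (z * w) = chi z * chi w"
proof -
  have "cis (Arg (z * w)) = cis (Arg z + Arg w)"
    using assms by (simp add: cis_Arg sgn_mult cis_mult[symmetric])
  from cis_g_cong[OF this] show ?thesis by (simp only: chi_def add distrib_left cis_mult)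
qed

lemma chi_nonzero: "chi z \<noteq> 0"
  by (simp add: chi_def)

lemma chi_of_real_pos: "0 < t \<Longrightarrow> chi (of_real t) = 1"
  by (simp add: chi_def zero)

lemma chi_minus: "z \<noteq> 0 \<Longrightarrow> chi (- z) = - chi z"
proof -
  have "Arg (-1) = pi" using Arg_of_real[of "-1"] by simp
  then have "chi (-1) = - 1" using cis_pi_nat[of 3] by (simp add: chi_def g_pi)
  then show "z \<noteq> 0 \<Longrightarrow> chi (- z) = - chi z" using chi_mult[of "-1" z] by simp
qed

lemma chi_vertex_angle:
  assumes "orient q p r \<noteq> 0" "g (vertex_angle p q r) = real m"
  shows "chi (r - q) = (- 1) ^ m * chi (p - q)"
proof -
  have ccw: "chi (r - q) = (- 1) ^ m * chi (p - q)" if d: "orient q p r > 0"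
    and m: "g (vertex_angle p q r) = real m" for p r
  proof -
    have "p \<noteq> q" "r \<noteq> q" using d by auto
    moreover have "Arg ((r - q) / (p - q)) = vertex_angle p q r"
      using view_angle_ccw[OF d] d by (simp add: view_angle_def)
    then have "chi ((r - q) / (p - q)) = (- 1) ^ m" using m by (simp add: chi_def cis_pi_nat)
    ultimately show ?thesis using chi_mult[of "(r - q) / (p - q)" "p - q"] by simp
  qed
  show ?thesis
  proof (cases "orient q p r > 0")
    case False
    then have "chi (p - q) = (- 1) ^ m * chi (r - q)"
      using assms orient_swap(2)[of q r p] vertex_angle_commute[of r q p] by (intro ccw) auto
    then show ?thesis by (simp flip: mult.assoc power_mult_distrib)
  qed (use ccw assms in blast)
qed

end

locale twisted_length = direction_character g + \<phi>: Modules.additive \<phi> for g \<phi> :: "real \<Rightarrow> real"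
begin

definition twisted :: "complex \<Rightarrow> complex \<Rightarrow> complex" where
  "twisted p q = of_real (\<phi> (norm (q - p))) * chi (q - p)"

lemma twisted_ray:
  assumes "u \<noteq> 0"
  shows "twisted (ray v u r) (ray v u s) = of_real (\<phi> ((s - r) * norm u)) * chi u"
proof -
  have scale: "of_real (\<phi> (norm (of_real t * u))) * chi (of_real t * u) = of_real (\<phi> (t * norm u)) * chi u"
    for t
  proof -
    consider "t > 0" | "t = 0" | "t < 0" by linarith
    then show ?thesis
    proof cases
      case 1
      then show ?thesis using assms by (simp add: norm_mult chi_mult chi_of_real_pos)
    next
      case 2
      then show ?thesis by (simp add: \<phi>.zero)
    next
      case 3
      have "chi (of_real t * u) = chi (of_real (- t) * (- u))" by simp
      also have "\<dots> = - chi u"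
        using 3 assms by (subst chi_mult) (simp_all add: chi_of_real_pos chi_minus del: of_real_minus)
      finally show ?thesis using 3 \<phi>.minus[of "t * norm u"] by (simp add: norm_mult)
    qed
  qed
  show ?thesis using scale[of "s - r"] by (simp only: twisted_def ray_diff)
qed

lemma line_additive_twisted: "line_additive twisted"
  unfolding line_additive_def
proof (intro allI)
  fix v u r s t
  show "twisted (ray v u r) (ray v u s) + twisted (ray v u s) (ray v u t) = twisted (ray v u r) (ray v u t)"
  proof (cases "u = 0")
    case False
    have "\<phi> ((t - r) * norm u) = \<phi> ((s - r) * norm u) + \<phi> ((t - s) * norm u)"
      by (simp add: \<phi>.add[symmetric] algebra_simps)
    then show ?thesis using False by (simp add: twisted_ray algebra_simps)
  qed (simp add: ray_def twisted_def \<phi>.zero)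
qed

lemma twisted_triangle:
  assumes nd: "orient A B C \<noteq> 0"
    and B: "g (vertex_angle A B C) = real m" and C: "g (vertex_angle A C B) = real n"
  shows "twisted A B + twisted B C + twisted C A = chi (B - A) *
    of_real (\<phi> (norm (B - A)) - (- 1) ^ m * \<phi> (norm (C - B)) + (- 1) ^ (m + n) * \<phi> (norm (C - A)))"
proof -
  have ne: "A \<noteq> B" "B \<noteq> C" "C \<noteq> A" using nd by auto
  have nd': "orient B A C \<noteq> 0" "orient C B A \<noteq> 0" using nd orient_swap[of A B C] orient_rotate[of C B A] by auto
  have "chi (C - B) = (- 1) ^ m * chi (A - B)" by (rule chi_vertex_angle[OF nd'(1) B])
  then have CB: "chi (C - B) = - ((- 1) ^ m * chi (B - A))" using chi_minus[of "B - A"] ne by simp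
  have "chi (A - C) = (- 1) ^ n * chi (B - C)"
    by (rule chi_vertex_angle[OF nd'(2)]) (use C vertex_angle_commute[of B C A] in simp)
  then have CA: "chi (A - C) = (- 1) ^ (m + n) * chi (B - A)"
    using chi_minus[of "C - B"] ne CB by (simp add: power_add)
  show ?thesis unfolding twisted_def CB CA norm_minus_commute[of A C] by (simp add: algebra_simps)
qed

end

context dissimilar_tiling
begin

definition signed_perimeter :: real where
  "signed_perimeter = (- 1) ^ num_beta X * norm (Z - Y) + (- 1) ^ num_beta Y * norm (Z - X)
      + (- 1) ^ num_beta Z * norm (Y - X)"

lemma angle_parity_character:
  obtains g :: "real \<Rightarrow> real"
  where "direction_character g" "g (2 * pi / 3) = 2" "\<And>p q. g (real p * \<alpha> + real q * \<beta>) = real q"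
proof -
  have "\<alpha> \<noteq> q * (pi / 3)" if "q \<in> \<rat>" for q using alpha_irrational[of "q / 3"] that by auto
  then obtain g :: "real \<Rightarrow> real" where g: "Modules.additive g" "g (pi / 3) = 1" "g \<alpha> = 0"
    using additive_extension[of "pi / 3" \<alpha> 1 0] by auto
  interpret additive g by (rule g(1))
  have gamma: "g (2 * pi / 3) = 2" using add[of "pi / 3" "pi / 3"] g(2) by simp
  then have "g pi = 3" using add[of "2 * pi / 3" "pi / 3"] g(2) by simp
  then interpret direction_character g by unfold_locales
  have "g \<beta> = 1" using add[of \<alpha> \<beta>] angles_sum g(2,3) by simp
  then have "g (real p * \<alpha> + real q * \<beta>) = real q" for p q
    using g_int[of "int p" \<alpha>] g_int[of "int q" \<beta>] g(3) by (simp add: add)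
  with gamma show thesis using that direction_character_axioms by blast
qed

text \<open>With \<open>\<chi>(e^(i \<alpha>)) = 1\<close> and \<open>\<chi>(e^(i \<beta>)) = -1\<close> the twisted lengths of the edges of a tile add up to
  \<open>\<plusminus>\<phi>(a - b + c)\<close>, and those of the big triangle to \<open>\<plusminus>\<phi>\<close> of its signed perimeter.\<close>

lemma additive_signed_perimeter:
  fixes \<phi> :: "real \<Rightarrow> real"
  assumes phi: "Modules.additive \<phi>" "\<phi> (a - b + c) = 0"
  shows "\<phi> signed_perimeter = 0"
proof -
  obtain g :: "real \<Rightarrow> real" where "direction_character g" and g_gamma: "g (2 * pi / 3) = 2"
    and g_corner: "\<And>p q. g (real p * \<alpha> + real q * \<beta>) = real q"
    by (rule angle_parity_character) blast
  then interpret twisted_length g \<phi> using phi(1) by (simp add: twisted_length_def)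
  have phi_sides: "\<phi> a - \<phi> b + \<phi> c = 0"
    using phi(2) \<phi>.add[of "a - b" c] \<phi>.diff[of a b] by simp
  have "(\<Sum>(x, y)\<in>tile_edges i. twisted x y) = 0" if i: "i \<in> I" for i
  proof -
    have "g (vertex_angle (tA i) (tB i) (tC i)) = real 1" "g (vertex_angle (tA i) (tC i) (tB i)) = real 2"
      unfolding tile_angles[OF i] using g_corner[of 0 1] g_gamma by simp_all
    note triangle = twisted_triangle[OF tile_nondegenerate[OF i] this]
    have "twisted (tA i) (tB i) + twisted (tB i) (tC i) + twisted (tC i) (tA i) = 0"
      unfolding triangle side_lengths[OF i] using phi_sides by (simp add: algebra_simps)
    then show ?thesis by (simp add: sum_ccw_edges[OF line_additive_twisted tile_nondegenerate[OF i]])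
  qed
  then have "(\<Sum>(x, y)\<in>ccw_edges X Y Z. twisted x y) = 0"
    using sum_tile_edges[OF line_additive_twisted] by simp
  then have "twisted X Y + twisted Y Z + twisted Z X = 0"
    using nondegenerate by (simp add: sum_ccw_edges[OF line_additive_twisted nondegenerate] sgn_zero_iff)
  moreover have "g (vertex_angle X Y Z) = real (num_beta Y)" "g (vertex_angle X Z Y) = real (num_beta Z)"
    unfolding corner_angles g_corner by simp_all
  note twisted_triangle[OF nondegenerate this]
  ultimately have perimeter: "\<phi> (norm (Y - X)) - (- 1) ^ num_beta Y * \<phi> (norm (Z - Y))
      + (- 1) ^ (num_beta Y + num_beta Z) * \<phi> (norm (Z - X)) = 0"
    using chi_nonzero by (metis mult_eq_0_iff of_real_eq_0_iff)
  have sign: "\<phi> ((- 1) ^ n * t) = (- 1) ^ n * \<phi> t" for n and t :: real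
    by (cases "even n") (simp_all add: \<phi>.minus)
  have "odd (num_beta X + num_beta Y + num_beta Z)" using corner_counts(2) by simp
  then have "\<phi> signed_perimeter = (- 1) ^ num_beta Z * (\<phi> (norm (Y - X)) - (- 1) ^ num_beta Y * \<phi> (norm (Z - Y))
      + (- 1) ^ (num_beta Y + num_beta Z) * \<phi> (norm (Z - X)))"
    unfolding signed_perimeter_def \<phi>.add sign
    by (cases "even (num_beta X)"; cases "even (num_beta Y)"; cases "even (num_beta Z)")
      (simp_all add: minus_one_power_iff)
  then show ?thesis using perimeter by simp
qed

theorem signed_perimeter_rational_multiple:
  assumes "a - b + c \<noteq> 0"
  obtains m where "m \<in> \<rat>" "signed_perimeter = m * (a - b + c)"
proof (rule ccontr)
  assume "\<not> thesis"
  with that have "signed_perimeter \<noteq> q * (a - b + c)" if "q \<in> \<rat>" for q using that by blast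
  with assms obtain \<phi> :: "real \<Rightarrow> real" where "Modules.additive \<phi>" "\<phi> (a - b + c) = 0" "\<phi> signed_perimeter = 1"
    by (rule additive_extension[where u = 0 and v = 1])
  then show False by (simp add: additive_signed_perimeter)
qed

end

section \<open>The arithmetic of the corner angles\<close>

lemma sin_sum_eq_product:
  fixes x y z :: real
  assumes "x + y + z = 4 * pi"
  shows "sin x + sin y + sin z = - 4 * (sin (x / 2) * sin (y / 2) * sin (z / 2))"
proof -
  define s t where "s = x / 2" and "t = y / 2"
  have xyz: "x = 2 * s" "y = 2 * t" "z = 4 * pi - (2 * s + 2 * t)" "z / 2 = 2 * pi - (s + t)"
    using assms by (simp_all add: s_def t_def field_simps)
  have "sin z = - sin (2 * s + 2 * t)" unfolding xyz(3)
    using sin_periodic[of "2 * pi - (2 * s + 2 * t)"] sin_2pi_minus[of "2 * s + 2 * t"]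
    by (simp add: algebra_simps)
  moreover have "sin (z / 2) = - sin (s + t)" unfolding xyz(4) by (rule sin_2pi_minus)
  moreover have "sin (2 * s) + sin (2 * t) - sin (2 * s + 2 * t) = 4 * (sin s * sin t * sin (s + t))"
  proof -
    have "(sin s)\<^sup>2 + (cos s)\<^sup>2 = 1" "(sin t)\<^sup>2 + (cos t)\<^sup>2 = 1" by simp_all
    then show ?thesis unfolding sin_add sin_double cos_double by algebra
  qed
  ultimately show ?thesis by (simp add: xyz(1,2))
qed

definition half_factor :: "nat \<Rightarrow> real \<Rightarrow> real" where
  "half_factor e x = (if even e then sin (x / 2) else cos (x / 2))"

lemma half_factor_pos: "0 < x \<Longrightarrow> x < pi \<Longrightarrow> 0 < half_factor e x"
  by (auto simp: half_factor_def intro!: sin_gt_zero cos_gt_zero)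

lemma abs_sin_half_add: "\<bar>sin ((x + real e * pi) / 2)\<bar> = \<bar>half_factor e x\<bar>"
proof (cases "even e")
  case True
  then obtain k where "e = 2 * k" by (rule evenE)
  then have "(x + real e * pi) / 2 = x / 2 + real k * pi" by (simp add: add_divide_distrib)
  then show ?thesis using True by (simp only: sin_add) (simp add: abs_mult power_abs half_factor_def)
next
  case False
  then obtain k where "e = 2 * k + 1" by (rule oddE)
  then have "(x + real e * pi) / 2 = (x / 2 + real k * pi) + pi / 2" by (simp add: field_simps)
  then show ?thesis using False by (simp only: sin_add) (simp add: cos_add abs_mult power_abs half_factor_def)
qed

definition signed_sines :: "nat \<Rightarrow> nat \<Rightarrow> nat \<Rightarrow> real \<Rightarrow> real \<Rightarrow> real \<Rightarrow> real" where
  "signed_sines i j k x y z = (- 1) ^ i * sin x + (- 1) ^ j * sin y + (- 1) ^ k * sin z"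

lemma abs_signed_sines:
  assumes pos: "0 < x" "0 < y" "0 < z" and sum: "x + y + z = pi" and "i + j + k = 3"
  shows "\<bar>signed_sines i j k x y z\<bar> = 4 * (half_factor i x * half_factor j y * half_factor k z)"
proof -
  have shift: "sin (t + real e * pi) = (- 1) ^ e * sin t" for t e by (simp add: sin_add mult.commute)
  have "real i + real j + real k = 3" using assms(5) by linarith
  then have "real i * pi + real j * pi + real k * pi = 3 * pi" unfolding distrib_right[symmetric] by simp
  then have "(x + real i * pi) + (y + real j * pi) + (z + real k * pi) = 4 * pi" using sum by simp
  from sin_sum_eq_product[OF this]
  have "\<bar>signed_sines i j k x y z\<bar> = 4 * (\<bar>half_factor i x\<bar> * \<bar>half_factor j y\<bar> * \<bar>half_factor k z\<bar>)"
    unfolding signed_sines_def shift by (simp add: abs_mult abs_sin_half_add)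
  then show ?thesis using half_factor_pos pos sum by (simp add: abs_of_pos)
qed

lemma sin_cos_half_pos:
  assumes "0 < x" "x < pi"
  shows "sin (x / 2) > 0" "cos (x / 2) > 0"
  using half_factor_pos[OF assms, of 0] half_factor_pos[OF assms, of 1] by (simp_all add: half_factor_def)

lemma half_angles_equal:
  assumes "sin (x / 2) * cos (y / 2) = cos (x / 2) * sin (y / 2)" "0 < x" "x < pi" "0 < y" "y < pi"
  shows "x = y"
proof -
  have "- pi < x / 2 - y / 2" "x / 2 - y / 2 < pi" using assms(2-5) by linarith+
  moreover have "sin (x / 2 - y / 2) = 0" using assms(1) by (simp add: sin_diff)
  ultimately have "x / 2 - y / 2 = 0" by (rule sin_eq_0_pi)
  then show ?thesis by simp
qed

lemma half_angles_not_complementary: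
  assumes "0 < x" "0 < y" "x + y < pi"
  shows "sin (x / 2) * sin (y / 2) \<noteq> cos (x / 2) * cos (y / 2)"
proof -
  have "0 < cos ((x + y) / 2)" using assms by (intro cos_gt_zero) auto
  then show ?thesis by (simp add: add_divide_distrib cos_add)
qed

text \<open>For rational \<open>\<sigma>\<^sup>2\<close> the assumptions on \<open>E + E'\<close> and \<open>E - E'\<close> say that \<open>E\<close> and \<open>E'\<close> are conjugate
  in \<open>\<rat>(\<sigma>)\<close>.\<close>

lemma conjugates_rational_ratio:
  fixes \<sigma> :: real
  assumes irrational: "\<sigma> \<notin> \<rat>" and "E + E' \<in> \<rat>" "\<sigma> * (E - E') \<in> \<rat>"
    and "n * E = m * E'" "m \<in> \<rat>" "n \<in> \<rat>" "m \<noteq> 0" "n \<noteq> 0"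
  shows "\<bar>E\<bar> = \<bar>E'\<bar>"
proof -
  have "\<sigma> \<noteq> 0" using irrational by auto
  have zero: "x = 0 \<and> y = 0" if "x * \<sigma> + y = 0" "x \<in> \<rat>" "y \<in> \<rat>" for x y
  proof (cases "x = 0")
    case False
    then have "\<sigma> = - y / x" using that(1) by (simp add: field_simps)
    then show ?thesis using that(2,3) irrational by simp
  qed (use that in simp)
  have "((n - m) * (E + E')) * \<sigma> + (n + m) * (\<sigma> * (E - E')) = 2 * \<sigma> * (n * E - m * E')"
    by (simp add: algebra_simps)
  then have "((n - m) * (E + E')) * \<sigma> + (n + m) * (\<sigma> * (E - E')) = 0" using assms(4) by simp
  then have "(n - m) * (E + E') = 0 \<and> (n + m) * (\<sigma> * (E - E')) = 0"
    using assms by (intro zero) auto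
  then have "(n = m \<or> E = - E') \<and> (n = - m \<or> E = E')"
    using \<open>\<sigma> \<noteq> 0\<close> by (auto simp: add_eq_0_iff)
  then have "E = E' \<or> E = - E'" using assms(7,8) by auto
  then show ?thesis by auto
qed

locale tile_angles =
  fixes \<alpha> \<beta> :: real
  assumes pos: "\<alpha> > 0" "\<beta> > 0" and sum: "\<alpha> + \<beta> = pi / 3" and distinct: "\<alpha> \<noteq> \<beta>"
begin

definition corner :: "nat \<Rightarrow> nat \<Rightarrow> real" where
  "corner p q = real p * \<alpha> + real q * \<beta>"

text \<open>The corner angles \<open>p\<^sub>i \<alpha> + q\<^sub>i \<beta>\<close> are compared with those of the tile, \<open>\<alpha>\<close>, \<open>\<beta>\<close> and \<open>2 \<alpha> + 2 \<beta>\<close>.\<close>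

definition balanced :: "nat \<Rightarrow> nat \<Rightarrow> nat \<Rightarrow> nat \<Rightarrow> nat \<Rightarrow> nat \<Rightarrow> bool" where
  "balanced p1 q1 p2 q2 p3 q3 \<longleftrightarrow>
     half_factor q1 (corner p1 q1) * half_factor q2 (corner p2 q2) * half_factor q3 (corner p3 q3) *
       (cos (\<alpha> / 2) * sin (\<beta> / 2)) =
     half_factor p1 (corner p1 q1) * half_factor p2 (corner p2 q2) * half_factor p3 (corner p3 q3) *
       (sin (\<alpha> / 2) * cos (\<beta> / 2))"

lemma balanced_commute:
  "balanced p1 q1 p2 q2 p3 q3 \<longleftrightarrow> balanced p2 q2 p1 q1 p3 q3"
  "balanced p1 q1 p2 q2 p3 q3 \<longleftrightarrow> balanced p1 q1 p3 q3 p2 q2"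
  unfolding balanced_def by (simp_all add: ac_simps)

lemma not_balanced_same_parity:
  assumes "even p1 \<longleftrightarrow> even q1" "even p2 \<longleftrightarrow> even q2" "even p3 \<longleftrightarrow> even q3"
    and range: "0 < corner p1 q1" "corner p1 q1 < pi" "0 < corner p2 q2" "corner p2 q2 < pi"
      "0 < corner p3 q3" "corner p3 q3 < pi"
  shows "\<not> balanced p1 q1 p2 q2 p3 q3"
proof
  assume "balanced p1 q1 p2 q2 p3 q3"
  moreover have "half_factor q1 (corner p1 q1) = half_factor p1 (corner p1 q1)"
    "half_factor q2 (corner p2 q2) = half_factor p2 (corner p2 q2)"
    "half_factor q3 (corner p3 q3) = half_factor p3 (corner p3 q3)"
    using assms(1-3) by (simp_all add: half_factor_def)
  moreover have
    "half_factor p1 (corner p1 q1) * half_factor p2 (corner p2 q2) * half_factor p3 (corner p3 q3) \<noteq> 0"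
    using half_factor_pos range by (simp add: less_imp_neq[symmetric])
  ultimately have "sin (\<alpha> / 2) * cos (\<beta> / 2) = cos (\<alpha> / 2) * sin (\<beta> / 2)" by (simp add: balanced_def)
  then have "\<alpha> = \<beta>" by (rule half_angles_equal) (use pos sum in auto)
  then show False using distinct by blast
qed

lemma not_balanced_special:
  "\<not> balanced 3 1 0 1 0 1" "\<not> balanced 3 0 0 1 0 2" "\<not> balanced 2 1 1 0 0 2" "\<not> balanced 2 1 1 1 0 1"
proof -
  have half: "sin (x / 2) \<noteq> 0" "cos (x / 2) \<noteq> 0" if "0 < x" "x < pi" for x
    using sin_cos_half_pos[OF that] by simp_all
  have nz: "sin (\<alpha> / 2) \<noteq> 0" "cos (\<alpha> / 2) \<noteq> 0" "sin (\<beta> / 2) \<noteq> 0" "cos (\<beta> / 2) \<noteq> 0"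
    "cos ((\<alpha> + \<beta>) / 2) \<noteq> 0" "sin (2 * \<beta> / 2) \<noteq> 0" "cos ((3 * \<alpha> + \<beta>) / 2) \<noteq> 0"
    by (rule half; use pos sum in linarith)+
  have "sin (\<alpha> / 2) * sin (\<beta> / 2) \<noteq> cos (\<alpha> / 2) * cos (\<beta> / 2)"
    by (rule half_angles_not_complementary; use pos sum in linarith)
  then show "\<not> balanced 3 1 0 1 0 1"
    using nz by (auto simp: balanced_def half_factor_def corner_def mult.commute)
  have "sin (3 * \<alpha> / 2) * cos (\<alpha> / 2) \<noteq> cos (3 * \<alpha> / 2) * sin (\<alpha> / 2)"
    using half_angles_equal[of "3 * \<alpha>" \<alpha>] pos sum by linarith
  then show "\<not> balanced 3 0 0 1 0 2"
    using nz by (auto simp: balanced_def half_factor_def corner_def mult.commute)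
  have "sin ((2 * \<alpha> + \<beta>) / 2) * cos (\<beta> / 2) \<noteq> cos ((2 * \<alpha> + \<beta>) / 2) * sin (\<beta> / 2)"
    using half_angles_equal[of "2 * \<alpha> + \<beta>" \<beta>] pos sum by linarith
  then show "\<not> balanced 2 1 1 0 0 2"
    using nz by (auto simp: balanced_def half_factor_def corner_def mult.commute)
  have "sin ((2 * \<alpha> + \<beta>) / 2) * sin (\<alpha> / 2) \<noteq> cos ((2 * \<alpha> + \<beta>) / 2) * cos (\<alpha> / 2)"
    by (rule half_angles_not_complementary; use pos sum in linarith)
  then show "\<not> balanced 2 1 1 1 0 1"
    using nz by (auto simp: balanced_def half_factor_def corner_def mult.commute)
qed

lemma tile_angles_swap: "tile_angles \<beta> \<alpha>"
  using pos sum distinct by unfold_locales auto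

lemma corner_pos: "p + q > 0 \<Longrightarrow> 0 < corner p q"
  using pos by (cases "p > 0") (auto simp: corner_def intro: add_pos_nonneg)

lemma corner_sum:
  assumes "p1 + p2 + p3 = 3" "q1 + q2 + q3 = 3"
  shows "corner p1 q1 + corner p2 q2 + corner p3 q3 = pi"
proof -
  have "corner p1 q1 + corner p2 q2 + corner p3 q3 = real (p1 + p2 + p3) * \<alpha> + real (q1 + q2 + q3) * \<beta>"
    by (simp add: corner_def algebra_simps)
  then show ?thesis using sum by (simp add: assms)
qed

lemma not_balanced:
  assumes sums: "p1 + p2 + p3 = 3" "q1 + q2 + q3 = 3" and nonzero: "p1 + q1 > 0" "p2 + q2 > 0" "p3 + q3 > 0"
    and not_tile: "(2, 2) \<notin> {(p1, q1), (p2, q2), (p3, q3)}"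
  shows "\<not> balanced p1 q1 p2 q2 p3 q3"
proof (cases "(even p1 \<longleftrightarrow> even q1) \<and> (even p2 \<longleftrightarrow> even q2) \<and> (even p3 \<longleftrightarrow> even q3)")
  case True
  have "0 < corner p1 q1" "0 < corner p2 q2" "0 < corner p3 q3"
    using nonzero by (simp_all only: corner_pos)
  moreover from this have "corner p1 q1 < pi" "corner p2 q2 < pi" "corner p3 q3 < pi"
    using corner_sum[OF sums] by linarith+
  ultimately show ?thesis using True by (simp only: not_balanced_same_parity simp_thms)
next
  case False
  interpret swap: tile_angles \<beta> \<alpha> by (rule tile_angles_swap)
  have "swap.corner q p = corner p q" for p q by (simp add: corner_def swap.corner_def)
  then have swap: "swap.balanced q1 p1 q2 p2 q3 p3 \<longleftrightarrow> balanced p1 q1 p2 q2 p3 q3" for p1 q1 p2 q2 p3 q3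
    by (auto simp: balanced_def swap.balanced_def ac_simps)
  have perms: "\<not> balanced p2 q2 p1 q1 p3 q3 \<and> \<not> balanced p1 q1 p3 q3 p2 q2 \<and> \<not> balanced p2 q2 p3 q3 p1 q1 \<and>
      \<not> balanced p3 q3 p1 q1 p2 q2 \<and> \<not> balanced p3 q3 p2 q2 p1 q1"
    if "\<not> balanced p1 q1 p2 q2 p3 q3" for p1 q1 p2 q2 p3 q3
    using that balanced_commute by metis
  note special = not_balanced_special swap.not_balanced_special[unfolded swap]
  have compositions: "(x, y, z) \<in> {(0, 0, 3), (0, 1, 2), (0, 2, 1), (0, 3, 0), (1, 0, 2), (1, 1, 1), (1, 2, 0),
      (2, 0, 1), (2, 1, 0), (3, 0, 0)}" if "x + y + z = 3" for x y z :: nat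
  proof -
    have "x = 0 \<or> x = 1 \<or> x = 2 \<or> x = 3" "y = 0 \<or> y = 1 \<or> y = 2 \<or> y = 3" "z = 3 - x - y" using that by linarith+
    then show ?thesis using that by (elim disjE) simp_all
  qed
  show ?thesis using compositions[OF sums(1)] compositions[OF sums(2)] nonzero not_tile False
    by (simp only: insert_iff prod.inject empty_iff simp_thms, elim disjE conjE)
      (simp_all del: One_nat_def add: special special[THEN perms])
qed

end

locale rational_tile = tile_angles +
  fixes \<rho> \<sigma> :: real
  assumes rho: "sin \<beta> = \<rho> * sin \<alpha>" and sigma: "sin (pi / 3) = \<sigma> * sin \<alpha>"
    and rho_rational: "\<rho> \<in> \<rat>" and sigma_irrational: "\<sigma> \<notin> \<rat>"
begin

lemma sigma_nonzero: "\<sigma> \<noteq> 0"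
  using sigma_irrational by auto

lemma sigma_trig:
  "\<sigma> * sin \<alpha> = sqrt 3 / 2" "\<sigma> * cos \<alpha> = (2 * \<rho> + 1) / 2"
  "\<sigma> * sin \<beta> = \<rho> * (sqrt 3 / 2)" "\<sigma> * cos \<beta> = (2 + \<rho>) / 2"
proof -
  have nz: "sin \<alpha> \<noteq> 0" using pos sum sin_gt_zero[of \<alpha>] by simp
  show sin: "\<sigma> * sin \<alpha> = sqrt 3 / 2" using sigma sin_60 by simp
  then show "\<sigma> * sin \<beta> = \<rho> * (sqrt 3 / 2)" unfolding rho by (simp add: mult.left_commute)
  have "sin \<beta> = sin (pi / 3) * cos \<alpha> - cos (pi / 3) * sin \<alpha>"
    "sin \<alpha> = sin (pi / 3) * cos \<beta> - cos (pi / 3) * sin \<beta>"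
    unfolding sin_diff[symmetric] using sum by (auto intro: arg_cong[where f = sin])
  then have "\<rho> * sin \<alpha> = \<sigma> * sin \<alpha> * cos \<alpha> - 1 / 2 * sin \<alpha>"
    and "sin \<alpha> = \<sigma> * sin \<alpha> * cos \<beta> - 1 / 2 * (\<rho> * sin \<alpha>)"
    unfolding rho sigma cos_60 .
  then have "(\<sigma> * cos \<alpha> - (2 * \<rho> + 1) / 2) * sin \<alpha> = 0" "(\<sigma> * cos \<beta> - (2 + \<rho>) / 2) * sin \<alpha> = 0"
    by (simp_all add: algebra_simps add_divide_distrib)
  then show "\<sigma> * cos \<alpha> = (2 * \<rho> + 1) / 2" "\<sigma> * cos \<beta> = (2 + \<rho>) / 2" using nz by simp_all
qed

lemma sigma_squared_rational: "\<sigma>\<^sup>2 \<in> \<rat>"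
proof -
  have "\<sigma>\<^sup>2 = (\<sigma> * sin \<alpha>)\<^sup>2 + (\<sigma> * cos \<alpha>)\<^sup>2"
    by (simp add: power_mult_distrib flip: distrib_left)
  also have "\<dots> = 3 / 4 + ((2 * \<rho> + 1) / 2)\<^sup>2" unfolding sigma_trig by (simp add: power_divide)
  also have "\<dots> \<in> \<rat>" using rho_rational by simp
  finally show ?thesis .
qed

text \<open>\<open>\<sigma>\<^sup>n e\<^sup>i\<^sup>x\<close> lies in the field generated by \<open>i \<surd>3\<close>.\<close>

definition rational_point :: "nat \<Rightarrow> real \<Rightarrow> bool" where
  "rational_point n x \<longleftrightarrow> \<sigma> ^ n * cos x \<in> \<rat> \<and> \<sigma> ^ n * sin x / sqrt 3 \<in> \<rat>"

lemma rational_point_add: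
  assumes "rational_point m x" "rational_point n y"
  shows "rational_point (m + n) (x + y)"
proof -
  define a b a' b' where "a = \<sigma> ^ m * cos x" and "b = \<sigma> ^ m * sin x / sqrt 3"
    and "a' = \<sigma> ^ n * cos y" and "b' = \<sigma> ^ n * sin y / sqrt 3"
  have sin: "\<sigma> ^ m * sin x = b * sqrt 3" "\<sigma> ^ n * sin y = b' * sqrt 3" by (simp_all add: b_def b'_def)
  have "\<sigma> ^ (m + n) * cos (x + y) = (\<sigma> ^ m * cos x) * (\<sigma> ^ n * cos y) - (\<sigma> ^ m * sin x) * (\<sigma> ^ n * sin y)"
    by (simp add: cos_add power_add algebra_simps)
  also have "\<dots> = a * a' - 3 * (b * b')" unfolding sin by (simp add: a_def a'_def)
  finally have cos: "\<sigma> ^ (m + n) * cos (x + y) = a * a' - 3 * (b * b')" .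
  have "\<sigma> ^ (m + n) * sin (x + y) = (\<sigma> ^ m * sin x) * (\<sigma> ^ n * cos y) + (\<sigma> ^ m * cos x) * (\<sigma> ^ n * sin y)"
    by (simp add: sin_add power_add algebra_simps)
  also have "\<dots> = (b * a' + a * b') * sqrt 3" unfolding sin by (simp add: a_def a'_def algebra_simps)
  finally have sin: "\<sigma> ^ (m + n) * sin (x + y) / sqrt 3 = b * a' + a * b'" by simp
  have "a \<in> \<rat>" "b \<in> \<rat>" "a' \<in> \<rat>" "b' \<in> \<rat>"
    using assms unfolding rational_point_def a_def b_def a'_def b'_def by blast+
  then show ?thesis unfolding rational_point_def cos sin by simp
qed

lemma rational_point_multiple: "rational_point m x \<Longrightarrow> rational_point (k * m) (real k * x)"
proof (induction k)
  case 0
  then show ?case by (simp add: rational_point_def)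
next
  case (Suc k)
  then show ?case using rational_point_add[of m x "k * m" "real k * x"] by (simp add: algebra_simps)
qed

lemma rational_point_corner: "rational_point (p + q) (corner p q)"
proof -
  have "rational_point 1 \<alpha>" "rational_point 1 \<beta>"
    using rho_rational by (simp_all add: rational_point_def sigma_trig)
  then show ?thesis
    using rational_point_add rational_point_multiple[of 1 \<alpha> p] rational_point_multiple[of 1 \<beta> q]
    by (simp add: corner_def)
qed

lemma corner_sine_rational:
  "((- 1) ^ q + (- 1) ^ p) * sin (corner p q) / sqrt 3 \<in> \<rat>"
  "\<sigma> * (((- 1) ^ q - (- 1) ^ p) * sin (corner p q)) / sqrt 3 \<in> \<rat>"
proof -
  define r where "r = \<sigma> ^ (p + q) * sin (corner p q) / sqrt 3"
  have r: "r \<in> \<rat>" using rational_point_corner by (simp add: r_def rational_point_def)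
  have even_power: "\<sigma> ^ n \<in> \<rat>" if "even n" for n
    using that sigma_squared_rational by (auto elim!: evenE simp: power_mult)
  have even: "sin (corner p q) / sqrt 3 \<in> \<rat>" if "even (p + q)"
  proof -
    have "sin (corner p q) / sqrt 3 = r / \<sigma> ^ (p + q)" using sigma_nonzero by (simp add: r_def)
    then show ?thesis using r even_power[OF that] by simp
  qed
  have odd: "\<sigma> * sin (corner p q) / sqrt 3 \<in> \<rat>" if "odd (p + q)"
  proof -
    have "\<sigma> * sin (corner p q) / sqrt 3 = \<sigma>\<^sup>2 * r / \<sigma> ^ (p + q + 1)"
      using sigma_nonzero by (simp add: r_def power2_eq_square)
    then show ?thesis using r even_power[of "p + q + 1"] sigma_squared_rational that by simp
  qed
  show "((- 1) ^ q + (- 1) ^ p) * sin (corner p q) / sqrt 3 \<in> \<rat>"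
    using even
    by (cases "even p"; cases "even q") (simp_all add: minus_one_power_iff flip: times_divide_eq_right)
  show "\<sigma> * (((- 1) ^ q - (- 1) ^ p) * sin (corner p q)) / sqrt 3 \<in> \<rat>"
    using odd
    by (cases "even p"; cases "even q")
      (simp_all add: minus_one_power_iff mult.left_commute[of \<sigma>] flip: times_divide_eq_right)
qed

lemma signed_sines_conjugate:
  fixes p1 q1 p2 q2 p3 q3 :: nat
  defines "P \<equiv> signed_sines q1 q2 q3 (corner p1 q1) (corner p2 q2) (corner p3 q3)"
    and "Q \<equiv> signed_sines p1 p2 p3 (corner p1 q1) (corner p2 q2) (corner p3 q3)"
  shows "(P + Q) / sqrt 3 \<in> \<rat>" "\<sigma> * (P - Q) / sqrt 3 \<in> \<rat>"
proof -
  have "(P + Q) / sqrt 3 = ((- 1) ^ q1 + (- 1) ^ p1) * sin (corner p1 q1) / sqrt 3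
      + ((- 1) ^ q2 + (- 1) ^ p2) * sin (corner p2 q2) / sqrt 3
      + ((- 1) ^ q3 + (- 1) ^ p3) * sin (corner p3 q3) / sqrt 3"
    by (simp add: P_def Q_def signed_sines_def algebra_simps add_divide_distrib)
  also have "\<dots> \<in> \<rat>" by (intro Rats_add corner_sine_rational)
  finally show "(P + Q) / sqrt 3 \<in> \<rat>" .
  have "\<sigma> * (P - Q) / sqrt 3 = \<sigma> * (((- 1) ^ q1 - (- 1) ^ p1) * sin (corner p1 q1)) / sqrt 3
      + \<sigma> * (((- 1) ^ q2 - (- 1) ^ p2) * sin (corner p2 q2)) / sqrt 3
      + \<sigma> * (((- 1) ^ q3 - (- 1) ^ p3) * sin (corner p3 q3)) / sqrt 3"
    by (simp add: P_def Q_def signed_sines_def algebra_simps add_divide_distrib diff_divide_distrib)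
  also have "\<dots> \<in> \<rat>" by (intro Rats_add corner_sine_rational)
  finally show "\<sigma> * (P - Q) / sqrt 3 \<in> \<rat>" .
qed

lemma signed_sines_products_conjugate:
  fixes p1 q1 p2 q2 p3 q3 p1' q1' p2' q2' p3' q3' :: nat
  defines "P \<equiv> signed_sines q1 q2 q3 (corner p1 q1) (corner p2 q2) (corner p3 q3)"
    and "Q \<equiv> signed_sines p1 p2 p3 (corner p1 q1) (corner p2 q2) (corner p3 q3)"
    and "P' \<equiv> signed_sines q1' q2' q3' (corner p1' q1') (corner p2' q2') (corner p3' q3')"
    and "Q' \<equiv> signed_sines p1' p2' p3' (corner p1' q1') (corner p2' q2') (corner p3' q3')"
  shows "P * Q' + Q * P' \<in> \<rat>" "\<sigma> * (P * Q' - Q * P') \<in> \<rat>"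
proof -
  define A B where "A = (P + Q) / sqrt 3" and "B = \<sigma> * (P - Q) / sqrt 3"
  define A' B' where "A' = (P' + Q') / sqrt 3" and "B' = \<sigma> * (P' - Q') / sqrt 3"
  have rational: "A \<in> \<rat>" "B \<in> \<rat>" "A' \<in> \<rat>" "B' \<in> \<rat>"
    unfolding A_def B_def A'_def B'_def P_def Q_def P'_def Q'_def by (rule signed_sines_conjugate)+
  have sums: "P + Q = A * sqrt 3" "\<sigma> * (P - Q) = B * sqrt 3" "P' + Q' = A' * sqrt 3"
    "\<sigma> * (P' - Q') = B' * sqrt 3"
    by (simp_all add: A_def B_def A'_def B'_def)
  have sqrt3: "x * sqrt 3 * (y * sqrt 3) = 3 * (x * y)" for x y
    using real_sqrt_mult_self[of 3] by (simp add: mult.left_commute mult.assoc)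
  have "2 * \<sigma>\<^sup>2 * (P * Q' + Q * P') = \<sigma>\<^sup>2 * ((P + Q) * (P' + Q')) - (\<sigma> * (P - Q)) * (\<sigma> * (P' - Q'))"
    by (simp add: power2_eq_square algebra_simps)
  also have "\<dots> = 3 * (\<sigma>\<^sup>2 * (A * A') - B * B')" unfolding sums sqrt3 by simp
  finally have "P * Q' + Q * P' = 3 * (\<sigma>\<^sup>2 * (A * A') - B * B') / (2 * \<sigma>\<^sup>2)"
    using sigma_nonzero by (simp add: field_simps)
  then show "P * Q' + Q * P' \<in> \<rat>" using rational sigma_squared_rational by simp
  have "2 * (\<sigma> * (P * Q' - Q * P')) = (\<sigma> * (P - Q)) * (P' + Q') - (P + Q) * (\<sigma> * (P' - Q'))"
    by (simp add: algebra_simps)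
  also have "\<dots> = 3 * (B * A' - A * B')" unfolding sums sqrt3 by simp
  finally have difference: "\<sigma> * (P * Q' - Q * P') = 3 * (B * A' - A * B') / 2" by simp
  show "\<sigma> * (P * Q' - Q * P') \<in> \<rat>" unfolding difference using rational by simp
qed

lemma abs_corner_sines:
  assumes sums: "p1 + p2 + p3 = 3" "q1 + q2 + q3 = 3" and nonzero: "p1 + q1 > 0" "p2 + q2 > 0" "p3 + q3 > 0"
    and exponents: "e1 + e2 + e3 = 3"
  shows "\<bar>signed_sines e1 e2 e3 (corner p1 q1) (corner p2 q2) (corner p3 q3)\<bar> =
      4 * (half_factor e1 (corner p1 q1) * half_factor e2 (corner p2 q2) * half_factor e3 (corner p3 q3))"
    and "signed_sines e1 e2 e3 (corner p1 q1) (corner p2 q2) (corner p3 q3) \<noteq> 0"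
proof -
  have corner: "0 < corner p1 q1" "0 < corner p2 q2" "0 < corner p3 q3"
    using nonzero by (simp_all only: corner_pos)
  moreover from this have "corner p1 q1 < pi" "corner p2 q2 < pi" "corner p3 q3 < pi"
    using corner_sum[OF sums] by linarith+
  ultimately have
    "0 < half_factor e1 (corner p1 q1) * half_factor e2 (corner p2 q2) * half_factor e3 (corner p3 q3)"
    by (intro mult_pos_pos half_factor_pos)
  moreover show eq: "\<bar>signed_sines e1 e2 e3 (corner p1 q1) (corner p2 q2) (corner p3 q3)\<bar> =
      4 * (half_factor e1 (corner p1 q1) * half_factor e2 (corner p2 q2) * half_factor e3 (corner p3 q3))"
    using corner corner_sum[OF sums] exponents by (rule abs_signed_sines)
  ultimately have "0 < \<bar>signed_sines e1 e2 e3 (corner p1 q1) (corner p2 q2) (corner p3 q3)\<bar>"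
    unfolding eq by simp
  then show "signed_sines e1 e2 e3 (corner p1 q1) (corner p2 q2) (corner p3 q3) \<noteq> 0" by simp
qed

lemma abs_tile_sines:
  "\<bar>signed_sines 0 1 2 \<alpha> \<beta> (2 * pi / 3)\<bar> = 4 * sin (pi / 3) * (sin (\<alpha> / 2) * cos (\<beta> / 2))"
  "\<bar>signed_sines 1 0 2 \<alpha> \<beta> (2 * pi / 3)\<bar> = 4 * sin (pi / 3) * (cos (\<alpha> / 2) * sin (\<beta> / 2))"
  using abs_signed_sines[of \<alpha> \<beta> "2 * pi / 3"] pos sum by (simp_all add: half_factor_def)

theorem signed_sines_not_proportional:
  fixes p1 q1 p2 q2 p3 q3 :: nat
  assumes sums: "p1 + p2 + p3 = 3" "q1 + q2 + q3 = 3" and nonzero: "p1 + q1 > 0" "p2 + q2 > 0" "p3 + q3 > 0"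
    and not_tile: "(2, 2) \<notin> {(p1, q1), (p2, q2), (p3, q3)}" and mn: "m \<in> \<rat>" "n \<in> \<rat>"
  shows "\<not> (signed_sines q1 q2 q3 (corner p1 q1) (corner p2 q2) (corner p3 q3) =
      m * k * signed_sines 0 1 2 \<alpha> \<beta> (2 * pi / 3) \<and>
    signed_sines p1 p2 p3 (corner p1 q1) (corner p2 q2) (corner p3 q3) =
      n * k * signed_sines 1 0 2 \<alpha> \<beta> (2 * pi / 3))"
proof
  define P Q where "P = signed_sines q1 q2 q3 (corner p1 q1) (corner p2 q2) (corner p3 q3)"
    and "Q = signed_sines p1 p2 p3 (corner p1 q1) (corner p2 q2) (corner p3 q3)"
  define P' Q' where "P' = signed_sines 0 1 2 \<alpha> \<beta> (2 * pi / 3)" and "Q' = signed_sines 1 0 2 \<alpha> \<beta> (2 * pi / 3)"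
  assume "signed_sines q1 q2 q3 (corner p1 q1) (corner p2 q2) (corner p3 q3) =
      m * k * signed_sines 0 1 2 \<alpha> \<beta> (2 * pi / 3) \<and>
    signed_sines p1 p2 p3 (corner p1 q1) (corner p2 q2) (corner p3 q3) =
      n * k * signed_sines 1 0 2 \<alpha> \<beta> (2 * pi / 3)"
  then have signs: "P = m * k * P'" "Q = n * k * Q'" by (simp_all add: P_def Q_def P'_def Q'_def)
  define H where
    "H e1 e2 e3 = half_factor e1 (corner p1 q1) * half_factor e2 (corner p2 q2) * half_factor e3 (corner p3 q3)"
    for e1 e2 e3
  note corner_sines = abs_corner_sines[OF sums nonzero sums(2), folded P_def H_def]
    abs_corner_sines[OF sums nonzero sums(1), folded Q_def H_def]
  have "m \<noteq> 0" "n \<noteq> 0" using signs corner_sines by auto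
  moreover have "n * (P * Q') = m * (Q * P')"
    using signs by simp
  moreover have "corner 1 0 = \<alpha>" "corner 0 1 = \<beta>" "corner 2 2 = 2 * pi / 3"
    using sum by (simp_all add: corner_def)
  note signed_sines_products_conjugate[of q1 q2 q3 p1 p2 p3 1 0 2 0 1 2, unfolded this,
      folded P_def Q_def P'_def Q'_def]
  ultimately have "\<bar>P\<bar> * \<bar>Q'\<bar> = \<bar>Q\<bar> * \<bar>P'\<bar>"
    unfolding abs_mult[symmetric]
    using mn by (intro conjugates_rational_ratio[OF sigma_irrational, of _ _ n m]) simp_all
  then have "4 * (4 * sin (pi / 3)) * (H q1 q2 q3 * (cos (\<alpha> / 2) * sin (\<beta> / 2))) =
    4 * (4 * sin (pi / 3)) * (H p1 p2 p3 * (sin (\<alpha> / 2) * cos (\<beta> / 2)))"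
    unfolding corner_sines abs_tile_sines P'_def Q'_def by (simp only: ac_simps)
  then have "balanced p1 q1 p2 q2 p3 q3"
    unfolding balanced_def H_def by (subst (asm) mult_left_cancel) (simp_all add: sin_60)
  then show False using not_balanced[OF sums nonzero not_tile] by blast
qed

end

section \<open>Commensurability of the sides\<close>

context dissimilar_tiling
begin

lemma swapped: "dissimilar_tiling I tB tA tC X Y Z b a c \<beta> \<alpha>"
proof
  show "orient (tB i) (tA i) (tC i) \<noteq> 0" if "i \<in> I" for i
    using tile_nondegenerate[OF that] orient_swap(1)[of "tB i" "tA i" "tC i"] by simp
  show "interior (convex hull {tB i, tA i, tC i}) \<inter> interior (convex hull {tB j, tA j, tC j}) = {}"
    if "i \<in> I" "j \<in> I" "i \<noteq> j" for i j
    using tiles_disjoint[OF that] by (simp add: insert_commute)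
  show "(\<Union>i\<in>I. convex hull {tB i, tA i, tC i}) = convex hull {X, Y, Z}"
    using tiles_cover by (simp add: insert_commute)
  show "norm (tA i - tB i) = c" if "i \<in> I" for i
    using side_lengths(3)[OF that] by (simp add: norm_minus_commute)
  show "vertex_angle (tB i) (tC i) (tA i) = 2 * pi / 3" if "i \<in> I" for i
    using tile_angles(3)[OF that] by (simp add: vertex_angle_commute)
  show "\<beta> \<noteq> q * pi" if "q \<in> \<rat>" for q
  proof
    assume "\<beta> = q * pi"
    then have "\<alpha> = (1 / 3 - q) * pi" using angles_sum by (simp add: algebra_simps)
    then show False using alpha_irrational[of "1 / 3 - q"] that by simp
  qed
  show "{#vertex_angle Y X Z, vertex_angle X Y Z, vertex_angle X Z Y#} \<noteq> {#\<beta>, \<alpha>, 2 * pi / 3#}"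
    using dissimilar by (simp add: add_mset_commute)
qed (use finite_tiles nondegenerate side_lengths tile_angles angles_pos angles_sum in simp_all)

lemma swapped_counts:
  "dissimilar_tiling.num_alpha I tB = num_beta" "dissimilar_tiling.num_beta I tA = num_alpha"
  by (simp_all add: fun_eq_iff num_alpha_def num_beta_def dissimilar_tiling.num_alpha_def[OF swapped]
    dissimilar_tiling.num_beta_def[OF swapped])

lemma mixed_multipleE:
  obtains q :: real and j k :: nat where "q \<in> \<rat>" "q > 0" "q * a = j * b + k * c" "j + k > 0"
proof -
  obtain m i j k :: nat where m: "m * a = i * a + j * b + k * c" "j + k > 0"
    using mixed_multiple_exists unfolding mixed_length_def by blast
  then have eq: "(real m - real i) * a = j * b + k * c" by (simp add: left_diff_distrib)
  moreover have "0 < j * b + k * c"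
    using m(2) sides_pos by (cases "j > 0") (auto intro: add_pos_nonneg)
  ultimately have "real m - real i > 0" using sides_pos(1) by (metis zero_less_mult_pos2)
  then show thesis using that[of "real m - real i" j k] eq m(2) by simp
qed

lemma b_div_a_rational: "b / a \<in> \<rat>"
proof -
  interpret swap: dissimilar_tiling I tB tA tC X Y Z b a c \<beta> \<alpha> by (rule swapped)
  obtain q and j k :: nat where q: "q \<in> \<rat>" "q * a = j * b + k * c" "j + k > 0" by (rule mixed_multipleE)
  obtain q' and j' k' :: nat where q': "q' \<in> \<rat>" "q' > 0" "q' * b = j' * a + k' * c"
    by (rule swap.mixed_multipleE)
  show ?thesis
  proof (cases "k = 0")
    case True
    then have "b / a = q / j" using q(2,3) sides_pos by (simp add: field_simps)
    then show ?thesis using q(1) by simp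
  next
    case False
    have "k' * (q * a - j * b) = k * (q' * b - j' * a)" unfolding q(2) q'(3) by simp
    then have "(k' * q + k * j') * a = (k * q' + k' * j) * b" by (simp add: algebra_simps)
    moreover have "k * q' + k' * j > 0" using False q'(2) by (intro add_pos_nonneg) auto
    ultimately have "b / a = (k' * q + k * j') / (k * q' + k' * j)" using sides_pos by (simp add: field_simps)
    then show ?thesis using q(1) q'(1) by simp
  qed
qed

lemma tile_law_of_sines:
  obtains k where "k > 0" "a = k * sin \<alpha>" "b = k * sin \<beta>" "c = k * sin (2 * pi / 3)"
proof -
  obtain i where i: "i \<in> I" using tiles_nonempty by blast
  from tile_nondegenerate[OF i] show thesis
    by (rule law_of_sines) (use that in \<open>simp add: side_lengths[OF i] tile_angles[OF i]\<close>)
qed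

lemma c_longest_side: "a < c" "b < c"
proof -
  have "sin \<alpha> < sin (pi / 3)" "sin \<beta> < sin (pi / 3)"
    using angles_pos angles_sum by (auto intro!: sin_monotone_2pi)
  then show "a < c" "b < c"
    using tile_law_of_sines unfolding sin_60 sin_120 by (metis mult_less_cancel_left_pos)+
qed

lemma alpha_neq_beta: "\<alpha> \<noteq> \<beta>"
  using alpha_irrational[of "1 / 6"] angles_sum by auto

sublocale angles: tile_angles \<alpha> \<beta>
  using angles_pos angles_sum alpha_neq_beta by unfold_locales

lemma corner_counts_nonzero:
  "num_alpha X + num_beta X > 0" "num_alpha Y + num_beta Y > 0" "num_alpha Z + num_beta Z > 0"
  using corner_angle_bounds(1)[of X] corner_angle_bounds(1)[of Y] corner_angle_bounds(1)[of Z]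
  by (auto simp: corner_angle_at corner_angles intro: ccontr)

lemma tile_corner_excluded:
  "(2, 2) \<notin> {(num_alpha X, num_beta X), (num_alpha Y, num_beta Y), (num_alpha Z, num_beta Z)}"
proof
  assume tile: "(2, 2) \<in> {(num_alpha X, num_beta X), (num_alpha Y, num_beta Y), (num_alpha Z, num_beta Z)}"
  have other: "p = 1 \<and> q = 0 \<and> p' = 0 \<and> q' = 1 \<or> p = 0 \<and> q = 1 \<and> p' = 1 \<and> q' = 0"
    if "p + p' = 1" "q + q' = 1" "p + q > 0" "p' + q' > 0" for p q p' q' :: nat
    using that by linarith
  have gamma: "2 * \<alpha> + 2 * \<beta> = 2 * pi / 3" using angles_sum by simp
  note counts = corner_counts corner_counts_nonzero gamma
  from tile consider "num_alpha X = 2" "num_beta X = 2" | "num_alpha Y = 2" "num_beta Y = 2"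
    | "num_alpha Z = 2" "num_beta Z = 2"
    by auto
  then have "{#vertex_angle Y X Z, vertex_angle X Y Z, vertex_angle X Z Y#} = {#\<alpha>, \<beta>, 2 * pi / 3#}"
  proof cases
    case 1
    then show ?thesis using other[of "num_alpha Y" "num_alpha Z" "num_beta Y" "num_beta Z"] counts
      by (auto simp: corner_angles add_mset_commute)
  next
    case 2
    then show ?thesis using other[of "num_alpha X" "num_alpha Z" "num_beta X" "num_beta Z"] counts
      by (auto simp: corner_angles add_mset_commute)
  next
    case 3
    then show ?thesis using other[of "num_alpha X" "num_alpha Y" "num_beta X" "num_beta Y"] counts
      by (auto simp: corner_angles add_mset_commute)
  qed
  then show False using dissimilar by contradiction
qed

lemma c_div_a_rational: "c / a \<in> \<rat>"
proof (rule ccontr)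
  assume "c / a \<notin> \<rat>"
  interpret swap: dissimilar_tiling I tB tA tC X Y Z b a c \<beta> \<alpha> by (rule swapped)
  obtain k where k: "k > 0" "a = k * sin \<alpha>" "b = k * sin \<beta>" "c = k * sin (2 * pi / 3)"
    by (rule tile_law_of_sines)
  interpret rational_tile \<alpha> \<beta> "b / a" "c / a"
    using k sides_pos b_div_a_rational \<open>c / a \<notin> \<rat>\<close> by unfold_locales (auto simp: sin_60 sin_120)
  have "a - b + c \<noteq> 0" "b - a + c \<noteq> 0" using c_longest_side sides_pos by linarith+
  then obtain m n where m: "m \<in> \<rat>" "signed_perimeter = m * (a - b + c)"
    and n: "n \<in> \<rat>" "swap.signed_perimeter = n * (b - a + c)"
    using signed_perimeter_rational_multiple swap.signed_perimeter_rational_multiple by metis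
  obtain l where l: "l > 0" "norm (Z - Y) = l * sin (vertex_angle Y X Z)"
    "norm (Z - X) = l * sin (vertex_angle X Y Z)" "norm (Y - X) = l * sin (vertex_angle X Z Y)"
    using law_of_sines[OF nondegenerate] by blast
  let ?S = "\<lambda>i j k. signed_sines i j k (vertex_angle Y X Z) (vertex_angle X Y Z) (vertex_angle X Z Y)"
  have "l * ?S (num_beta X) (num_beta Y) (num_beta Z) =
      m * (k * signed_sines 0 1 2 \<alpha> \<beta> (2 * pi / 3))"
    using m(2) unfolding signed_perimeter_def l(2-4) k(2-4) by (simp add: signed_sines_def algebra_simps)
  then have beta_signs: "?S (num_beta X) (num_beta Y) (num_beta Z) =
      m * (k / l) * signed_sines 0 1 2 \<alpha> \<beta> (2 * pi / 3)"
    using l(1) by (simp add: field_simps)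
  have "l * ?S (num_alpha X) (num_alpha Y) (num_alpha Z) =
      n * (k * signed_sines 1 0 2 \<alpha> \<beta> (2 * pi / 3))"
    using n(2) unfolding swap.signed_perimeter_def swapped_counts l(2-4) k(2-4)
    by (simp add: signed_sines_def algebra_simps)
  then have alpha_signs: "?S (num_alpha X) (num_alpha Y) (num_alpha Z) =
      n * (k / l) * signed_sines 1 0 2 \<alpha> \<beta> (2 * pi / 3)"
    using l(1) by (simp add: field_simps)
  have corners: "vertex_angle Y X Z = angles.corner (num_alpha X) (num_beta X)"
    "vertex_angle X Y Z = angles.corner (num_alpha Y) (num_beta Y)"
    "vertex_angle X Z Y = angles.corner (num_alpha Z) (num_beta Z)"
    by (simp_all add: corner_angles angles.corner_def)
  show False
    using signed_sines_not_proportional[OF corner_counts corner_counts_nonzero tile_corner_excluded m(1) n(1)]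
      beta_signs alpha_signs unfolding corners by blast
qed

theorem sides_commensurable:
  assumes "s \<in> {a, b, c}" "t \<in> {a, b, c}"
  shows "s / t \<in> \<rat>"
proof -
  have "s / a \<in> \<rat>" "t / a \<in> \<rat>"
    using assms b_div_a_rational c_div_a_rational sides_pos(1) by auto
  then have "(s / a) / (t / a) \<in> \<rat>" by (rule Rats_divide)
  then show ?thesis using sides_pos(1) by simp
qed

end

section \<open>Similar triangles\<close>

lemma scaling_convex_hull:
  fixes f :: "'a::real_inner \<Rightarrow> 'a"
  assumes "\<And>x y. dist (f x) (f y) = k * dist x y"
  shows "f ` (convex hull S) = convex hull (f ` S)"
proof -
  have "linear (\<lambda>x. - f 0 + f x)"
    by (rule scaling_linear[of _ k]) (simp, simp only: dist_add_cancel assms simp_thms)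
  then have "(\<lambda>x. - f 0 + f x) ` (convex hull S) = convex hull ((\<lambda>x. - f 0 + f x) ` S)"
    by (rule convex_hull_linear_image)
  then have "(+) (f 0) ` (\<lambda>x. - f 0 + f x) ` (convex hull S) = convex hull ((+) (f 0) ` (\<lambda>x. - f 0 + f x) ` S)"
    by (simp only: convex_hull_translation)
  then show ?thesis by (simp add: image_image)
qed

lemma scaling_between_triangles:
  fixes P Q R P' Q' R' :: complex
  assumes h: "\<And>x y. norm (h x - h y) = norm (x - y)" and ne: "P \<noteq> Q" "P' \<noteq> Q'"
    and ratio: "(R' - P') / (Q' - P') = (h R - h P) / (h Q - h P)"
  shows "\<exists>k>0. \<exists>f. (\<forall>x y. dist (f x) (f y) = k * dist x y) \<and> f ` (convex hull {P, Q, R}) =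
      convex hull {P', Q', R'}"
proof -
  define d where "d = (Q' - P') / (h Q - h P)"
  define f where "f z = P' + d * (h z - h P)" for z
  have hne: "h Q - h P \<noteq> 0" using h[of Q P] ne(1) by auto
  then have "norm d > 0" using ne by (simp add: d_def)
  moreover have scale: "dist (f x) (f y) = norm d * dist x y" for x y
    by (simp add: dist_norm f_def h norm_mult flip: right_diff_distrib)
  moreover have "f P = P'" "f Q = Q'" using hne by (simp_all add: f_def d_def)
  moreover have "f R = R'"
  proof -
    have "d * (h R - h P) = (Q' - P') * ((h R - h P) / (h Q - h P))" by (simp add: d_def)
    also have "\<dots> = R' - P'" unfolding ratio[symmetric] using ne by simp
    finally show ?thesis by (simp add: f_def)
  qed
  ultimately have "f ` (convex hull {P, Q, R}) = convex hull {P', Q', R'}"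
    using scaling_convex_hull[of f "norm d" "{P, Q, R}"] by simp
  then show ?thesis using \<open>norm d > 0\<close> scale by blast
qed

lemma ratio_eq_angles:
  assumes "orient A B C \<noteq> 0"
  shows "norm ((C - A) / (B - A)) = sin (vertex_angle A B C) / sin (vertex_angle A C B)"
    and "Re ((C - A) / (B - A)) = norm ((C - A) / (B - A)) * cos (vertex_angle B A C)"
proof -
  from assms show "norm ((C - A) / (B - A)) = sin (vertex_angle A B C) / sin (vertex_angle A C B)"
    by (rule law_of_sines) (simp add: norm_divide)
  have "A \<noteq> B" "A \<noteq> C" using assms by auto
  then show "Re ((C - A) / (B - A)) = norm ((C - A) / (B - A)) * cos (vertex_angle B A C)"
    by (simp add: cos_sin_vertex_angle(3)[OF assms] Re_divide_inner norm_divide power2_eq_square)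
qed

lemma equal_angles_imp_scaling:
  assumes nd: "orient P Q R \<noteq> 0" "orient P' Q' R' \<noteq> 0"
    and angles: "vertex_angle Q P R = vertex_angle Q' P' R'" "vertex_angle P Q R = vertex_angle P' Q' R'"
      "vertex_angle P R Q = vertex_angle P' R' Q'"
  shows "\<exists>k>0. \<exists>f. (\<forall>x y. dist (f x) (f y) = k * dist x y) \<and> f ` (convex hull {P, Q, R}) =
      convex hull {P', Q', R'}"
proof -
  define w w' where "w = (R - P) / (Q - P)" and "w' = (R' - P') / (Q' - P')"
  have norm: "norm w' = norm w"
    unfolding w_def w'_def ratio_eq_angles(1)[OF nd(1)] ratio_eq_angles(1)[OF nd(2)] angles ..
  moreover have Re: "Re w' = Re w"
    using norm unfolding w_def w'_def ratio_eq_angles(2)[OF nd(1)] ratio_eq_angles(2)[OF nd(2)] angles by simp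
  ultimately have "(Im w')\<^sup>2 = (Im w)\<^sup>2" by (metis cmod_power2 add_left_cancel)
  then have "w' = w \<or> w' = cnj w" using Re by (auto simp: complex_eq_iff power2_eq_iff)
  moreover have "P \<noteq> Q" "P' \<noteq> Q'" using nd by auto
  ultimately show ?thesis
    using scaling_between_triangles[of "\<lambda>z. z" P Q P' Q' R' R] scaling_between_triangles[of cnj P Q P' Q' R' R]
    by (auto simp: w_def w'_def simp flip: complex_cnj_diff)
qed

section \<open>Transport to the real plane\<close>

definition to_complex :: "real^2 \<Rightarrow> complex" where
  "to_complex x = Complex (x $ 1) (x $ 2)"

definition of_complex :: "complex \<Rightarrow> real^2" where
  "of_complex z = vector [Re z, Im z]"

lemma of_complex_to_complex [simp]: "of_complex (to_complex x) = x"
  by (simp add: of_complex_def to_complex_def vec_eq_iff forall_2)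

lemma to_complex_of_complex [simp]: "to_complex (of_complex z) = z"
  by (simp add: of_complex_def to_complex_def)

lemma bij_to_complex: "bij to_complex"
  by (rule o_bij[of of_complex]) (simp_all add: fun_eq_iff)

lemma linear_to_complex: "linear to_complex"
  by (intro linearI) (simp_all add: to_complex_def complex_eq_iff)

lemma dist_to_complex [simp]: "dist (to_complex x) (to_complex y) = dist x y"
  by (simp add: to_complex_def dist_norm cmod_def norm_vec_def L2_set_def sum_2)

lemma dist_of_complex [simp]: "dist (of_complex z) (of_complex w) = dist z w"
  using dist_to_complex[of "of_complex z" "of_complex w"] by simp

lemma to_complex_convex_hull: "to_complex ` (convex hull S) = convex hull (to_complex ` S)"
  by (rule convex_hull_linear_image[OF linear_to_complex])

lemma to_complex_interior: "to_complex ` interior S = interior (to_complex ` S)"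
  by (rule interior_bijective_linear_image[OF linear_to_complex bij_to_complex, symmetric])

lemma angle_eq_vertex_angle: "angle x y z = vertex_angle x y z"
  by (simp add: angle_def vertex_angle_def)

lemma vertex_angle_to_complex: "vertex_angle (to_complex x) (to_complex y) (to_complex z) = vertex_angle x y z"
  by (rule vertex_angle_cong_dist) simp_all

lemma collinear_cong_dist:
  fixes x y z :: "'a::euclidean_space" and x' y' z' :: "'b::euclidean_space"
  assumes "dist x y = dist x' y'" "dist y z = dist y' z'" "dist x z = dist x' z'"
  shows "collinear {x, y, z} \<longleftrightarrow> collinear {x', y', z'}"
  using assms by (simp add: collinear_between_cases between dist_commute)

lemma is_triangle_cong_dist:
  assumes "is_triangle x y z" "dist p q = dist x y" "dist q r = dist y z" "dist p r = dist x z"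
  shows "orient p q r \<noteq> 0"
  using assms collinear_cong_dist[of p q x y r z] by (simp add: is_triangle_def orient_eq_0_iff_collinear)

lemma similar_if_angles_eq:
  assumes "is_triangle A B C" "is_triangle U V W"
    and "vertex_angle B A C = vertex_angle V U W" "vertex_angle A B C = vertex_angle U V W"
    "vertex_angle A C B = vertex_angle U W V"
  shows "similar (triangle_region A B C) (triangle_region U V W)"
proof -
  have "orient (to_complex A) (to_complex B) (to_complex C) \<noteq> 0"
    "orient (to_complex U) (to_complex V) (to_complex W) \<noteq> 0"
    by (rule is_triangle_cong_dist[OF assms(1)]; simp) (rule is_triangle_cong_dist[OF assms(2)]; simp)
  from equal_angles_imp_scaling[OF this] obtain k f where k: "k > 0"
    and f: "\<And>x y. dist (f x) (f y) = k * dist x y"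
      "f ` (convex hull {to_complex A, to_complex B, to_complex C}) =
          convex hull {to_complex U, to_complex V, to_complex W}"
    using assms(3-5) unfolding vertex_angle_to_complex by blast
  define F where "F x = of_complex (f (to_complex x))" for x
  have "F ` triangle_region A B C = of_complex ` f ` to_complex ` (convex hull {A, B, C})"
    by (simp add: F_def image_image triangle_region_def)
  also have "\<dots> = of_complex ` to_complex ` (convex hull {U, V, W})"
    using f(2) by (simp add: to_complex_convex_hull)
  also have "\<dots> = triangle_region U V W" by (simp add: image_image triangle_region_def)
  finally have "F ` triangle_region A B C = triangle_region U V W" .
  moreover have "dist (F x) (F y) = k * dist x y" for x y by (simp add: F_def f(1))
  ultimately show ?thesis using k unfolding similar_def by blast
qed

lemma mset_3_eq_cases:
  assumes "{#x, y, z#} = {#p, q, r#}"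
  shows "x = p \<and> y = q \<and> z = r \<or> x = p \<and> y = r \<and> z = q \<or> x = q \<and> y = p \<and> z = r \<or>
    x = q \<and> y = r \<and> z = p \<or> x = r \<and> y = p \<and> z = q \<or> x = r \<and> y = q \<and> z = p"
  using assms by (auto simp: add_eq_conv_ex add_mset_eq_singleton_iff)

lemma similar_if_angle_mset_eq:
  assumes triangles: "is_triangle A B C" "is_triangle U V W"
    and "{#vertex_angle B A C, vertex_angle A B C, vertex_angle A C B#} =
      {#vertex_angle V U W, vertex_angle U V W, vertex_angle U W V#}"
  shows "similar (triangle_region A B C) (triangle_region U V W)"
proof -
  have similar: "similar (triangle_region A B C) (triangle_region U V W)"
    if "{P, Q, R} = {A, B, C}" "vertex_angle Q P R = vertex_angle V U W"
      "vertex_angle P Q R = vertex_angle U V W"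
      "vertex_angle P R Q = vertex_angle U W V" for P Q R
    using similar_if_angles_eq[of P Q R U V W] that triangles by (simp add: is_triangle_def triangle_region_def)
  have "{A, C, B} = {A, B, C}" "{B, A, C} = {A, B, C}" "{B, C, A} = {A, B, C}" "{C, A, B} = {A, B, C}"
    "{C, B, A} = {A, B, C}"
    by auto
  note similar = similar[OF refl] this[THEN similar]
  note commute = vertex_angle_commute[of C A B] vertex_angle_commute[of C B A] vertex_angle_commute[of B C A]
  from mset_3_eq_cases[OF assms(3)] show ?thesis
    by (elim disjE conjE) (rule similar; simp add: commute)+
qed

lemma finite_disjoint_balls:
  fixes \<T> :: "'a::euclidean_space set set"
  assumes bounded: "bounded (\<Union>\<T>)" and r: "r > 0" and balls: "\<And>S. S \<in> \<T> \<Longrightarrow> \<exists>x. ball x r \<subseteq> S"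
    and disjoint: "pairwise (\<lambda>S T. interior S \<inter> interior T = {}) \<T>"
  shows "finite \<T>"
proof -
  obtain m where m: "\<And>S. S \<in> \<T> \<Longrightarrow> ball (m S) r \<subseteq> S" using balls by metis
  then have interior: "ball (m S) r \<subseteq> interior S" if "S \<in> \<T>" for S
    using that by (simp add: interior_maximal)
  have separated: "r \<le> dist (m S) (m T)" if "S \<in> \<T>" "T \<in> \<T>" "S \<noteq> T" for S T
  proof (rule ccontr)
    assume "\<not> ?thesis"
    then have "m T \<in> ball (m S) r \<inter> ball (m T) r" using r by simp
    then show False using interior that disjoint unfolding pairwise_def by blast
  qed
  then have "inj_on m \<T>" using r by (intro inj_onI) (metis dist_self not_less)
  moreover have "uniform_discrete (m ` \<T>)" using r separated by (intro uniformI2[of r]) auto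
  moreover have "m S \<in> S" if "S \<in> \<T>" for S using m[OF that] r by (meson centre_in_ball subsetD)
  then have "bounded (m ` \<T>)" by (intro bounded_subset[OF bounded]) blast
  ultimately show ?thesis using uniform_discrete_finite_iff finite_imageD by blast
qed

lemma isometry_ball:
  fixes f :: "'a::euclidean_space \<Rightarrow> 'a"
  assumes "\<And>x y. dist (f x) (f y) = dist x y"
  shows "f ` ball x r = ball (f x) r"
proof -
  have "orthogonal_transformation (\<lambda>x. - f 0 + f x)"
    unfolding orthogonal_transformation_isometry dist_add_cancel using assms by simp
  then have "(\<lambda>x. - f 0 + f x) ` ball x r = ball (- f 0 + f x) r" by (rule image_orthogonal_transformation_ball)
  then have "(+) (f 0) ` (\<lambda>x. - f 0 + f x) ` ball x r = ball (f x) r" by (simp add: ball_translation)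
  then show ?thesis by (simp add: image_image)
qed

lemma is_tiling_finite:
  assumes tile: "is_triangle U V W" and tiling: "is_tiling \<T> (triangle_region A B C) (triangle_region U V W)"
  shows "finite \<T>"
proof -
  have "interior (triangle_region U V W) \<noteq> {}"
    using tile interior_convex_hull_3_nonempty[of U V W] by (simp add: triangle_region_def is_triangle_def)
  then obtain x r where r: "r > 0" "ball x r \<subseteq> triangle_region U V W"
    by (auto simp: mem_interior)
  show ?thesis
  proof (rule finite_disjoint_balls)
    fix S assume "S \<in> \<T>"
    then obtain f where "\<And>x y. dist (f x) (f y) = dist x y" "f ` triangle_region U V W = S"
      using tiling unfolding is_tiling_def congruent_sets_def by blast
    then have "ball (f x) r \<subseteq> S" using isometry_ball[of f x r] r(2) by blast
    then show "\<exists>y. ball y r \<subseteq> S" ..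
  next
    have "bounded (triangle_region A B C)"
      unfolding triangle_region_def by (intro bounded_convex_hull finite_imp_bounded) simp
    then show "bounded (\<Union>\<T>)" using tiling by (simp add: is_tiling_def)
  qed (use r tiling in \<open>simp_all add: is_tiling_def\<close>)
qed

lemma is_tiling_imp_triangle_tiling:
  assumes tile: "is_triangle U V W" and big: "is_triangle A B C"
    and tiling: "is_tiling \<T> (triangle_region A B C) (triangle_region U V W)"
  obtains F :: "(real^2) set \<Rightarrow> real^2 \<Rightarrow> complex"
  where "triangle_tiling \<T> (\<lambda>S. F S U) (\<lambda>S. F S V) (\<lambda>S. F S W) (to_complex A) (to_complex B) (to_complex C)"
    "\<And>S x y. S \<in> \<T> \<Longrightarrow> dist (F S x) (F S y) = dist x y"
proof -
  obtain G where G: "\<And>S x y. S \<in> \<T> \<Longrightarrow> dist (G S x) (G S y) = dist x y"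
    and image: "\<And>S. S \<in> \<T> \<Longrightarrow> G S ` triangle_region U V W = S"
    using tiling unfolding is_tiling_def congruent_sets_def by metis
  define F where "F S x = to_complex (G S x)" for S x
  have F: "dist (F S x) (F S y) = dist x y" if "S \<in> \<T>" for S x y by (simp add: F_def G[OF that])
  have region: "convex hull {F S U, F S V, F S W} = to_complex ` S" if S: "S \<in> \<T>" for S
  proof -
    have "S = convex hull (G S ` {U, V, W})"
      using scaling_convex_hull[of "G S" 1 "{U, V, W}"] G[OF S] image[OF S] by (simp add: triangle_region_def)
    then have "to_complex ` S = convex hull (to_complex ` G S ` {U, V, W})" by (metis to_complex_convex_hull)
    then show ?thesis by (simp add: F_def)
  qed
  have "triangle_tiling \<T> (\<lambda>S. F S U) (\<lambda>S. F S V) (\<lambda>S. F S W) (to_complex A) (to_complex B) (to_complex C)"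
  proof
    show "finite \<T>" using tile tiling by (rule is_tiling_finite)
    show "orient (F S U) (F S V) (F S W) \<noteq> 0" if "S \<in> \<T>" for S
      using tile by (rule is_triangle_cong_dist) (rule F[OF that])+
    show "orient (to_complex A) (to_complex B) (to_complex C) \<noteq> 0"
      using big by (rule is_triangle_cong_dist) simp_all
    show "interior (convex hull {F S U, F S V, F S W}) \<inter> interior (convex hull {F T U, F T V, F T W}) = {}"
      if "S \<in> \<T>" "T \<in> \<T>" "S \<noteq> T" for S T
    proof -
      have "interior S \<inter> interior T = {}" using tiling that unfolding is_tiling_def pairwise_def by blast
      then have "to_complex ` interior S \<inter> to_complex ` interior T = {}"
        by (simp add: bij_is_inj[OF bij_to_complex] flip: image_Int)
      then show ?thesis using that by (simp add: region to_complex_interior)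
    qed
    have "(\<Union>S\<in>\<T>. to_complex ` S) = to_complex ` triangle_region A B C"
      using tiling unfolding is_tiling_def by blast
    then show "(\<Union>S\<in>\<T>. convex hull {F S U, F S V, F S W}) =
        convex hull {to_complex A, to_complex B, to_complex C}"
      by (simp add: region triangle_region_def to_complex_convex_hull)
  qed
  then show thesis using that F by blast
qed

lemma obtuse_tile_angles:
  assumes tile: "is_triangle U V W" and gamma: "angle U W V = 2 * pi / 3" and "\<not> commensurable_angles U V W"
  shows "vertex_angle V U W > 0" "vertex_angle U V W > 0" "vertex_angle V U W + vertex_angle U V W = pi / 3"
    and "q \<in> \<rat> \<Longrightarrow> vertex_angle V U W \<noteq> q * pi"
proof -
  have nd: "orient (to_complex U) (to_complex V) (to_complex W) \<noteq> 0"
    "orient (to_complex V) (to_complex U) (to_complex W) \<noteq> 0"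
    using tile is_triangle_cong_dist[of U V W] is_triangle_cong_dist[of V U W]
    by (simp_all add: is_triangle_def insert_commute)
  show "vertex_angle V U W > 0" "vertex_angle U V W > 0"
    using vertex_angle_bounds[OF nd(1)] vertex_angle_bounds[OF nd(2)] by (simp_all add: vertex_angle_to_complex)
  show sum: "vertex_angle V U W + vertex_angle U V W = pi / 3"
    using triangle_angle_sum[OF nd(1)] gamma by (simp add: vertex_angle_to_complex angle_eq_vertex_angle)
  show "vertex_angle V U W \<noteq> q * pi" if "q \<in> \<rat>"
  proof
    assume alpha: "vertex_angle V U W = q * pi"
    then have beta: "vertex_angle U V W = (1 / 3 - q) * pi" using sum by (simp add: algebra_simps)
    have "vertex_angle U W V = 2 / 3 * pi" using gamma by (simp add: angle_eq_vertex_angle)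
    moreover have "1 / 3 - q \<in> \<rat>" "(2 / 3 :: real) \<in> \<rat>" using that by simp_all
    ultimately have "commensurable_angles U V W"
      unfolding commensurable_angles_def angle_eq_vertex_angle using alpha beta that by blast
    then show False using assms(3) by contradiction
  qed
qed

lemma is_tiling_imp_dissimilar_tiling:
  assumes tile: "is_triangle U V W" "angle U W V = 2 * pi / 3" "\<not> commensurable_angles U V W"
    and big: "is_triangle A B C" "\<not> similar (triangle_region A B C) (triangle_region U V W)"
    and tiling: "is_tiling \<T> (triangle_region A B C) (triangle_region U V W)"
  obtains tA tB tC where "dissimilar_tiling \<T> tA tB tC (to_complex A) (to_complex B) (to_complex C)
    (dist V W) (dist U W) (dist U V) (angle V U W) (angle U V W)"
proof -
  obtain F :: "(real^2) set \<Rightarrow> real^2 \<Rightarrow> complex"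
    where F: "triangle_tiling \<T> (\<lambda>S. F S U) (\<lambda>S. F S V) (\<lambda>S. F S W)
        (to_complex A) (to_complex B) (to_complex C)"
      "\<And>S x y. S \<in> \<T> \<Longrightarrow> dist (F S x) (F S y) = dist x y"
    using tile(1) big(1) tiling by (rule is_tiling_imp_triangle_tiling) blast
  have gamma: "vertex_angle U W V = 2 * pi / 3" using tile(2) by (simp add: angle_eq_vertex_angle)
  have norm: "norm (F S y - F S x) = dist x y" if "S \<in> \<T>" for S x y
    using F(2)[OF that, of y x] by (simp add: dist_norm norm_minus_commute)
  have angle: "vertex_angle (F S x) (F S y) (F S z) = vertex_angle x y z" if "S \<in> \<T>" for S x y z
    by (rule vertex_angle_cong_dist) (rule F(2)[OF that])+
  interpret triangle_tiling \<T> "\<lambda>S. F S U" "\<lambda>S. F S V" "\<lambda>S. F S W" "to_complex A" "to_complex B" "to_complex C"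
    by (rule F(1))
  show thesis
  proof (rule that, unfold angle_eq_vertex_angle, unfold_locales)
    show "{#vertex_angle (to_complex B) (to_complex A) (to_complex C),
        vertex_angle (to_complex A) (to_complex B) (to_complex C),
        vertex_angle (to_complex A) (to_complex C) (to_complex B)#} \<noteq>
      {#vertex_angle V U W, vertex_angle U V W, 2 * pi / 3#}"
      using similar_if_angle_mset_eq[OF big(1) tile(1)] big(2) unfolding vertex_angle_to_complex gamma by blast
  qed (simp_all add: norm angle gamma obtuse_tile_angles[OF tile])
qed

theorem theorem1p1:
  fixes U V W A B C :: "real^2" and a b c \<alpha> \<beta> \<gamma> :: real
  assumes "is_triangle U V W"
    and "a = dist V W" and "b = dist U W" and "c = dist U V"
    and "\<alpha> = angle V U W" and "\<beta> = angle U V W" and "\<gamma> = angle U W V"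
    and "\<gamma> = 2 * pi / 3"
    and "\<not> commensurable_angles U V W"
    and "is_triangle A B C"
    and "tiled_by (triangle_region A B C) (triangle_region U V W)"
    and "\<not> similar (triangle_region A B C) (triangle_region U V W)"
  shows "commensurable_sides U V W"
proof -
  obtain \<T> where tiling: "is_tiling \<T> (triangle_region A B C) (triangle_region U V W)"
    using assms(11) unfolding tiled_by_def by blast
  have gamma: "angle U W V = 2 * pi / 3" using assms(7,8) by simp
  obtain tA tB tC where "dissimilar_tiling \<T> tA tB tC (to_complex A) (to_complex B) (to_complex C)
      (dist V W) (dist U W) (dist U V) (angle V U W) (angle U V W)"
    using assms(1) gamma assms(9,10,12) tiling by (rule is_tiling_imp_dissimilar_tiling)
  then interpret dissimilar_tiling \<T> tA tB tC "to_complex A" "to_complex B" "to_complex C"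
    "dist V W" "dist U W" "dist U V" "angle V U W" "angle U V W" .
  show ?thesis unfolding commensurable_sides_def using sides_commensurable by blast
qed

end
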